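(* Let $p$ be a prime and fix an integer $m\ge 0$. Let $(b_k)_{k\ge 2m}$ be an even sequence of $p$-adic integers, i.e. $b_k\in\mathbb{Z}_p$ with $b_k=0$ for $k$ odd. Then the following are equivalent: (a) There exists a measure $\mu\in\mathrm{Meas}(\mathbb{Z}_p^*/\{\pm1\},\mathbb{Z}_p)$ with $$b_{2k}=\int_{\mathbb{Z}_p^*/\{\pm1\}}x^{2k}\,d\mu,\qquad k\ge m.$$ (b) For each $k\ge m$ we have $$b_{2k}\equiv\sum_{i=m}^{k-1}c^{(k-m,p)}_{2(i-m)}\,b_{2i}\mod C_p(k-m)\mathbb{Z}_p,$$ where $1/C_p(k-m)$ is the leading coefficient of $E^{(p)}_{2(k-m)}(X)$, i.e. $C_p(k-m)=\prod_{i\ge0}(p^i!)^{a_i}$ where $2(k-m)=a_0+\sum_{i\ge1}a_i\varphi(p^i)$ is the expansion by $\varphi$-digits, and the $c^{(k-m,p)}_{2(i-m)}$ are the integers determined by $$C_p(k-m)\,E^{(p)}_{2(k-m)}(X)\,X^{2m}=X^{2k}-\sum_{i=m}^{k-1}c^{(k-m,p)}_{2(i-m)}X^{2i}.$$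
   Context: $\mathrm{Meas}(\mathbb{Z}_p^*/\{\pm1\},\mathbb{Z}_p)$ is the set of $\mathbb{Z}_p$-valued measures, i.e. $\mathbb{Z}_p$-linear maps $\mu\colon C(\mathbb{Z}_p^*/\{\pm1\},\mathbb{Z}_p)\to\mathbb{Z}_p$ on continuous functions; $\int f\,d\mu:=\mu(f)$. Even functions on $\mathbb{Z}_p^*$ are regarded as functions on $\mathbb{Z}_p^*/\{\pm1\}$. Expansion by $\varphi$-digits: every integer $n\ge0$ can be uniquely written $n=a_0+\sum_{i\ge1}a_i\varphi(p^i)$ with $a_0\in\{0,\dots,p-2\}$ and $a_i\in\{0,\dots,p-1\}$ for $i\ge1$ ($\varphi$ is Euler's totient function). Polynomials $E_n^{(p)}$: for $a\in\mathbb{Z}/p^j\mathbb{Z}$ let $\tilde a$ be its unique integer lift in $\{-\lfloor p^j/2\rfloor,\dots,p^j-1-\lfloor p^j/2\rfloor\}$. Put $e_0^{(p)}:=X$ and, for $j\ge1$, $e_j^{(p)}:=\frac{1}{(p^j)!}\prod_{a\in(\mathbb{Z}/p^j\mathbb{Z})^\times}(X-\tilde a)\in\mathbb{Q}[X]$. For $n\ge0$ with $\varphi$-digits $(a_j)$ put $E_n^{(p)}:=\prod_{j\ge0}(e_j^{(p)})^{a_j}$, a polynomial of degree $n$ which is even if $n$ is even. *)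

theory Defs
  imports
    "HOL-Number_Theory.Residues"
    "HOL-Analysis.Function_Topology"
    "HOL-Computational_Algebra.Polynomial"
begin

section \<open>The ring of p-adic integers\<close>

text \<open>The inverse limit of the rings Z/p^n: a p-adic integer x is the coherent sequence of its
  reductions, x n being the representative of x mod p^n in {0..<p^n}. The topology is the inverse
  limit topology, which is the p-adic one.\<close>

definition Zp :: "nat \<Rightarrow> (nat \<Rightarrow> int) ring" where
  "Zp p = \<lparr>carrier = {x. \<forall>n. x n \<in> {0..<int p ^ n} \<and> x (Suc n) mod int p ^ n = x n},
     monoid.mult = (\<lambda>x y n. (x n * y n) mod int p ^ n),
     Group.monoid.one = (\<lambda>n. 1 mod int p ^ n),
     Ring.ring.zero = (\<lambda>n. 0),
     Ring.ring.add = (\<lambda>x y n. (x n + y n) mod int p ^ n)\<rparr>"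

definition Zp_topology :: "nat \<Rightarrow> (nat \<Rightarrow> int) topology" where
  "Zp_topology p =
     subtopology (product_topology (\<lambda>_. discrete_topology UNIV) UNIV) (carrier (Zp p))"

lemma cring_Zp:
  assumes "p > 0"
  shows "cring (Zp p)"
proof (intro cringI abelian_groupI Group.comm_monoidI)
  have pos: "int p ^ n > 0" for n
    using assms by simp
  have coh: "(x (Suc n) mod (int p * int p ^ n)) mod int p ^ n = x (Suc n) mod int p ^ n"
    for x :: "nat \<Rightarrow> int" and n
    by (simp add: mod_mod_cancel)
  have lo: "0 \<le> a mod int p ^ n" "a mod int p ^ n < int p ^ n" for a n
    using pos[of n] by auto
  show "x \<oplus>\<^bsub>Zp p\<^esub> y \<in> carrier (Zp p)" if "x \<in> carrier (Zp p)" "y \<in> carrier (Zp p)" for x y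
    using that by (auto simp: Zp_def lo coh mod_mod_cancel) (metis mod_add_eq)
  show "x \<otimes>\<^bsub>Zp p\<^esub> y \<in> carrier (Zp p)" if "x \<in> carrier (Zp p)" "y \<in> carrier (Zp p)" for x y
    using that by (auto simp: Zp_def lo mod_mod_cancel) (metis mod_mult_eq)
  show "\<one>\<^bsub>Zp p\<^esub> \<in> carrier (Zp p)"
    by (auto simp: Zp_def lo mod_mod_cancel)
  show "\<zero>\<^bsub>Zp p\<^esub> \<in> carrier (Zp p)"
    using pos by (auto simp: Zp_def)
  show "\<exists>y\<in>carrier (Zp p). y \<oplus>\<^bsub>Zp p\<^esub> x = \<zero>\<^bsub>Zp p\<^esub>" if "x \<in> carrier (Zp p)" for x
  proof
    show "(\<lambda>n. (- x n) mod int p ^ n) \<in> carrier (Zp p)"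
      using that by (auto simp: Zp_def lo mod_mod_cancel) (metis mod_minus_eq)
    show "(\<lambda>n. (- x n) mod int p ^ n) \<oplus>\<^bsub>Zp p\<^esub> x = \<zero>\<^bsub>Zp p\<^esub>"
      by (auto simp: Zp_def mod_simps)
  qed
qed (auto simp: Zp_def mod_simps algebra_simps)

section \<open>Measures on the units modulo the subgroup of order two\<close>

definition quotient_topology :: "'a topology \<Rightarrow> ('a \<Rightarrow> 'b) \<Rightarrow> 'b topology" where
  "quotient_topology X q =
     topology (\<lambda>U. U \<subseteq> q ` topspace X \<and> openin X {x \<in> topspace X. q x \<in> U})"

lemma openin_quotient_topology:
  "openin (quotient_topology X q) U \<longleftrightarrow> U \<subseteq> q ` topspace X \<and> openin X {x \<in> topspace X. q x \<in> U}"
proof -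
  have "istopology (\<lambda>U. U \<subseteq> q ` topspace X \<and> openin X {x \<in> topspace X. q x \<in> U})"
    unfolding istopology_def
  proof (intro conjI allI impI)
    fix S T
    assume "S \<subseteq> q ` topspace X \<and> openin X {x \<in> topspace X. q x \<in> S}"
      and "T \<subseteq> q ` topspace X \<and> openin X {x \<in> topspace X. q x \<in> T}"
    moreover have "{x \<in> topspace X. q x \<in> S \<inter> T} =
        {x \<in> topspace X. q x \<in> S} \<inter> {x \<in> topspace X. q x \<in> T}"
      by auto
    ultimately show "S \<inter> T \<subseteq> q ` topspace X" "openin X {x \<in> topspace X. q x \<in> S \<inter> T}"
      by auto
  next
    fix \<K>
    assume "\<forall>K\<in>\<K>. K \<subseteq> q ` topspace X \<and> openin X {x \<in> topspace X. q x \<in> K}"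
    moreover have "{x \<in> topspace X. q x \<in> \<Union>\<K>} = (\<Union>K\<in>\<K>. {x \<in> topspace X. q x \<in> K})"
      by auto
    ultimately show "\<Union>\<K> \<subseteq> q ` topspace X" "openin X {x \<in> topspace X. q x \<in> \<Union>\<K>}"
      by auto
  qed
  then show ?thesis
    unfolding quotient_topology_def by simp
qed

lemma quotient_map_quotient_topology: "quotient_map X (quotient_topology X q) q"
proof -
  have "topspace (quotient_topology X q) = q ` topspace X"
  proof
    show "topspace (quotient_topology X q) \<subseteq> q ` topspace X"
      using openin_topspace[of "quotient_topology X q"] by (simp only: openin_quotient_topology)
    have "{x \<in> topspace X. q x \<in> q ` topspace X} = topspace X"
      by auto
    then have "openin (quotient_topology X q) (q ` topspace X)"
      by (simp add: openin_quotient_topology)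
    then show "q ` topspace X \<subseteq> topspace (quotient_topology X q)"
      by (rule openin_subset)
  qed
  then show ?thesis
    unfolding quotient_map_def
    by (intro conjI allI impI) (simp_all only: openin_quotient_topology simp_thms)
qed

definition pm_one :: "nat \<Rightarrow> (nat \<Rightarrow> int) set" where
  "pm_one p = {\<one>\<^bsub>Zp p\<^esub>, \<ominus>\<^bsub>Zp p\<^esub> \<one>\<^bsub>Zp p\<^esub>}"

definition Zp_units_mod_pm :: "nat \<Rightarrow> (nat \<Rightarrow> int) set monoid" where
  "Zp_units_mod_pm p = units_of (Zp p) Mod pm_one p"

definition Zp_units_mod_pm_topology :: "nat \<Rightarrow> (nat \<Rightarrow> int) set topology" where
  "Zp_units_mod_pm_topology p =
     quotient_topology (subtopology (Zp_topology p) (Units (Zp p)))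
       (\<lambda>x. pm_one p #>\<^bsub>units_of (Zp p)\<^esub> x)"

text \<open>Continuous functions are taken extensional, so that they are determined by their values
  on the space.\<close>

definition cont_funs :: "nat \<Rightarrow> 'a topology \<Rightarrow> ('a \<Rightarrow> nat \<Rightarrow> int) set" where
  "cont_funs p X = {f \<in> extensional (topspace X). continuous_map X (Zp_topology p) f}"

definition Meas :: "nat \<Rightarrow> 'a topology \<Rightarrow> (('a \<Rightarrow> nat \<Rightarrow> int) \<Rightarrow> nat \<Rightarrow> int) set" where
  "Meas p X = {\<mu> \<in> cont_funs p X \<rightarrow>\<^sub>E carrier (Zp p).
     (\<forall>f\<in>cont_funs p X. \<forall>g\<in>cont_funs p X.
        \<mu> (\<lambda>x\<in>topspace X. f x \<oplus>\<^bsub>Zp p\<^esub> g x) = \<mu> f \<oplus>\<^bsub>Zp p\<^esub> \<mu> g) \<and>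
     (\<forall>c\<in>carrier (Zp p). \<forall>f\<in>cont_funs p X.
        \<mu> (\<lambda>x\<in>topspace X. c \<otimes>\<^bsub>Zp p\<^esub> f x) = c \<otimes>\<^bsub>Zp p\<^esub> \<mu> f)}"

text \<open>An even function on the units, regarded as a function on the quotient: its value at a
  class is the unique value that it takes on that class.\<close>

definition descend :: "nat \<Rightarrow> ((nat \<Rightarrow> int) \<Rightarrow> nat \<Rightarrow> int) \<Rightarrow> (nat \<Rightarrow> int) set \<Rightarrow> nat \<Rightarrow> int" where
  "descend p f = (\<lambda>A\<in>carrier (Zp_units_mod_pm p). the_elem (f ` A))"

lemma topspace_Zp_units_mod_pm_topology:
  "topspace (Zp_units_mod_pm_topology p) = carrier (Zp_units_mod_pm p)"
proof -
  have "topspace (Zp_topology p) = carrier (Zp p)"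
    by (simp add: Zp_topology_def)
  moreover have "Units (Zp p) \<subseteq> carrier (Zp p)"
    by (auto simp only: Units_def)
  ultimately have "topspace (subtopology (Zp_topology p) (Units (Zp p))) = Units (Zp p)"
    by (simp only: topspace_subtopology Int_absorb1)
  then have "topspace (Zp_units_mod_pm_topology p) =
      (\<lambda>x. pm_one p #>\<^bsub>units_of (Zp p)\<^esub> x) ` Units (Zp p)"
    using quotient_imp_surjective_map[OF quotient_map_quotient_topology,
        of "\<lambda>x. pm_one p #>\<^bsub>units_of (Zp p)\<^esub> x" "subtopology (Zp_topology p) (Units (Zp p))"]
    by (simp only: Zp_units_mod_pm_topology_def)
  then show ?thesis
    unfolding Zp_units_mod_pm_def FactGroup_def RCOSETS_def partial_object.simps units_of_carrier
    by (simp only: UNION_singleton_eq_range)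
qed

lemma descend_even:
  assumes "p > 0" and x: "x \<in> Units (Zp p)"
    and even: "\<And>x. x \<in> Units (Zp p) \<Longrightarrow> f (\<ominus>\<^bsub>Zp p\<^esub> x) = f x"
  shows "descend p f (pm_one p #>\<^bsub>units_of (Zp p)\<^esub> x) = f x"
proof -
  interpret cring "Zp p"
    by (rule cring_Zp[OF \<open>p > 0\<close>])
  have xc: "x \<in> carrier (Zp p)"
    using x by (rule Units_closed)
  have "\<ominus>\<^bsub>Zp p\<^esub> \<one>\<^bsub>Zp p\<^esub> \<otimes>\<^bsub>Zp p\<^esub> x = \<ominus>\<^bsub>Zp p\<^esub> x"
    unfolding l_minus[OF one_closed xc] l_one[OF xc] by (rule refl)
  then have coset: "pm_one p #>\<^bsub>units_of (Zp p)\<^esub> x = {x, \<ominus>\<^bsub>Zp p\<^esub> x}"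
    unfolding pm_one_def r_coset_def units_of_mult
    by (simp only: l_one[OF xc] UN_insert UN_empty Un_insert_left Un_empty_left Un_empty_right)
  have "pm_one p #>\<^bsub>units_of (Zp p)\<^esub> x \<in> carrier (Zp_units_mod_pm p)"
    unfolding Zp_units_mod_pm_def FactGroup_def RCOSETS_def partial_object.simps units_of_carrier
    using x by (rule UN_I) (rule singletonI)
  moreover have "f ` {x, \<ominus>\<^bsub>Zp p\<^esub> x} = {f x}"
    by (simp only: even[OF x] image_insert image_empty insert_absorb2)
  ultimately show ?thesis
    unfolding descend_def coset by (simp only: restrict_apply if_True the_elem_eq)
qed

lemma Zp_nat_pow_apply:
  assumes "p > 0" "x \<in> carrier (Zp p)"
  shows "(x [^]\<^bsub>Zp p\<^esub> k) n = x n ^ k mod int p ^ n"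
proof (induction k)
  case 0
  show ?case
    by (simp add: Zp_def nat_pow_def)
next
  case (Suc k)
  interpret cring "Zp p"
    by (rule cring_Zp[OF assms(1)])
  have "(x [^]\<^bsub>Zp p\<^esub> Suc k) n = ((x [^]\<^bsub>Zp p\<^esub> k) n * x n) mod int p ^ n"
    unfolding nat_pow_Suc by (simp add: Zp_def)
  then show ?case
    unfolding Suc.IH mod_mult_left_eq power_Suc2 .
qed

lemma continuous_map_Zp_nat_pow:
  assumes "p > 0"
  shows "continuous_map (Zp_topology p) (Zp_topology p) (\<lambda>x. x [^]\<^bsub>Zp p\<^esub> (k :: nat))"
proof -
  interpret cring "Zp p"
    by (rule cring_Zp[OF assms(1)])
  have top: "topspace (Zp_topology p) = carrier (Zp p)"
    by (simp add: Zp_topology_def)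
  have "continuous_map (Zp_topology p) (discrete_topology UNIV) (\<lambda>x. (x [^]\<^bsub>Zp p\<^esub> k) n)" for n
  proof (rule continuous_map_eq)
    have "continuous_map (Zp_topology p) (discrete_topology UNIV) (\<lambda>x. x n)"
      unfolding Zp_topology_def
      by (intro continuous_map_from_subtopology continuous_map_product_projection) simp
    then show "continuous_map (Zp_topology p) (discrete_topology UNIV)
        ((\<lambda>a. a ^ k mod int p ^ n) \<circ> (\<lambda>x. x n))"
      by (rule continuous_map_compose) simp
    show "((\<lambda>a. a ^ k mod int p ^ n) \<circ> (\<lambda>x. x n)) x = (x [^]\<^bsub>Zp p\<^esub> k) n"
      if "x \<in> topspace (Zp_topology p)" for x
      using Zp_nat_pow_apply[OF assms, of x k n] that unfolding top by simp
  qed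
  then have "continuous_map (Zp_topology p) (product_topology (\<lambda>_. discrete_topology UNIV) UNIV)
      (\<lambda>x. x [^]\<^bsub>Zp p\<^esub> k)"
    by (simp add: continuous_map_componentwise_UNIV)
  moreover have "x [^]\<^bsub>Zp p\<^esub> k \<in> carrier (Zp p)" if "x \<in> topspace (Zp_topology p)" for x
    using that nat_pow_closed unfolding top by blast
  ultimately show ?thesis
    unfolding Zp_topology_def[of p] continuous_map_in_subtopology by (auto simp flip: Zp_topology_def)
qed

lemma descend_even_power_in_cont_funs:
  fixes k :: nat
  assumes "p > 0"
  shows "descend p (\<lambda>x. x [^]\<^bsub>Zp p\<^esub> (2 * k)) \<in> cont_funs p (Zp_units_mod_pm_topology p)"
proof -
  interpret cring "Zp p"
    by (rule cring_Zp[OF assms(1)])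
  let ?f = "\<lambda>x. x [^]\<^bsub>Zp p\<^esub> (2 * k)"
  let ?X = "subtopology (Zp_topology p) (Units (Zp p))"
  let ?q = "\<lambda>x. pm_one p #>\<^bsub>units_of (Zp p)\<^esub> x"
  have even: "(\<ominus>\<^bsub>Zp p\<^esub> x) [^]\<^bsub>Zp p\<^esub> (2 * k) = x [^]\<^bsub>Zp p\<^esub> (2 * k)" if "x \<in> Units (Zp p)" for x
  proof -
    have x: "x \<in> carrier (Zp p)" "\<ominus>\<^bsub>Zp p\<^esub> x \<in> carrier (Zp p)"
      using Units_closed[OF that] a_inv_closed by blast+
    have sq: "y [^]\<^bsub>Zp p\<^esub> (2 :: nat) = y \<otimes>\<^bsub>Zp p\<^esub> y" if "y \<in> carrier (Zp p)" for y
      unfolding numeral_2_eq_2 nat_pow_Suc nat_pow_0 l_one[OF that] by (rule refl)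
    have "(\<ominus>\<^bsub>Zp p\<^esub> x) [^]\<^bsub>Zp p\<^esub> (2 :: nat) = x [^]\<^bsub>Zp p\<^esub> (2 :: nat)"
      unfolding sq[OF x(1)] sq[OF x(2)] l_minus[OF x] r_minus[OF x(1) x(1)]
        minus_minus[OF m_closed[OF x(1) x(1)]] by (rule refl)
    then show ?thesis
      unfolding nat_pow_pow[OF x(1), symmetric] nat_pow_pow[OF x(2), symmetric] by (rule arg_cong)
  qed
  have "continuous_map ?X (Zp_topology p) ?f"
    by (rule continuous_map_from_subtopology[OF continuous_map_Zp_nat_pow[OF assms]])
  then have "continuous_map ?X (Zp_topology p) (descend p ?f \<circ> ?q)"
  proof (rule continuous_map_eq)
    fix x
    assume "x \<in> topspace ?X"
    then have "x \<in> Units (Zp p)"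
      by simp
    then show "?f x = (descend p ?f \<circ> ?q) x"
      unfolding o_apply using descend_even[of p x ?f, OF assms _ even] by simp
  qed
  then have "continuous_map (Zp_units_mod_pm_topology p) (Zp_topology p) (descend p ?f)"
    unfolding Zp_units_mod_pm_topology_def
    by (simp only: continuous_compose_quotient_map_eq[OF quotient_map_quotient_topology])
  moreover have "descend p ?f \<in> extensional (topspace (Zp_units_mod_pm_topology p))"
    unfolding topspace_Zp_units_mod_pm_topology descend_def by (rule restrict_extensional)
  ultimately show ?thesis
    unfolding cont_funs_def by blast
qed

section \<open>Expansion by phi-digits\<close>

definition is_phi_digits :: "nat \<Rightarrow> nat \<Rightarrow> (nat \<Rightarrow> nat) \<Rightarrow> bool" where
  "is_phi_digits p n a \<longleftrightarrow>
     finite {i. a i \<noteq> 0} \<and> a 0 \<in> {0..p - 2} \<and> (\<forall>i\<ge>1. a i \<in> {0..p - 1}) \<and>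
     n = a 0 + (\<Sum>i | i \<ge> 1 \<and> a i \<noteq> 0. a i * totient (p ^ i))"

definition phi_digits :: "nat \<Rightarrow> nat \<Rightarrow> nat \<Rightarrow> nat" where
  "phi_digits p n = (THE a. is_phi_digits p n a)"

lemma base_digit:
  fixes d :: "nat \<Rightarrow> nat"
  assumes "\<And>i. d i < q"
  shows "(\<Sum>i<N. d i * q ^ i) div q ^ k mod q = (if k < N then d k else 0)"
  using assms
proof (induction k arbitrary: d N)
  case 0
  show ?case
  proof (cases N)
    case (Suc M)
    have "(\<Sum>i<N. d i * q ^ i) = d 0 + q * (\<Sum>i<M. d (Suc i) * q ^ i)"
      unfolding Suc sum.lessThan_Suc_shift sum_distrib_left by (simp add: ac_simps)
    then show ?thesis
      using 0[of 0] Suc by simp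
  qed simp
next
  case (Suc k)
  have q: "q > 0"
    using Suc.prems[of 0] by simp
  show ?case
  proof (cases N)
    case (Suc M)
    have "(\<Sum>i<N. d i * q ^ i) = d 0 + q * (\<Sum>i<M. d (Suc i) * q ^ i)"
      unfolding Suc sum.lessThan_Suc_shift sum_distrib_left by (simp add: ac_simps)
    then have "(\<Sum>i<N. d i * q ^ i) div q = (\<Sum>i<M. d (Suc i) * q ^ i)"
      using q Suc.prems[of 0] by simp
    then have "(\<Sum>i<N. d i * q ^ i) div q ^ Suc k = (\<Sum>i<M. d (Suc i) * q ^ i) div q ^ k"
      by (simp add: div_mult2_eq)
    then show ?thesis
      using Suc.IH[of "\<lambda>i. d (Suc i)" M] Suc.prems Suc by simp
  qed simp
qed

lemma base_expansion:
  fixes n q :: nat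
  shows "n = (\<Sum>i<N. (n div q ^ i mod q) * q ^ i) + (n div q ^ N) * q ^ N"
proof (induction N)
  case (Suc N)
  define x where "x = n div q ^ N"
  have "n div q ^ Suc N = x div q"
    unfolding x_def by (simp only: power_Suc2 div_mult2_eq)
  moreover have "x * q ^ N = (x mod q + q * (x div q)) * q ^ N"
    by simp
  ultimately have "x * q ^ N = (x mod q) * q ^ N + (n div q ^ Suc N) * q ^ Suc N"
    by (simp only: add_mult_distrib power_Suc mult.assoc mult.left_commute[of q])
  then show ?case
    using Suc.IH unfolding x_def sum.lessThan_Suc by linarith
qed simp

lemma phi_digits_sum:
  assumes "prime p" "\<And>i. i > N \<Longrightarrow> a i = 0"
  shows "(\<Sum>i | i \<ge> 1 \<and> a i \<noteq> 0. a i * totient (p ^ i)) = (p - 1) * (\<Sum>i<N. a (Suc i) * p ^ i)"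
proof -
  have "(\<Sum>i | i \<ge> 1 \<and> a i \<noteq> 0. a i * totient (p ^ i)) = (\<Sum>i\<in>{1..N}. a i * totient (p ^ i))"
    using assms(2) by (intro sum.mono_neutral_left) (auto simp: not_less[symmetric])
  also have "\<dots> = (\<Sum>i<N. a (Suc i) * totient (p ^ Suc i))"
    by (intro sum.reindex_bij_witness[of _ Suc "\<lambda>i. i - 1"]) auto
  also have "\<dots> = (p - 1) * (\<Sum>i<N. a (Suc i) * p ^ i)"
    unfolding totient_prime_power_Suc[OF assms(1)] sum_distrib_left by (simp add: algebra_simps)
  finally show ?thesis .
qed

lemma is_phi_digits_imp:
  assumes "prime p" "is_phi_digits p n a"
  shows "a = (\<lambda>i. case i of 0 \<Rightarrow> n mod (p - 1) | Suc j \<Rightarrow> n div (p - 1) div p ^ j mod p)"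
proof
  fix i
  have p: "p \<ge> 2"
    using assms(1) by (rule prime_ge_2_nat)
  have fin: "finite {i. a i \<noteq> 0}" and lo: "a 0 \<le> p - 2" and hi: "\<And>i. i \<ge> 1 \<Longrightarrow> a i \<le> p - 1"
    and sum: "n = a 0 + (\<Sum>i | i \<ge> 1 \<and> a i \<noteq> 0. a i * totient (p ^ i))"
    using assms(2) by (simp_all only: is_phi_digits_def atLeastAtMost_iff)
  obtain N where "\<forall>i\<in>{i. a i \<noteq> 0}. i \<le> N"
    using fin unfolding finite_nat_set_iff_bounded_le by (rule exE)
  then have N: "a i = 0" if "i > N" for i
    using that leD by blast
  define s where "s = (\<Sum>i<N. a (Suc i) * p ^ i)"
  have n: "n = a 0 + (p - 1) * s"
    using sum phi_digits_sum[of p N a, OF assms(1) N] unfolding s_def by linarith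
  have a0: "a 0 < p - 1"
    using lo p by linarith
  have aS: "a (Suc i) < p" for i
    using hi[of "Suc i"] p by simp
  have "n mod (p - 1) = a 0" "n div (p - 1) = s"
    using a0 by (simp_all only: n mod_mult_self2 mod_less div_mult_self2 div_less add_0_left)
  moreover have "s div p ^ j mod p = a (Suc j)" for j
    unfolding s_def using base_digit[of "\<lambda>i. a (Suc i)" p N j] aS N[of "Suc j"] by simp
  ultimately show "a i = (case i of 0 \<Rightarrow> n mod (p - 1) | Suc j \<Rightarrow> n div (p - 1) div p ^ j mod p)"
    by (simp split: nat.split)
qed

lemma is_phi_digits_exists:
  assumes "prime p"
  shows "is_phi_digits p n (\<lambda>i. case i of 0 \<Rightarrow> n mod (p - 1) | Suc j \<Rightarrow> n div (p - 1) div p ^ j mod p)"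
    (is "is_phi_digits p n ?a")
proof -
  have p: "p \<ge> 2"
    using assms by (rule prime_ge_2_nat)
  have big: "n div (p - 1) < p ^ j" if "j \<ge> n" for j
  proof -
    have "n div (p - 1) \<le> n"
      by simp
    also have "n < 2 ^ n"
      by (rule less_exp)
    also have "\<dots> \<le> p ^ n"
      using p by (simp add: power_mono)
    also have "\<dots> \<le> p ^ j"
      using p that by (simp add: power_increasing)
    finally show ?thesis .
  qed
  define a where "a = ?a"
  have a0: "a 0 = n mod (p - 1)" and aS: "a (Suc j) = n div (p - 1) div p ^ j mod p" for j
    by (simp_all add: a_def)
  have zero: "a i = 0" if "i > n" for i
  proof (cases i)
    case (Suc j)
    then show ?thesis
      using that big[of j] by (simp only: aS div_less mod_0 less_Suc_eq_le)
  qed (use that in simp)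
  have "{i. a i \<noteq> 0} \<subseteq> {..n}"
  proof
    fix i
    assume "i \<in> {i. a i \<noteq> 0}"
    then show "i \<in> {..n}"
      using zero[of i] by (cases "n < i") auto
  qed
  then have fin: "finite {i. a i \<noteq> 0}"
    by (rule finite_subset) simp
  have lo: "a 0 \<in> {0..p - 2}"
  proof -
    have "n mod (p - 1) < p - 1"
      using p by simp
    then show ?thesis
      unfolding a0 atLeastAtMost_iff by linarith
  qed
  have hi: "\<forall>i\<ge>1. a i \<in> {0..p - 1}"
  proof (intro allI impI)
    fix i :: nat
    assume "i \<ge> 1"
    then obtain j where "i = Suc j"
      by (cases i) auto
    then show "a i \<in> {0..p - 1}"
      using p mod_less_divisor[of p "n div (p - 1) div p ^ j"]
      unfolding \<open>i = Suc j\<close> aS atLeastAtMost_iff by linarith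
  qed
  have "n div (p - 1) = (\<Sum>i<n. a (Suc i) * p ^ i)"
    using base_expansion[of "n div (p - 1)" p n] div_less[OF big[OF order_refl]]
    by (simp only: aS mult_0 add_0_right)
  moreover have "n = n mod (p - 1) + (p - 1) * (n div (p - 1))"
    by simp
  ultimately have "n = a 0 + (\<Sum>i | i \<ge> 1 \<and> a i \<noteq> 0. a i * totient (p ^ i))"
    by (simp only: phi_digits_sum[of p n a, OF assms zero] a0)
  then show ?thesis
    using fin lo hi unfolding is_phi_digits_def a_def by blast
qed

lemma ex1_phi_digits: "prime p \<Longrightarrow> \<exists>!a. is_phi_digits p n a"
  using is_phi_digits_exists is_phi_digits_imp by metis

lemma is_phi_digits_phi_digits: "prime p \<Longrightarrow> is_phi_digits p n (phi_digits p n)"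
  unfolding phi_digits_def by (rule theI'[OF ex1_phi_digits])

section \<open>The polynomials E\<close>

definition centered_lift :: "nat \<Rightarrow> nat \<Rightarrow> int \<Rightarrow> int" where
  "centered_lift p j a = (THE t.
     t \<in> {- \<lfloor>real (p ^ j) / 2\<rfloor>..int (p ^ j) - 1 - \<lfloor>real (p ^ j) / 2\<rfloor>} \<and> [t = a] (mod int (p ^ j)))"

definition e_poly :: "nat \<Rightarrow> nat \<Rightarrow> rat poly" where
  "e_poly p j = (if j = 0 then [:0, 1:]
     else Polynomial.smult (1 / fact (p ^ j))
       (\<Prod>a\<in>Units (residue_ring (int (p ^ j))). [:- of_int (centered_lift p j a), 1:]))"

definition E_poly :: "nat \<Rightarrow> nat \<Rightarrow> rat poly" where
  "E_poly p n = (\<Prod>j | phi_digits p n j \<noteq> 0. e_poly p j ^ phi_digits p n j)"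

definition C_const :: "nat \<Rightarrow> nat \<Rightarrow> nat" where
  "C_const p n = (\<Prod>i | phi_digits p (2 * n) i \<noteq> 0. fact (p ^ i) ^ phi_digits p (2 * n) i)"

text \<open>The coefficients c, with n in the role of k - m. They do not depend on m, as the
  factor X^(2m) only shifts both sides.\<close>

definition is_c_coeffs :: "nat \<Rightarrow> nat \<Rightarrow> (nat \<Rightarrow> int) \<Rightarrow> bool" where
  "is_c_coeffs p n c \<longleftrightarrow> (\<forall>j. c j \<noteq> 0 \<longrightarrow> even j \<and> j < 2 * n) \<and>
     (\<forall>m. Polynomial.smult (of_nat (C_const p n)) (E_poly p (2 * n)) * [:0, 1:] ^ (2 * m) =
        [:0, 1:] ^ (2 * (n + m)) -
        (\<Sum>i=m..<n + m. Polynomial.smult (of_int (c (2 * (i - m)))) ([:0, 1:] ^ (2 * i))))"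

definition c_coeffs :: "nat \<Rightarrow> nat \<Rightarrow> nat \<Rightarrow> int" where
  "c_coeffs p n = (THE c. is_c_coeffs p n c)"

subsection \<open>Existence and uniqueness of the coefficients c\<close>

lemma ex1_centered_lift:
  fixes q :: nat and a :: int
  assumes "q > 0"
  shows "\<exists>!t. t \<in> {- \<lfloor>real q / 2\<rfloor>..int q - 1 - \<lfloor>real q / 2\<rfloor>} \<and> [t = a] (mod int q)"
proof -
  define h where "h = \<lfloor>real q / 2\<rfloor>"
  have q: "int q > 0"
    using assms by simp
  show ?thesis
    unfolding h_def[symmetric]
  proof (rule ex1I[of _ "(a + h) mod int q - h"])
    have "[(a + h) mod int q - h = (a + h) - h] (mod int q)"
      by (intro cong_diff) (auto simp: cong_def)
    then show "(a + h) mod int q - h \<in> {- h..int q - 1 - h} \<and> [(a + h) mod int q - h = a] (mod int q)"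
      using pos_mod_bound[OF q, of "a + h"] pos_mod_sign[OF q, of "a + h"] by auto
  next
    fix t
    assume t: "t \<in> {- h..int q - 1 - h} \<and> [t = a] (mod int q)"
    then have "[t + h = a + h] (mod int q)"
      by (intro cong_add) auto
    moreover have "(t + h) mod int q = t + h"
      using t by (intro mod_pos_pos_trivial) auto
    ultimately show "t = (a + h) mod int q - h"
      by (simp add: cong_def)
  qed
qed

lemma centered_lift:
  assumes "p > 0"
  shows "centered_lift p j a \<in> {- \<lfloor>real (p ^ j) / 2\<rfloor>..int (p ^ j) - 1 - \<lfloor>real (p ^ j) / 2\<rfloor>}"
    and "[centered_lift p j a = a] (mod int (p ^ j))"
  using theI'[OF ex1_centered_lift[of "p ^ j" a]] assms unfolding centered_lift_def by auto

lemma centered_lift_eqI: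
  assumes "p > 0" "t \<in> {- \<lfloor>real (p ^ j) / 2\<rfloor>..int (p ^ j) - 1 - \<lfloor>real (p ^ j) / 2\<rfloor>}"
    "[t = a] (mod int (p ^ j))"
  shows "centered_lift p j a = t"
  using the1_equality[OF ex1_centered_lift[of "p ^ j" a]] assms unfolding centered_lift_def by auto

definition num_poly :: "nat \<Rightarrow> nat \<Rightarrow> rat poly" where
  "num_poly p j = Polynomial.smult (fact (p ^ j)) (e_poly p j)"

lemma num_poly_0: "num_poly p 0 = [:0, 1:]"
  by (simp add: num_poly_def e_poly_def)

lemma num_poly_pos:
  "j > 0 \<Longrightarrow> num_poly p j =
     (\<Prod>a\<in>Units (residue_ring (int (p ^ j))). [:- of_int (centered_lift p j a), 1:])"
  by (simp add: num_poly_def e_poly_def)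

lemma smult_C_const_E_poly:
  "Polynomial.smult (of_nat (C_const p n)) (E_poly p (2 * n)) =
     (\<Prod>j | phi_digits p (2 * n) j \<noteq> 0. num_poly p j ^ phi_digits p (2 * n) j)"
  by (simp only: C_const_def E_poly_def num_poly_def of_nat_prod of_nat_power of_nat_fact
      smult_power prod_smult)

lemma residue_ring_units:
  assumes "prime p" "j > 0"
  shows "Units (residue_ring (int (p ^ j))) = {x. 0 < x \<and> x < int (p ^ j) \<and> coprime x (int (p ^ j))}"
    and "card (Units (residue_ring (int (p ^ j)))) = totient (p ^ j)"
proof -
  have "p ^ j > 1"
    using assms prime_gt_1_nat one_less_power by blast
  then have "1 < int (p ^ j)"
    by linarith
  then interpret residues "int (p ^ j)" "residue_ring (int (p ^ j))"
    by (simp only: residues_def)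
  show "Units (residue_ring (int (p ^ j))) = {x. 0 < x \<and> x < int (p ^ j) \<and> coprime x (int (p ^ j))}"
    by (rule res_units_eq)
  show "card (Units (residue_ring (int (p ^ j)))) = totient (p ^ j)"
    using totient_eq by (simp only: nat_int)
qed

lemma degree_num_poly:
  assumes "prime p"
  shows "degree (num_poly p j) = (if j = 0 then 1 else totient (p ^ j))"
proof (cases "j = 0")
  case False
  have "degree (num_poly p j) =
      (\<Sum>a\<in>Units (residue_ring (int (p ^ j))). degree [:- of_int (centered_lift p j a), 1 :: rat:])"
    using False by (simp only: num_poly_pos neq0_conv) (rule degree_prod_eq_sum_degree, simp)
  then show ?thesis
    using False residue_ring_units(2)[OF assms] by simp
qed (simp add: num_poly_0)

lemma lead_coeff_num_poly: "lead_coeff (num_poly p j) = 1"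
  by (cases "j = 0") (simp_all add: num_poly_0 num_poly_pos lead_coeff_prod)

lemma coeff_mult_Ints:
  fixes f g :: "rat poly"
  assumes "\<And>i. poly.coeff f i \<in> \<int>" "\<And>i. poly.coeff g i \<in> \<int>"
  shows "poly.coeff (f * g) i \<in> \<int>"
  using assms by (auto simp: coeff_mult intro!: Ints_sum Ints_mult)

lemma coeff_prod_Ints:
  fixes f :: "'a \<Rightarrow> rat poly"
  assumes "\<And>x i. x \<in> A \<Longrightarrow> poly.coeff (f x) i \<in> \<int>"
  shows "poly.coeff (prod f A) i \<in> \<int>"
  using assms
  by (induction A arbitrary: i rule: infinite_finite_induct) (auto simp: coeff_1 intro!: coeff_mult_Ints)

lemma coeff_power_Ints:
  fixes f :: "rat poly"
  assumes "\<And>i. poly.coeff f i \<in> \<int>"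
  shows "poly.coeff (f ^ k) i \<in> \<int>"
  using coeff_prod_Ints[of "{..<k}" "\<lambda>_. f"] assms by simp

lemma coeff_num_poly_Ints: "poly.coeff (num_poly p j) i \<in> \<int>"
proof (cases "j = 0")
  case True
  then show ?thesis
    by (auto simp: num_poly_0 coeff_pCons split: nat.split)
next
  case False
  then show ?thesis
    by (auto simp: num_poly_pos coeff_pCons split: nat.split intro!: coeff_prod_Ints)
qed

lemma pcompose_power_left:
  fixes f g :: "rat poly"
  shows "pcompose (f ^ k) g = pcompose f g ^ k"
  by (induction k) (simp_all add: pcompose_mult pcompose_1)

lemma num_poly_even:
  assumes "prime p" "j > 0" "p ^ j > 2"
  shows "pcompose (num_poly p j) [:0, -1:] = num_poly p j"
proof -
  define q where "q = p ^ j"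
  define U where "U = Units (residue_ring (int q))"
  define l where "l = centered_lift p j"
  have p: "p > 0"
    using assms(1) prime_gt_0_nat by blast
  have U: "U = {x. 0 < x \<and> x < int q \<and> coprime x (int q)}"
    unfolding U_def q_def by (rule residue_ring_units(1)[OF assms(1,2)])
  have "finite U"
    by (rule finite_subset[of _ "{0..<int q}"]) (auto simp: U)
  have "card U = totient q"
    unfolding U_def q_def by (rule residue_ring_units(2)[OF assms(1,2)])
  then have card: "even (card U)"
    using assms(3) totient_even[of q] unfolding q_def by simp
  have neg: "l (int q - a) = - l a" if a: "a \<in> U" for a
    unfolding l_def
  proof (rule centered_lift_eqI[OF p])
    define h where "h = \<lfloor>real q / 2\<rfloor>"
    have h: "h = int q div 2"
      unfolding h_def by linarith
    have r: "l a \<in> {- h..int q - 1 - h}" and c: "[l a = a] (mod int q)"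
      using centered_lift[OF p, of j a] unfolding l_def h_def q_def by auto
    have "[- l a = - a] (mod int q)"
      using c by (simp add: cong_minus_minus_iff)
    also have "[- a = int q - a] (mod int q)"
      by (simp add: cong_iff_dvd_diff)
    finally show "[- centered_lift p j a = int q - a] (mod int (p ^ j))"
      unfolding l_def q_def .
    have "l a \<noteq> - h" if "even (int q)"
    proof
      assume "l a = - h"
      have "even p" "even q"
        using that assms(2) unfolding q_def by auto
      then have "p = 2"
        using assms(1) primes_dvd_imp_eq two_is_prime_nat by blast
      then have "j \<ge> 2"
        using assms(2,3) by (cases "j = 1") auto
      then obtain i where i: "j = Suc (Suc i)"
        using numeral_2_eq_2 less_eqE[of 2 j] by (metis add_2_eq_Suc)
      have "q = 4 * 2 ^ i"
        using \<open>p = 2\<close> i unfolding q_def by simp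
      then have "h = 2 * 2 ^ i"
        unfolding h by simp
      then have "even (l a)"
        using \<open>l a = - h\<close> by simp
      moreover have "coprime (l a) (int q)"
        using c a cong_imp_coprime[OF cong_sym[OF c]] unfolding U by auto
      ultimately show False
        using that coprime_common_divisor[of "l a" "int q" 2] by simp
    qed
    then have "- l a \<in> {- h..int q - 1 - h}"
      using r h by (cases "even (int q)") (auto elim!: evenE oddE)
    then show "- centered_lift p j a \<in> {- \<lfloor>real (p ^ j) / 2\<rfloor>..int (p ^ j) - 1 - \<lfloor>real (p ^ j) / 2\<rfloor>}"
      unfolding l_def h_def q_def .
  qed
  have "pcompose (num_poly p j) [:0, -1:] = (\<Prod>a\<in>U. pcompose [:- of_int (l a), 1 :: rat:] [:0, -1:])"
    using assms(2) by (simp only: num_poly_pos pcompose_prod U_def l_def q_def)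
  also have "\<dots> = (\<Prod>a\<in>U. (- 1) * [:of_int (l a), 1 :: rat:])"
    by (intro prod.cong refl) (simp add: pcompose_pCons)
  also have "\<dots> = (- 1) ^ card U * (\<Prod>a\<in>U. [:of_int (l a), 1 :: rat:])"
    by (simp only: prod.distrib prod_constant)
  also have "\<dots> = (\<Prod>a\<in>U. [:of_int (l a), 1 :: rat:])"
    using card by simp
  also have "\<dots> = (\<Prod>a\<in>U. [:- of_int (l a), 1 :: rat:])"
  proof (rule prod.reindex_bij_witness[of _ "\<lambda>a. int q - a" "\<lambda>a. int q - a"])
    have cop: "coprime (int q - a) (int q)" if "coprime a (int q)" for a
    proof (rule coprimeI)
      fix d
      assume d: "d dvd int q - a" "d dvd int q"
      then have "d dvd int q - (int q - a)"
        by (intro dvd_diff[OF d(2) d(1)])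
      then show "is_unit d"
        using coprime_common_divisor[OF that _ d(2)] by simp
    qed
    show "int q - a \<in> U" if "a \<in> U" for a
      using that cop unfolding U by auto
    then show "int q - a \<in> U" if "a \<in> U" for a
      using that by auto
    show "[:- of_int (l (int q - a)), 1:] = [:of_int (l a), 1 :: rat:]" if "a \<in> U" for a
      using neg[OF that] by simp
  qed auto
  also have "\<dots> = num_poly p j"
    using assms(2) by (simp only: num_poly_pos U_def l_def q_def)
  finally show ?thesis .
qed

lemma monic_int_even_E_poly:
  fixes n :: nat
  assumes "prime p"
  defines "M \<equiv> Polynomial.smult (of_nat (C_const p n)) (E_poly p (2 * n))"
  shows "degree M = 2 * n" "poly.coeff M (2 * n) = 1" "poly.coeff M i \<in> \<int>" "odd i \<Longrightarrow> poly.coeff M i = 0"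
proof -
  define a where "a = phi_digits p (2 * n)"
  define S where "S = {j. a j \<noteq> 0}"
  have M: "M = (\<Prod>j\<in>S. num_poly p j ^ a j)"
    unfolding M_def S_def a_def by (rule smult_C_const_E_poly)
  have dig: "is_phi_digits p (2 * n) a"
    unfolding a_def by (rule is_phi_digits_phi_digits[OF assms(1)])
  have p: "p \<ge> 2"
    using assms(1) by (rule prime_ge_2_nat)
  have fin: "finite S"
    using dig unfolding is_phi_digits_def S_def by blast
  have fin': "finite {i. i \<ge> 1 \<and> a i \<noteq> 0}"
    using fin by (rule rev_finite_subset) (auto simp: S_def)
  have nz: "num_poly p j \<noteq> 0" for j
    using lead_coeff_num_poly[of p j] by auto
  have "degree M = (\<Sum>j\<in>S. degree (num_poly p j ^ a j))"
    unfolding M by (rule degree_prod_eq_sum_degree) (simp add: nz)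
  also have "\<dots> = (\<Sum>j\<in>S. a j * degree (num_poly p j))"
    by (simp add: degree_power_eq nz)
  also have "\<dots> = (\<Sum>j\<in>insert 0 S. a j * degree (num_poly p j))"
    by (rule sum.mono_neutral_left) (use fin in \<open>auto simp: S_def\<close>)
  also have "insert 0 S = insert 0 {i. i \<ge> 1 \<and> a i \<noteq> 0}"
    by (auto simp: S_def)
  also have "(\<Sum>j\<in>insert 0 {i. i \<ge> 1 \<and> a i \<noteq> 0}. a j * degree (num_poly p j)) =
      a 0 + (\<Sum>i | i \<ge> 1 \<and> a i \<noteq> 0. a i * degree (num_poly p i))"
    by (subst sum.insert[OF fin']) (simp_all add: degree_num_poly[OF assms(1)])
  also have "(\<Sum>i | i \<ge> 1 \<and> a i \<noteq> 0. a i * degree (num_poly p i)) =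
      (\<Sum>i | i \<ge> 1 \<and> a i \<noteq> 0. a i * totient (p ^ i))"
    by (intro sum.cong refl) (auto simp: degree_num_poly[OF assms(1)])
  also have "a 0 + \<dots> = 2 * n"
    using dig unfolding is_phi_digits_def by simp
  finally show deg: "degree M = 2 * n" .
  have "lead_coeff M = 1"
    unfolding M by (simp add: lead_coeff_prod lead_coeff_power lead_coeff_num_poly)
  then show "poly.coeff M (2 * n) = 1"
    by (simp add: deg)
  show "poly.coeff M i \<in> \<int>"
    unfolding M by (intro coeff_prod_Ints coeff_power_Ints coeff_num_poly_Ints)
  have step: "pcompose (num_poly p j ^ a j) [:0, -1:] = num_poly p j ^ a j" for j
  proof (cases "j > 0 \<and> p ^ j > 2")
    case True
    then show ?thesis
      by (simp add: pcompose_power_left num_poly_even assms(1))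
  next
    case False
    have tot: "even (totient (p ^ i))" if "i \<ge> 1" "p ^ i > 2" for i
      using totient_even that by blast
    show ?thesis
    proof (cases "p = 2")
      case True
      then have "j \<le> 1"
        using False power_increasing[of 2 j "2::nat"] by (cases "j \<ge> 2") auto
      have a0: "a 0 = 0"
        using dig True unfolding is_phi_digits_def by simp
      have "a 1 = 0"
      proof (rule ccontr)
        assume "a 1 \<noteq> 0"
        then have "a 1 = 1"
          using dig True unfolding is_phi_digits_def
          by (metis One_nat_def atLeastAtMost_iff diff_Suc_1 le_antisym less_one linorder_not_le
              numeral_2_eq_2 order_refl)
        have "{i. i \<ge> 1 \<and> a i \<noteq> 0} = insert 1 {i. i \<ge> 2 \<and> a i \<noteq> 0}"
          using \<open>a 1 \<noteq> 0\<close> by (auto simp: numeral_2_eq_2 le_Suc_eq)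
        moreover have "finite {i. i \<ge> 2 \<and> a i \<noteq> 0}"
          using fin by (rule rev_finite_subset) (auto simp: S_def)
        ultimately have "2 * n = 1 + (\<Sum>i | i \<ge> 2 \<and> a i \<noteq> 0. a i * totient (p ^ i))"
          using dig a0 \<open>a 1 = 1\<close> True unfolding is_phi_digits_def by simp
        moreover have "even (\<Sum>i | i \<ge> 2 \<and> a i \<noteq> 0. a i * totient (p ^ i))"
        proof (rule dvd_sum)
          fix i assume "i \<in> {i. i \<ge> 2 \<and> a i \<noteq> 0}"
          then have "p ^ i > 2"
            using power_increasing[of 2 i "2::nat"] True by simp
          then show "even (a i * totient (p ^ i))"
            using tot[of i] \<open>i \<in> _\<close> by simp
        qed
        ultimately show False
          by presburger
      qed
      then have "a j = 0"
        using a0 \<open>j \<le> 1\<close> by (cases j) auto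
      then show ?thesis
        by (simp add: pcompose_1)
    next
      case pn2: False
      have big: "p ^ i > 2" if "i \<ge> 1" for i
        using that p pn2 power_increasing[of 1 i p] by simp
      then have "j = 0"
        using False by fastforce
      have "even (\<Sum>i | i \<ge> 1 \<and> a i \<noteq> 0. a i * totient (p ^ i))"
      proof (rule dvd_sum)
        fix i assume "i \<in> {i. i \<ge> 1 \<and> a i \<noteq> 0}"
        then have "i \<ge> 1"
          by simp
        then show "even (a i * totient (p ^ i))"
          using tot[OF _ big] by simp
      qed
      then have "even (a 0)"
        using dig dvd_add_left_iff[of 2 _ "a 0"] unfolding is_phi_digits_def by (metis dvd_triv_left)
      then show ?thesis
        by (auto simp: \<open>j = 0\<close> num_poly_0 pcompose_power_left pcompose_pCons power_mult power2_eq_square elim!: evenE)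
    qed
  qed
  have "pcompose M [:0, -1:] = M"
    unfolding M pcompose_prod by (simp add: step)
  then have "(-1) ^ i * poly.coeff M i = poly.coeff M i"
    using coeff_pcompose_linear[of M "-1" i] by simp
  then show "odd i \<Longrightarrow> poly.coeff M i = 0"
    by simp
qed

lemma lead_coeff_E_poly:
  assumes "prime p"
  shows "degree (E_poly p (2 * n)) = 2 * n" "lead_coeff (E_poly p (2 * n)) = 1 / of_nat (C_const p n)"
proof -
  have "C_const p n > 0"
    unfolding C_const_def by (intro prod_pos) simp
  then have "C_const p n \<noteq> 0"
    by simp
  then show deg: "degree (E_poly p (2 * n)) = 2 * n"
    using monic_int_even_E_poly(1)[OF assms, of n] by simp
  show "lead_coeff (E_poly p (2 * n)) = 1 / of_nat (C_const p n)"
    using monic_int_even_E_poly(2)[OF assms, of n] \<open>C_const p n \<noteq> 0\<close>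
    unfolding deg by (simp add: field_simps)
qed

lemma ex1_c_coeffs:
  assumes "prime p"
  shows "\<exists>!c. is_c_coeffs p n c"
proof -
  define M where "M = Polynomial.smult (of_nat (C_const p n)) (E_poly p (2 * n))"
  note M = monic_int_even_E_poly[OF assms, where n = n, folded M_def]
  have X1: "[:0, 1:] ^ i = Polynomial.monom (1 :: rat) i" for i
    by (simp add: monom_altdef)
  define c where "c j = (if even j \<and> j < 2 * n then - \<lfloor>poly.coeff M j\<rfloor> else 0)" for j
  have cM: "rat_of_int (c (2 * r)) = - poly.coeff M (2 * r)" if "r < n" for r
    using that M(3)[of "2 * r"] by (auto simp: c_def elim!: Ints_cases)
  have coeff_rhs: "poly.coeff (Polynomial.monom 1 (2 * n) -
      (\<Sum>r<n. Polynomial.monom (rat_of_int (d (2 * r))) (2 * r))) i =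
      (if i = 2 * n then 1 else if even i \<and> i < 2 * n then - of_int (d i) else 0)" for d i
  proof -
    have "(\<Sum>r<n. poly.coeff (Polynomial.monom (rat_of_int (d (2 * r))) (2 * r)) i) =
        (\<Sum>r<n. if r = i div 2 then (if even i then rat_of_int (d i) else 0) else 0)"
      by (intro sum.cong refl) auto
    also have "\<dots> = (if i div 2 < n \<and> even i then rat_of_int (d i) else 0)"
      by (simp add: sum.delta)
    finally show ?thesis
      by (auto simp: coeff_sum)
  qed
  have id: "M = Polynomial.monom 1 (2 * n) - (\<Sum>r<n. Polynomial.monom (rat_of_int (c (2 * r))) (2 * r))"
  proof (rule poly_eqI)
    fix i
    show "poly.coeff M i = poly.coeff (Polynomial.monom 1 (2 * n) -
        (\<Sum>r<n. Polynomial.monom (rat_of_int (c (2 * r))) (2 * r))) i"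
      unfolding coeff_rhs using M cM[of "i div 2"] coeff_eq_0[of M i] by (auto elim!: evenE)
  qed
  show ?thesis
  proof (rule ex1I[of _ c])
    have "M * [:0, 1:] ^ (2 * m) = [:0, 1:] ^ (2 * (n + m)) -
        (\<Sum>i=m..<n + m. Polynomial.smult (of_int (c (2 * (i - m)))) ([:0, 1:] ^ (2 * i)))" for m
    proof -
      have "(\<Sum>r<n. Polynomial.monom (rat_of_int (c (2 * r))) (2 * r + 2 * m)) =
          (\<Sum>i=m..<n + m. Polynomial.monom (of_int (c (2 * (i - m)))) (2 * i))"
        by (rule sum.reindex_bij_witness[of _ "\<lambda>i. i - m" "\<lambda>r. r + m"]) (auto simp: algebra_simps)
      moreover have "M * Polynomial.monom 1 (2 * m) = Polynomial.monom 1 (2 * n + 2 * m) -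
          (\<Sum>r<n. Polynomial.monom (rat_of_int (c (2 * r))) (2 * r + 2 * m))"
        by (subst id) (simp only: left_diff_distrib sum_distrib_right mult_monom mult_1_right)
      ultimately show ?thesis
        unfolding X1 smult_monom mult_1_right distrib_left by (simp only:)
    qed
    then show "is_c_coeffs p n c"
      unfolding is_c_coeffs_def M_def by (simp add: c_def)
  next
    fix d
    assume d: "is_c_coeffs p n d"
    then have "M * [:0, 1:] ^ (2 * 0) = [:0, 1:] ^ (2 * (n + 0)) -
        (\<Sum>i=0..<n + 0. Polynomial.smult (of_int (d (2 * (i - 0)))) ([:0, 1:] ^ (2 * i)))"
      unfolding is_c_coeffs_def M_def by blast
    then have "M = Polynomial.monom 1 (2 * n) - (\<Sum>r<n. Polynomial.monom (rat_of_int (d (2 * r))) (2 * r))"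
      unfolding X1 smult_monom mult_1_right by (simp add: atLeast0LessThan)
    then have dM: "poly.coeff M j = - rat_of_int (d j)" if "even j" "j < 2 * n" for j
      using that coeff_rhs[of d j] by auto
    show "d = c"
    proof
      fix j
      show "d j = c j"
      proof (cases "even j \<and> j < 2 * n")
        case True
        then have "rat_of_int (d j) = rat_of_int (c j)"
          using dM[of j] cM[of "j div 2"] by auto
        then show ?thesis
          by simp
      next
        case False
        then show ?thesis
          using d by (auto simp: is_c_coeffs_def c_def)
      qed
    qed
  qed
qed

lemma is_c_coeffs_c_coeffs: "prime p \<Longrightarrow> is_c_coeffs p n (c_coeffs p n)"
  unfolding c_coeffs_def by (rule theI'[OF ex1_c_coeffs])

end

theory Submission
  imports Defs
begin

text \<open>The polynomials E_n take p-integral values on the units, and modulo p they form a basis of the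
  locally constant functions there: with the basic polynomials up to level s fixed, e_(s+1) separates
  the p lifts to level s + 2 of a residue class at level s + 1 by an affine function of the lift, so
  its powers up to p - 1 span and are independent on each class. Hence modulo every p^N each continuous
  function on the units is a finite combination of the functions x^(2m) E_n with coefficients unique
  modulo p^N, and a measure may be prescribed by arbitrary values on them. The congruences say exactly
  that the values on x^(2m) E_(2j) forced by the moments are p-adic integers.\<close>

section \<open>Functions on the prime field\<close>

text \<open>Integers prime to p are dense in the units, so the expansion theory is done for
  functions from integers to integers, modulo p^N, at arguments prime to p; p-adic integers enter
  only through their coordinates. To keep all values integral, only the p-part of the factorials is
  divided out: the rest of C_p is a p-adic unit and changes neither spans nor the ideal C_p Z_p. The
  denominator (p^j)! has this origin: for x prime to p, the factors x - a other than the one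
  divisible by p^j have total valuation that of (p^j - 1)!, and the exceptional factor contributes
  at least j more. Even functions are expanded in the full basis, with n of both parities. Averaging
  over x and -x would isolate an even part but fails for p = 2; here p = 2 needs no separate
  treatment. Only the E_(2n) have to descend to the quotient, and this serves the direction from (a)
  to (b). The factor x^(2m) is invertible at units, so starting the moments at 2m instead of 0
  merely multiplies the basis by an invertible function.\<close>

lemma fermat_int:
  fixes t :: int
  assumes "prime p" "\<not> int p dvd t"
  shows "[t ^ (p - 1) = 1] (mod int p)"
proof -
  have p: "int p > 1"
    using prime_gt_1_nat[OF assms(1)] by simp
  then interpret residues "int p" "residue_ring (int p)"
    by (simp only: residues_def)
  have "coprime t (int p)"
    using assms by (subst coprime_commute) (rule prime_imp_coprime, simp_all)
  then show ?thesis
    using euler_theorem totient_prime[OF assms(1)] by simp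
qed

text \<open>By Fermat, 1 - (X - c)^(p-1) is the indicator of the class of c modulo p; weighting
  these indicators by g c interpolates g with degree at most p - 1.\<close>

lemma interpolation_mod_prime:
  fixes g :: "int \<Rightarrow> int"
  assumes "prime p"
  shows "\<exists>\<beta>. \<forall>t. [g (t mod int p) = (\<Sum>r<p. \<beta> r * t ^ r)] (mod int p)"
proof -
  have p: "p > 1"
    using assms by (rule prime_gt_1_nat)
  define P where "P = (\<Sum>c\<in>{0..<int p}. Polynomial.smult (g c) (1 - [:- c, 1:] ^ (p - 1)))"
  have "degree P \<le> p - 1"
    unfolding P_def
  proof (rule degree_sum_le)
    fix c :: int
    have "degree ([:- c, 1:] ^ (p - 1)) = p - 1"
      by (simp add: degree_power_eq)
    then have "degree (1 - [:- c, 1:] ^ (p - 1)) \<le> p - 1"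
      by (intro degree_diff_le) auto
    then show "degree (Polynomial.smult (g c) (1 - [:- c, 1:] ^ (p - 1))) \<le> p - 1"
      using degree_smult_le order_trans by blast
  qed simp
  then have val: "poly P t = (\<Sum>r<p. poly.coeff P r * t ^ r)" for t
  proof -
    have "(\<Sum>r\<le>degree P. poly.coeff P r * t ^ r) = (\<Sum>r<p. poly.coeff P r * t ^ r)"
      using \<open>degree P \<le> p - 1\<close> p by (intro sum.mono_neutral_left) (auto simp: coeff_eq_0)
    then show ?thesis
      by (simp add: poly_altdef)
  qed
  have "[g (t mod int p) = poly P t] (mod int p)" for t
  proof -
    have "[g c * (1 - (t - c) ^ (p - 1)) = (if c = t mod int p then g c else 0)] (mod int p)"
      if "c \<in> {0..<int p}" for c
    proof (cases "c = t mod int p")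
      case True
      then have "int p dvd t - c"
        by (simp add: minus_mod_eq_mult_div)
      then have "int p dvd g c * (t - c) ^ (p - 1)"
        using p by (intro dvd_mult dvd_trans[OF _ dvd_power]) auto
      moreover have "g c * (1 - (t - c) ^ (p - 1)) - g c = - (g c * (t - c) ^ (p - 1))"
        by (simp add: algebra_simps)
      ultimately have "int p dvd g c * (1 - (t - c) ^ (p - 1)) - g c"
        by (simp only: dvd_minus_iff)
      then show ?thesis
        unfolding if_P[OF True] cong_iff_dvd_diff .
    next
      case False
      have "\<not> int p dvd t - c"
        using False that by (auto simp flip: mod_eq_dvd_iff)
      then have "[(t - c) ^ (p - 1) = 1] (mod int p)"
        by (rule fermat_int[OF assms])
      then have "int p dvd g c * ((t - c) ^ (p - 1) - 1)"
        by (simp add: cong_iff_dvd_diff)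
      moreover have "g c * (1 - (t - c) ^ (p - 1)) - 0 = - (g c * ((t - c) ^ (p - 1) - 1))"
        by (simp add: algebra_simps)
      ultimately have "int p dvd g c * (1 - (t - c) ^ (p - 1)) - 0"
        by (simp only: dvd_minus_iff)
      then show ?thesis
        unfolding if_not_P[OF False] cong_iff_dvd_diff .
    qed
    then have "[(\<Sum>c\<in>{0..<int p}. g c * (1 - (t - c) ^ (p - 1))) =
        (\<Sum>c\<in>{0..<int p}. if c = t mod int p then g c else 0)] (mod int p)"
      by (rule cong_sum)
    moreover have "(\<Sum>c\<in>{0..<int p}. if c = t mod int p then g c else 0) = g (t mod int p)"
      using p by (simp add: sum.delta)
    moreover have "poly P t = (\<Sum>c\<in>{0..<int p}. g c * (1 - (t - c) ^ (p - 1)))"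
      unfolding P_def by (simp add: poly_sum)
    ultimately show ?thesis
      by (simp add: cong_sym)
  qed
  then show ?thesis
    unfolding val by blast
qed

text \<open>The bound on the number of roots over the field with p elements. Dividing by X - n
  leaves a quotient that still vanishes modulo p at 0, ..., n - 1, because t - n is prime to p
  there.\<close>

lemma poly_vanishing_mod_prime:
  fixes P :: "int poly"
  assumes "prime p" "n \<le> p" "degree P < n" "\<And>t. t \<in> {0..<int n} \<Longrightarrow> int p dvd poly P t"
  shows "int p dvd poly.coeff P i"
  using assms(2-)
proof (induction n arbitrary: P i)
  case (Suc n)
  define Q where "Q = synthetic_div P (int n)"
  have PQ: "[:- int n, 1:] * Q + [:poly P (int n):] = P"
    unfolding Q_def by (rule synthetic_div_correct')
  have pn: "int p dvd poly P (int n)"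
    using Suc.prems(3)[of "int n"] by simp
  have Q: "int p dvd poly.coeff Q i" for i
  proof (cases "degree P = 0")
    case True
    then show ?thesis
      using synthetic_div_eq_0_iff[of P "int n"] by (simp add: Q_def)
  next
    case False
    then have "degree Q < n"
      using Suc.prems(2) by (simp add: Q_def degree_synthetic_div)
    moreover have "int p dvd poly Q t" if "t \<in> {0..<int n}" for t
    proof -
      have "poly P t = (t - int n) * poly Q t + poly P (int n)"
        by (subst (1) PQ[symmetric]) (simp add: algebra_simps)
      moreover have "int p dvd poly P t"
        using Suc.prems(3) that by simp
      ultimately have "int p dvd (t - int n) * poly Q t"
        using pn by (simp add: dvd_add_left_iff)
      moreover have "\<not> int p dvd t - int n"
        using that Suc.prems(1) zdvd_not_zless[of "int n - t" "int p"]
        by (simp add: dvd_diff_commute)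
      ultimately show ?thesis
        using assms(1) by (simp add: prime_dvd_mult_iff)
    qed
    ultimately show ?thesis
      using Suc.IH Suc.prems(1) by simp
  qed
  have "int p dvd poly.coeff ([:- int n, 1:] * Q) i"
    using Q by (cases i) (auto simp: coeff_pCons)
  moreover have "int p dvd poly.coeff [:poly P (int n):] i"
    using pn by (cases i) auto
  ultimately show ?case
    by (subst PQ[symmetric]) (simp only: coeff_add dvd_add)
qed simp

lemma coeffs_vanish_mod_prime:
  fixes \<beta> :: "nat \<Rightarrow> int"
  assumes "prime p" "\<And>t. [(\<Sum>r<p. \<beta> r * t ^ r) = 0] (mod int p)" "r < p"
  shows "[\<beta> r = 0] (mod int p)"
proof -
  define P where "P = (\<Sum>r<p. Polynomial.monom (\<beta> r) r)"
  have p: "p > 0"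
    using assms(1) by (rule prime_gt_0_nat)
  have "degree P \<le> p - 1"
    unfolding P_def by (rule degree_sum_le) (auto intro: order_trans[OF degree_monom_le])
  then have "degree P < p"
    using p by simp
  moreover have "int p dvd poly P t" for t
    using assms(2)[of t] by (simp add: P_def poly_sum poly_monom cong_0_iff)
  ultimately have "int p dvd poly.coeff P r"
    using poly_vanishing_mod_prime[OF assms(1) order_refl] by blast
  moreover have "poly.coeff P r = \<beta> r"
    using assms(3) by (simp add: P_def coeff_sum sum.delta)
  ultimately show ?thesis
    by (simp add: cong_0_iff)
qed

section \<open>Integer values of the basic polynomials\<close>

text \<open>The value at x of the monic numerator (p^j)! e_j; see
  \<open>poly_num_poly\<close>.\<close>

definition unit_prod :: "nat \<Rightarrow> nat \<Rightarrow> int \<Rightarrow> int" where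
  "unit_prod p j x = (if j = 0 then x
     else \<Prod>a\<in>Units (residue_ring (int (p ^ j))). x - centered_lift p j a)"

definition fact_val :: "nat \<Rightarrow> nat \<Rightarrow> nat" where
  "fact_val p j = multiplicity (int p) (fact (p ^ j))"

text \<open>For x prime to p this is e_j(x) times the prime-to-p part of (p^j)!, a p-adic unit.
  Dividing by the p-part alone keeps the value an integer; the division is exact at such x
  (\<open>e_int_eq\<close>).\<close>

definition e_int :: "nat \<Rightarrow> nat \<Rightarrow> int \<Rightarrow> int" where
  "e_int p j x = unit_prod p j x div int p ^ fact_val p j"

lemma e_int_0: "e_int p 0 x = x"
  by (simp add: e_int_def unit_prod_def fact_val_def)

text \<open>Divisibility by P^i for i \<le> j depends only on the class modulo P^j, and the second
  hypothesis places the valuation of y below j.\<close>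

lemma multiplicity_cong:
  fixes P :: int
  assumes "[y = z] (mod P ^ j)" "\<not> P ^ j dvd y"
  shows "multiplicity P y = multiplicity P z"
proof (cases "is_unit P \<or> y = 0")
  case True
  then show ?thesis
    using assms(2) unit_imp_dvd[of "P ^ j" y] is_unit_power_iff[of P j] by auto
next
  case False
  define n where "n = multiplicity P y"
  have yz: "P ^ i dvd y \<longleftrightarrow> P ^ i dvd z" if "i \<le> j" for i
    using cong_dvd_iff[OF cong_dvd_modulus[OF assms(1) le_imp_power_dvd[OF that]]] .
  have "n < j"
    using assms(2) False unfolding n_def by (intro multiplicity_lessI) auto
  moreover have "P ^ n dvd y"
    unfolding n_def by (rule multiplicity_dvd)
  moreover have "\<not> P ^ Suc n dvd y"
    using False multiplicity_geI[of y P "Suc n"] unfolding n_def by auto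
  ultimately show ?thesis
    using yz[of n] yz[of "Suc n"] multiplicity_eqI[of P n z] unfolding n_def by simp
qed

text \<open>As a varies, x - a runs through the nonzero residues modulo p^j, each with the valuation
  of its representative in 1, ..., p^j - 1. The sum is thus the valuation of (p^j - 1)!, and the
  added j is that of the last factor p^j of (p^j)!.\<close>

lemma sum_multiplicity_residues:
  assumes "prime p" "j > 0"
  shows "(\<Sum>a\<in>{0..<int (p ^ j)} - {x mod int (p ^ j)}. multiplicity (int p) (x - a)) + j = fact_val p j"
proof -
  define q where "q = int (p ^ j)"
  have q: "q > 0"
    using assms(1) prime_gt_0_nat unfolding q_def by auto
  have pe: "prime_elem (int p)"
    using assms(1) by simp
  have "(\<Sum>a\<in>{0..<q} - {x mod q}. multiplicity (int p) (x - a)) = (\<Sum>r\<in>{1..<q}. multiplicity (int p) r)"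
  proof (rule sum.reindex_bij_witness[of _ "\<lambda>r. (x - r) mod q" "\<lambda>a. (x - a) mod q"])
    fix a assume a: "a \<in> {0..<q} - {x mod q}"
    have nd: "\<not> q dvd x - a"
      using a by (auto simp flip: mod_eq_dvd_iff)
    have "(x - (x - a) mod q) mod q = (x - (x - a)) mod q"
      by (rule mod_diff_right_eq)
    then show "(x - (x - a) mod q) mod q = a"
      using a by simp
    have "(x - a) mod q \<noteq> 0"
      using nd by (simp add: dvd_eq_mod_eq_0)
    moreover have "0 \<le> (x - a) mod q"
      using q by simp
    ultimately show "(x - a) mod q \<in> {1..<q}"
      using q pos_mod_bound[OF q, of "x - a"] unfolding atLeastLessThan_iff by linarith
    show "multiplicity (int p) ((x - a) mod q) = multiplicity (int p) (x - a)"
      using nd by (intro multiplicity_cong[symmetric, of _ _ _ j]) (auto simp: q_def cong_def)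
  next
    fix r assume r: "r \<in> {1..<q}"
    have "(x - (x - r) mod q) mod q = (x - (x - r)) mod q"
      by (rule mod_diff_right_eq)
    then show "(x - (x - r) mod q) mod q = r"
      using r by simp
    have "(x - r) mod q \<noteq> x mod q"
    proof
      assume "(x - r) mod q = x mod q"
      then have "q dvd - r"
        by (simp add: mod_eq_dvd_iff)
      then show False
        using r zdvd_not_zless[of r q] by simp
    qed
    then show "(x - r) mod q \<in> {0..<q} - {x mod q}"
      using q by simp
  qed
  also have "\<dots> = multiplicity (int p) (\<Prod>r\<in>{1..<q}. r)"
    by (rule prime_elem_multiplicity_prod_distrib[OF pe, symmetric]) auto
  finally have sum: "(\<Sum>a\<in>{0..<q} - {x mod q}. multiplicity (int p) (x - a)) =
      multiplicity (int p) (\<Prod>r\<in>{1..<q}. r)" .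
  have "fact (p ^ j) = (\<Prod>r\<in>{1..p ^ j}. int r)"
    by (simp add: fact_prod)
  also have "\<dots> = (\<Prod>r\<in>{1..q}. r)"
    unfolding q_def by (rule prod.reindex_bij_witness[of _ nat int]) (auto simp: nat_le_iff)
  also have "{1..q} = insert q {1..<q}"
    using q by auto
  also have "(\<Prod>r\<in>insert q {1..<q}. r) = q * (\<Prod>r\<in>{1..<q}. r)"
    by simp
  finally have "fact_val p j = multiplicity (int p) (q * (\<Prod>r\<in>{1..<q}. r))"
    unfolding fact_val_def by simp
  also have "\<dots> = multiplicity (int p) q + multiplicity (int p) (\<Prod>r\<in>{1..<q}. r)"
    using q by (intro prime_elem_multiplicity_mult_distrib[OF pe]) auto
  also have "multiplicity (int p) q = j"
    using pe assms(1) prime_gt_0_nat[OF assms(1)] unfolding q_def by (simp add: multiplicity_same_power prime_elem_not_unit)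
  finally show ?thesis
    unfolding q_def[symmetric] sum by simp
qed

text \<open>On a residue class modulo p^j exactly one factor of the product is divisible by p^j; all others
  have constant valuation, and their unit parts are constant modulo p.\<close>

lemma unit_prod_local:
  assumes "prime p" "j > 0" "\<not> int p dvd x"
  obtains r u where "\<not> int p dvd u"
    "\<And>d. \<exists>t. unit_prod p j (x + int p ^ j * d) = int p ^ fact_val p j * t \<and> [t = (r + d) * u] (mod int p)"
proof -
  define q where "q = int (p ^ j)"
  define U where "U = Units (residue_ring (int (p ^ j)))"
  define l where "l = centered_lift p j"
  define a0 where "a0 = x mod q"
  define v where "v a = multiplicity (int p) (x - l a)" for a
  define c where "c a = (x - l a) div int p ^ v a" for a
  have p: "p > 0"
    using assms(1) by (rule prime_gt_0_nat)
  have q: "q > 0"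
    using p unfolding q_def by auto
  have pi: "prime (int p)"
    using assms(1) by simp
  have U: "U = {a. 0 < a \<and> a < q \<and> coprime a q}"
    unfolding U_def q_def by (rule residue_ring_units(1)[OF assms(1,2)])
  have cop: "coprime a q \<longleftrightarrow> \<not> int p dvd a" for a
    using assms(2) pi unfolding q_def
    by (metis coprime_commute coprime_power_right_iff int_ops(1) less_irrefl of_nat_power prime_imp_coprime
        not_coprimeI dvd_refl not_prime_unit)
  have finU: "finite U"
    by (rule finite_subset[of _ "{0..<q}"]) (auto simp: U)
  have "\<not> int p dvd a0"
    unfolding a0_def q_def using assms(2,3) by (simp add: dvd_mod_iff dvd_power)
  then have a0: "a0 \<in> U"
    using q unfolding U cop a0_def by (auto simp: order.strict_iff_order[of 0])
  have l: "[l a = a] (mod q)" for a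
    using centered_lift(2)[OF p] unfolding l_def q_def .
  have "q dvd x - l a0"
    using l[of a0] unfolding a0_def by (metis cong_iff_dvd_diff cong_mod_left cong_sym)
  then obtain r where r: "x - l a0 = q * r" ..
  have nd: "\<not> q dvd x - a" if "a \<in> {0..<q} - {a0}" for a
    using that unfolding a0_def by (auto simp flip: mod_eq_dvd_iff)
  have xl: "[x - a = x - l a] (mod int p ^ j)" for a
    using l[of a] unfolding q_def by (simp add: cong_diff cong_sym)
  have nd': "\<not> q dvd x - l a" if "a \<in> U - {a0}" for a
    using nd[of a] that cong_dvd_iff[OF xl[of a], of] unfolding U q_def by auto
  have vj: "v a < j" if "a \<in> U - {a0}" for a
    using nd'[OF that] pi unfolding v_def q_def by (intro multiplicity_lessI) auto
  have c: "x - l a = int p ^ v a * c a" for a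
    unfolding c_def v_def by (simp add: multiplicity_dvd)
  have cnd: "\<not> int p dvd c a" if "a \<in> U - {a0}" for a
    unfolding c_def v_def using nd'[OF that] pi by (intro multiplicity_decompose) auto
  have "(\<Sum>a\<in>U - {a0}. v a) = (\<Sum>a\<in>U - {a0}. multiplicity (int p) (x - a))"
  proof (rule sum.cong[OF refl])
    fix a assume "a \<in> U - {a0}"
    then have "\<not> int p ^ j dvd x - a"
      using nd[of a] unfolding U q_def by auto
    then show "v a = multiplicity (int p) (x - a)"
      unfolding v_def by (rule multiplicity_cong[OF xl, symmetric])
  qed
  \<comment> \<open>Classes a divisible by p may be added to the sum: x is prime to p, hence so is x
    - a.\<close>
  also have "\<dots> = (\<Sum>a\<in>{0..<q} - {a0}. multiplicity (int p) (x - a))"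
  proof (rule sum.mono_neutral_left)
    show "\<forall>a\<in>{0..<q} - {a0} - (U - {a0}). multiplicity (int p) (x - a) = 0"
    proof
      fix a assume a: "a \<in> {0..<q} - {a0} - (U - {a0})"
      then have "int p dvd a"
        unfolding U cop by (auto simp: less_le)
      then have "\<not> int p dvd x - a"
        using assms(3) by (simp add: dvd_diff_left_iff)
      then show "multiplicity (int p) (x - a) = 0"
        by (rule not_dvd_imp_multiplicity_0)
    qed
  qed (auto simp: U)
  finally have vsum: "(\<Sum>a\<in>U - {a0}. v a) + j = fact_val p j"
    using sum_multiplicity_residues[OF assms(1,2), of x] unfolding a0_def q_def by simp
  show ?thesis
  proof (rule that[of "\<Prod>a\<in>U - {a0}. c a" r])
    show "\<not> int p dvd (\<Prod>a\<in>U - {a0}. c a)"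
      using cnd finU pi by (subst prime_dvd_prod_iff) auto
    fix d
    \<comment> \<open>The unit part of the factor at a after the shift by p^j d. Since v a < j, it
      differs from c a by a multiple of p.\<close>
    define c' where "c' a = c a + int p ^ (j - v a) * d" for a
    define t where "t = (r + d) * (\<Prod>a\<in>U - {a0}. c' a)"
    have fac: "x + int p ^ j * d - l a = int p ^ v a * c' a" if "a \<in> U - {a0}" for a
    proof -
      have "int p ^ j = int p ^ v a * int p ^ (j - v a)"
        using vj[OF that] by (simp flip: power_add)
      then show ?thesis
        using c[of a] unfolding c'_def by (simp add: algebra_simps)
    qed
    have "unit_prod p j (x + int p ^ j * d) = (\<Prod>a\<in>U. x + int p ^ j * d - l a)"
      using assms(2) by (simp add: unit_prod_def U_def l_def)
    also have "\<dots> = (x + int p ^ j * d - l a0) * (\<Prod>a\<in>U - {a0}. x + int p ^ j * d - l a)"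
      by (rule prod.remove[OF finU a0])
    also have "(\<Prod>a\<in>U - {a0}. x + int p ^ j * d - l a) = (\<Prod>a\<in>U - {a0}. int p ^ v a * c' a)"
      using fac by (rule prod.cong[OF refl])
    also have "\<dots> = int p ^ (\<Sum>a\<in>U - {a0}. v a) * (\<Prod>a\<in>U - {a0}. c' a)"
      by (simp add: prod.distrib power_sum)
    also have "x + int p ^ j * d - l a0 = int p ^ j * (r + d)"
      using r unfolding q_def by (simp add: algebra_simps)
    finally have "unit_prod p j (x + int p ^ j * d) = int p ^ fact_val p j * t"
      unfolding t_def vsum[symmetric] by (simp add: power_add ac_simps)
    moreover have "[c' a = c a] (mod int p)" if "a \<in> U - {a0}" for a
      using vj[OF that] unfolding c'_def by (simp add: cong_iff_dvd_diff dvd_power)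
    then have "[t = (r + d) * (\<Prod>a\<in>U - {a0}. c a)] (mod int p)"
      unfolding t_def by (intro cong_mult cong_refl cong_prod)
    ultimately show "\<exists>t. unit_prod p j (x + int p ^ j * d) = int p ^ fact_val p j * t \<and>
        [t = (r + d) * (\<Prod>a\<in>U - {a0}. c a)] (mod int p)"
      by blast
  qed
qed

text \<open>The case d = 0 of \<open>unit_prod_local\<close>, which makes the division in
  \<open>e_int\<close> exact.\<close>

lemma e_int_eq:
  assumes "prime p" "\<not> int p dvd x"
  shows "unit_prod p j x = int p ^ fact_val p j * e_int p j x"
proof (cases "j = 0")
  case True
  then show ?thesis
    by (simp add: unit_prod_def e_int_0 fact_val_def)
next
  case False
  obtain r u where "\<exists>t. unit_prod p j (x + int p ^ j * 0) = int p ^ fact_val p j * t \<and> [t = (r + 0) * u] (mod int p)"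
    using unit_prod_local[OF assms(1) _ assms(2), of j] False by (metis neq0_conv)
  then show ?thesis
    unfolding e_int_def by auto
qed

text \<open>Comparison with d = 0 removes the offset r of \<open>unit_prod_local\<close>. As the
  slope u is invertible modulo p, the values e_j(x + p^j d) meet every residue modulo p exactly once
  when d runs over the residues.\<close>

lemma e_int_shift:
  assumes "prime p" "j > 0" "\<not> int p dvd x"
  obtains u where "\<not> int p dvd u" "\<And>d. [e_int p j (x + int p ^ j * d) = e_int p j x + u * d] (mod int p)"
proof -
  obtain r u where u: "\<not> int p dvd u" and
    t: "\<And>d. \<exists>t. unit_prod p j (x + int p ^ j * d) = int p ^ fact_val p j * t \<and> [t = (r + d) * u] (mod int p)"
    using unit_prod_local[OF assms] by metis
  have p: "int p \<noteq> 0"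
    using assms(1) by auto
  have e: "[e_int p j (x + int p ^ j * d) = (r + d) * u] (mod int p)" for d
    using t[of d] p unfolding e_int_def by auto
  have "[e_int p j (x + int p ^ j * d) = e_int p j x + u * d] (mod int p)" for d
  proof -
    have "[e_int p j x + u * d = (r + 0) * u + u * d] (mod int p)"
      using e[of 0] by (intro cong_add) auto
    then show ?thesis
      using e[of d] by (simp add: algebra_simps) (metis cong_sym cong_trans)
  qed
  then show ?thesis
    using that u by blast
qed

text \<open>Adding p^(j+1) k is the shift by d = p k, for which the affine term u d vanishes modulo
  p.\<close>

lemma e_int_cong:
  assumes "prime p" "\<not> int p dvd x" "[y = x] (mod int p ^ Suc j)"
  shows "[e_int p j y = e_int p j x] (mod int p)"
proof (cases "j = 0")
  case True
  then show ?thesis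
    using assms(3) by (simp add: e_int_0)
next
  case False
  obtain k where k: "y = x + int p ^ Suc j * k"
    using assms(3) by (metis cong_iff_lin cong_sym)
  obtain u where "\<And>d. [e_int p j (x + int p ^ j * d) = e_int p j x + u * d] (mod int p)"
    using e_int_shift[OF assms(1) _ assms(2), of j] False by blast
  from this[of "int p * k"] show ?thesis
    unfolding k by (simp add: ac_simps cong_def) (metis mod_mult_self2 mult.left_commute mult.commute)
qed

section \<open>The regular basis modulo powers of p\<close>

text \<open>At x prime to p this is E_n(x) up to a p-adic unit factor independent of x;
  \<open>basis_val\<close> is the valuation of the denominator that was cleared.\<close>

definition basis_fun :: "nat \<Rightarrow> nat \<Rightarrow> int \<Rightarrow> int" where
  "basis_fun p n x = (\<Prod>j | phi_digits p n j \<noteq> 0. e_int p j x ^ phi_digits p n j)"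

definition basis_val :: "nat \<Rightarrow> nat \<Rightarrow> nat" where
  "basis_val p n = (\<Sum>j | phi_digits p n j \<noteq> 0. phi_digits p n j * fact_val p j)"

lemma phi_digits_eq:
  "prime p \<Longrightarrow> phi_digits p n = (\<lambda>i. case i of 0 \<Rightarrow> n mod (p - 1) | Suc j \<Rightarrow> n div (p - 1) div p ^ j mod p)"
  using is_phi_digits_imp is_phi_digits_phi_digits by blast

lemma finite_phi_digits: "prime p \<Longrightarrow> finite {j. phi_digits p n j \<noteq> 0}"
  using is_phi_digits_phi_digits unfolding is_phi_digits_def by blast

text \<open>(p - 1) p^s = phi(p^(s+1)) is the place value of digit s + 1, so smaller n have no digit
  beyond s. It is also the number of unit classes modulo p^(s+1), which is why this range of n
  indexes a basis at that level.\<close>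

lemma basis_fun_atMost:
  assumes "prime p" "n < (p - 1) * p ^ s"
  shows "basis_fun p n x = (\<Prod>j\<le>s. e_int p j x ^ phi_digits p n j)"
  unfolding basis_fun_def
proof (rule prod.mono_neutral_left)
  have p: "p > 1"
    using assms(1) by (rule prime_gt_1_nat)
  have y: "n div (p - 1) < p ^ s"
    using assms(2) p by (simp add: div_less_iff_less_mult mult.commute)
  show "{j. phi_digits p n j \<noteq> 0} \<subseteq> {..s}"
  proof
    fix j assume j: "j \<in> {j. phi_digits p n j \<noteq> 0}"
    show "j \<in> {..s}"
    proof (rule ccontr)
      assume "j \<notin> {..s}"
      then obtain i where i: "j = Suc i" "s \<le> i"
        by (cases j) auto
      have "p ^ s \<le> p ^ i"
        using i p by (simp add: power_increasing)
      then show False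
        using j y i by (simp add: phi_digits_eq[OF assms(1)])
    qed
  qed
qed auto

lemma basis_fun_less:
  assumes "prime p" "n < p - 1"
  shows "basis_fun p n x = x ^ n"
  using assms basis_fun_atMost[of p n 0 x] by (simp add: phi_digits_eq e_int_0)

text \<open>Adding r phi(p^(s+1)) to n sets digit s + 1 from 0 to r without a carry. The basis of
  the next level therefore consists of the present one multiplied by the powers of e_(s+1) up to p -
  1, which drives both inductions below.\<close>

lemma basis_fun_step:
  assumes "prime p" "n < (p - 1) * p ^ s" "r < p"
  shows "basis_fun p (n + r * ((p - 1) * p ^ s)) x = basis_fun p n x * e_int p (Suc s) x ^ r"
proof -
  have p: "p > 1"
    using assms(1) by (rule prime_gt_1_nat)
  define N where "N = n + r * ((p - 1) * p ^ s)"
  have N: "N = n + (r * p ^ s) * (p - 1)"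
    unfolding N_def by simp
  define y where "y = n div (p - 1)"
  have y: "y < p ^ s"
    using assms(2) p unfolding y_def by (simp add: div_less_iff_less_mult mult.commute)
  have Nmod: "N mod (p - 1) = n mod (p - 1)"
    unfolding N by simp
  have Ndiv: "N div (p - 1) = y + r * p ^ s"
    unfolding N y_def using p by (subst div_mult_self1) auto
  have lo: "phi_digits p N i = phi_digits p n i" if "i \<le> s" for i
  proof (cases i)
    case 0
    then show ?thesis
      using Nmod by (simp add: phi_digits_eq[OF assms(1)])
  next
    case (Suc j)
    define z where "z = r * p ^ (s - Suc j)"
    have "r * p ^ s = (z * p) * p ^ j"
      using that Suc unfolding z_def by (simp add: ac_simps flip: power_Suc power_add)
    then have "(y + r * p ^ s) div p ^ j = z * p + y div p ^ j"
      using p by (simp add: div_mult_self1)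
    then have "(y + r * p ^ s) div p ^ j mod p = y div p ^ j mod p"
      by simp
    then show ?thesis
      using Suc Ndiv by (simp add: phi_digits_eq[OF assms(1)] y_def)
  qed
  have "(y + r * p ^ s) div p ^ s mod p = r"
    using y assms(3) p by (simp add: div_mult_self1)
  then have hi: "phi_digits p N (Suc s) = r"
    using Ndiv by (simp add: phi_digits_eq[OF assms(1)])
  have "N < (r + 1) * ((p - 1) * p ^ s)"
    using assms(2) unfolding N_def by simp
  also have "\<dots> \<le> p * ((p - 1) * p ^ s)"
    using assms(3) by (intro mult_right_mono) auto
  finally have "N < (p - 1) * p ^ Suc s"
    by (simp add: ac_simps)
  then have "basis_fun p N x = (\<Prod>j\<le>Suc s. e_int p j x ^ phi_digits p N j)"
    by (rule basis_fun_atMost[OF assms(1)])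
  also have "\<dots> = (\<Prod>j\<le>s. e_int p j x ^ phi_digits p n j) * e_int p (Suc s) x ^ r"
    using lo hi by simp
  finally show ?thesis
    unfolding N_def basis_fun_atMost[OF assms(1,2)] .
qed

lemma basis_fun_cong:
  assumes "prime p" "n < (p - 1) * p ^ s" "\<not> int p dvd x" "[y = x] (mod int p ^ Suc s)"
  shows "[basis_fun p n y = basis_fun p n x] (mod int p)"
  unfolding basis_fun_atMost[OF assms(1,2)]
proof (intro cong_prod cong_pow e_int_cong[OF assms(1,3)])
  fix j assume "j \<in> {..s}"
  then show "[y = x] (mod int p ^ Suc j)"
    by (intro cong_dvd_modulus[OF assms(4)] le_imp_power_dvd) simp
qed

lemma sum_basis_split:
  fixes f :: "nat \<Rightarrow> int"
  shows "(\<Sum>n<(p - 1) * p ^ Suc s. f n) = (\<Sum>r<p. \<Sum>n<(p - 1) * p ^ s. f (n + r * ((p - 1) * p ^ s)))"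
proof -
  define K where "K = (p - 1) * p ^ s"
  have "(\<Sum>n<(p - 1) * p ^ Suc s. f n) = (\<Sum>n<p * K. f n)"
    unfolding K_def by (simp add: ac_simps)
  also have "\<dots> = (\<Sum>r<p. sum f {r * K..<r * K + K})"
    by (rule sum.nat_group[symmetric])
  also have "\<dots> = (\<Sum>r<p. \<Sum>n<K. f (n + r * K))"
  proof (rule sum.cong[OF refl])
    fix r
    show "sum f {r * K..<r * K + K} = (\<Sum>n<K. f (n + r * K))"
      by (rule sum.reindex_bij_witness[of _ "\<lambda>n. n + r * K" "\<lambda>n. n - r * K"]) auto
  qed
  finally show ?thesis
    unfolding K_def .
qed

section \<open>Spanning and independence modulo p\<close>

lemma inverse_mod_prime:
  assumes "prime p" "\<not> int p dvd u"
  obtains w where "[u * w = 1] (mod int p)"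
proof -
  have "coprime u (int p)"
    using assms by (subst coprime_commute) (rule prime_imp_coprime, simp_all)
  then show ?thesis
    using that cong_solve_coprime_int by blast
qed

text \<open>Induction on the level. On each class modulo p^(s+1), h is a polynomial of degree below
  p in e_(s+1); its coefficients depend only on the class, so they are functions of the previous
  level and are expanded by the induction hypothesis.\<close>

lemma basis_span_mod_prime:
  assumes "prime p"
    and "\<And>x y. \<not> int p dvd x \<Longrightarrow> \<not> int p dvd y \<Longrightarrow> [x = y] (mod int p ^ Suc s) \<Longrightarrow> [h x = h y] (mod int p)"
  shows "\<exists>\<alpha>. \<forall>x. \<not> int p dvd x \<longrightarrow> [h x = (\<Sum>n<(p - 1) * p ^ s. \<alpha> n * basis_fun p n x)] (mod int p)"
  using assms(2)
proof (induction s arbitrary: h)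
  case 0
  have p: "p > 1"
    using assms(1) by (rule prime_gt_1_nat)
  obtain \<beta> where \<beta>: "\<And>t. [h (t mod int p) = (\<Sum>r<p. \<beta> r * t ^ r)] (mod int p)"
    using interpolation_mod_prime[OF assms(1)] by metis
  \<comment> \<open>On units x^(p-1) is 1 modulo p, so the top coefficient is folded into the
    constant one and p - 1 monomials suffice.\<close>
  define \<alpha> where "\<alpha> r = \<beta> r + (if r = 0 then \<beta> (p - 1) else 0)" for r
  have "[h x = (\<Sum>n<p - 1. \<alpha> n * basis_fun p n x)] (mod int p)" if x: "\<not> int p dvd x" for x
  proof -
    have "[h x = h (x mod int p)] (mod int p)"
      using x by (intro 0) (auto simp: dvd_mod_iff)
    also have "[h (x mod int p) = (\<Sum>r<p. \<beta> r * x ^ r)] (mod int p)"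
      by (rule \<beta>)
    also have "(\<Sum>r<p. \<beta> r * x ^ r) = (\<Sum>r<p - 1. \<beta> r * x ^ r) + \<beta> (p - 1) * x ^ (p - 1)"
      using p sum.lessThan_Suc[of "\<lambda>r. \<beta> r * x ^ r" "p - 1"] by simp
    also have "[\<dots> = (\<Sum>r<p - 1. \<beta> r * x ^ r) + \<beta> (p - 1) * 1] (mod int p)"
      by (intro cong_add cong_mult cong_refl fermat_int[OF assms(1) x])
    also have "(\<Sum>r<p - 1. \<beta> r * x ^ r) + \<beta> (p - 1) * 1 = (\<Sum>r<p - 1. \<alpha> r * x ^ r)"
    proof -
      have "(\<Sum>r<p - 1. \<alpha> r * x ^ r) = (\<Sum>r<p - 1. \<beta> r * x ^ r + (if r = 0 then \<beta> (p - 1) else 0))"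
        unfolding \<alpha>_def by (intro sum.cong) (auto simp: algebra_simps)
      then show ?thesis
        using p by (simp add: sum.distrib)
    qed
    also have "\<dots> = (\<Sum>n<p - 1. \<alpha> n * basis_fun p n x)"
      using basis_fun_less[OF assms(1)] by (intro sum.cong) auto
    finally show ?thesis .
  qed
  then show ?case
    by auto
next
  case (Suc s)
  define P where "P = int p ^ Suc s"
  define K where "K = (p - 1) * p ^ s"
  define e where "e = e_int p (Suc s)"
  have p: "p > 1"
    using assms(1) by (rule prime_gt_1_nat)
  have K: "K > 0"
    using p unfolding K_def by simp
  have local: "\<exists>\<beta>. \<forall>d. [h (x + P * d) = (\<Sum>r<p. \<beta> r * e (x + P * d) ^ r)] (mod int p)"
    if x: "\<not> int p dvd x" for x
  proof -
    obtain u where u: "\<not> int p dvd u" "\<And>d. [e (x + P * d) = e x + u * d] (mod int p)"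
      using e_int_shift[OF assms(1) zero_less_Suc x, of s] unfolding e_def P_def by metis
    obtain w where w: "[u * w = 1] (mod int p)"
      using inverse_mod_prime[OF assms(1) u(1)] .
    \<comment> \<open>h as a function of the value t of e_(s+1): solving t = e x + u d modulo p
      gives d = w (t - e x).\<close>
    define g where "g t = h (x + P * (w * (t - e x)))" for t
    obtain \<beta> where \<beta>: "\<And>t. [g (t mod int p) = (\<Sum>r<p. \<beta> r * t ^ r)] (mod int p)"
      using interpolation_mod_prime[OF assms(1)] by metis
    have "[h (x + P * d) = (\<Sum>r<p. \<beta> r * e (x + P * d) ^ r)] (mod int p)" for d
    proof -
      define t where "t = e (x + P * d)"
      have "[w * (t mod int p - e x) = w * (e x + u * d - e x)] (mod int p)"
        using u(2)[of d] unfolding t_def by (intro cong_mult cong_diff cong_refl) simp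
      also have "w * (e x + u * d - e x) = (u * w) * d"
        by (simp add: algebra_simps)
      also have "[(u * w) * d = 1 * d] (mod int p)"
        by (intro cong_mult w cong_refl)
      \<comment> \<open>Multiplication by P raises the modulus from p to p^(s+2), the level at which
        h is constant modulo p.\<close>
      finally have "[P * (w * (t mod int p - e x)) = P * d] (mod P * int p)"
        by (simp add: cong_iff_dvd_diff flip: right_diff_distrib)
      then have "[x + P * d = x + P * (w * (t mod int p - e x))] (mod int p ^ Suc (Suc s))"
        by (intro cong_add cong_refl) (simp add: cong_sym P_def mult.commute)
      moreover have "\<not> int p dvd x + P * c" for c
        using x by (simp add: P_def dvd_add_left_iff)
      ultimately have "[h (x + P * d) = g (t mod int p)] (mod int p)"
        unfolding g_def by (intro Suc.prems)
      then show ?thesis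
        using \<beta>[of t] unfolding t_def by (rule cong_trans)
    qed
    then show ?thesis
      by blast
  qed
  then obtain \<beta> where \<beta>: "\<And>x d. \<not> int p dvd x \<Longrightarrow>
      [h (x + P * d) = (\<Sum>r<p. \<beta> x r * e (x + P * d) ^ r)] (mod int p)"
    by metis
  \<comment> \<open>The coefficients \<beta> were chosen for each x separately; taking them at the
    representative x mod P makes B r a function of the class modulo p^(s+1).\<close>
  define B where "B r x = \<beta> (x mod P) r" for r x
  have hB: "[h x = (\<Sum>r<p. B r x * e x ^ r)] (mod int p)" if "\<not> int p dvd x" for x
  proof -
    have "\<not> int p dvd x mod P"
      using that unfolding P_def by (simp add: dvd_mod_iff)
    from \<beta>[OF this, of "x div P"] show ?thesis
      by (simp add: B_def)
  qed
  have "\<exists>\<alpha>. \<forall>x. \<not> int p dvd x \<longrightarrow> [B r x = (\<Sum>n<K. \<alpha> n * basis_fun p n x)] (mod int p)" for r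
    unfolding K_def by (rule Suc.IH) (simp add: B_def P_def cong_def)
  then obtain \<alpha> where \<alpha>: "\<And>r x. \<not> int p dvd x \<Longrightarrow> [B r x = (\<Sum>n<K. \<alpha> r n * basis_fun p n x)] (mod int p)"
    by metis
  \<comment> \<open>An index N = n + r K with n < K is split by quotient and remainder, matching
    \<open>basis_fun_step\<close>.\<close>
  define A where "A N = \<alpha> (N div K) (N mod K)" for N
  have "[h x = (\<Sum>N<(p - 1) * p ^ Suc s. A N * basis_fun p N x)] (mod int p)" if x: "\<not> int p dvd x" for x
  proof -
    have "[h x = (\<Sum>r<p. B r x * e x ^ r)] (mod int p)"
      by (rule hB[OF x])
    also have "[(\<Sum>r<p. B r x * e x ^ r) = (\<Sum>r<p. (\<Sum>n<K. \<alpha> r n * basis_fun p n x) * e x ^ r)] (mod int p)"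
      by (intro cong_sum cong_mult \<alpha> x cong_refl)
    also have "(\<Sum>r<p. (\<Sum>n<K. \<alpha> r n * basis_fun p n x) * e x ^ r) =
        (\<Sum>r<p. \<Sum>n<K. A (n + r * K) * basis_fun p (n + r * K) x)"
    proof (rule sum.cong[OF refl])
      fix r assume r: "r \<in> {..<p}"
      have "\<alpha> r n * basis_fun p n x * e x ^ r = A (n + r * K) * basis_fun p (n + r * K) x" if "n \<in> {..<K}" for n
        using that r K basis_fun_step[OF assms(1), of n s r x] unfolding A_def K_def e_def
        by (simp add: ac_simps)
      then show "(\<Sum>n<K. \<alpha> r n * basis_fun p n x) * e x ^ r = (\<Sum>n<K. A (n + r * K) * basis_fun p (n + r * K) x)"
        unfolding sum_distrib_right by (rule sum.cong[OF refl])
    qed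
    also have "\<dots> = (\<Sum>N<(p - 1) * p ^ Suc s. A N * basis_fun p N x)"
      unfolding sum_basis_split K_def ..
    finally show ?thesis .
  qed
  then show ?case
    by blast
qed

text \<open>Grouping by powers of e_(s+1) gives, on each class modulo p^(s+1), a polynomial of
  degree below p in e_(s+1). Since e_(s+1) takes all residues there, its coefficients vanish; they
  are combinations of the previous level.\<close>

lemma basis_independent_mod_prime:
  assumes "prime p"
    and "\<And>x. \<not> int p dvd x \<Longrightarrow> [(\<Sum>n<(p - 1) * p ^ s. \<alpha> n * basis_fun p n x) = 0] (mod int p)"
    and "n < (p - 1) * p ^ s"
  shows "[\<alpha> n = 0] (mod int p)"
  using assms(2,3)
proof (induction s arbitrary: \<alpha> n)
  case 0
  have p: "p > 1"
    using assms(1) by (rule prime_gt_1_nat)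
  \<comment> \<open>The relation is multiplied by t, so that it also holds at t divisible by p; the
    degree rises only to p - 1, still within the root bound.\<close>
  define \<beta> where "\<beta> r = (case r of 0 \<Rightarrow> 0 | Suc i \<Rightarrow> \<alpha> i)" for r
  have "[(\<Sum>r<p. \<beta> r * t ^ r) = 0] (mod int p)" for t
  proof -
    have "(\<Sum>r<p. \<beta> r * t ^ r) = (\<Sum>r<Suc (p - 1). \<beta> r * t ^ r)"
      using p by simp
    also have "\<dots> = t * (\<Sum>n<p - 1. \<alpha> n * t ^ n)"
      unfolding sum.lessThan_Suc_shift by (simp add: \<beta>_def sum_distrib_left ac_simps)
    also have "(\<Sum>n<p - 1. \<alpha> n * t ^ n) = (\<Sum>n<p - 1. \<alpha> n * basis_fun p n t)"
      using basis_fun_less[OF assms(1)] by (intro sum.cong) auto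
    finally have eq: "(\<Sum>r<p. \<beta> r * t ^ r) = t * (\<Sum>n<p - 1. \<alpha> n * basis_fun p n t)" .
    show ?thesis
      unfolding eq using 0(1)[of t] by (cases "int p dvd t") (auto simp: cong_0_iff)
  qed
  from coeffs_vanish_mod_prime[OF assms(1) this, of "Suc n"] show ?case
    using 0(2) by (simp add: \<beta>_def)
next
  case (Suc s)
  define P where "P = int p ^ Suc s"
  define K where "K = (p - 1) * p ^ s"
  define e where "e = e_int p (Suc s)"
  have p: "p > 1"
    using assms(1) by (rule prime_gt_1_nat)
  have K: "K > 0"
    using p unfolding K_def by simp
  have sub: "[(\<Sum>n<K. \<alpha> (n + r * K) * basis_fun p n x) = 0] (mod int p)"
    if r: "r < p" and x: "\<not> int p dvd x" for r x
  proof -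
    define \<beta> where "\<beta> r = (\<Sum>n<K. \<alpha> (n + r * K) * basis_fun p n x)" for r
    obtain u where u: "\<not> int p dvd u" "\<And>d. [e (x + P * d) = e x + u * d] (mod int p)"
      using e_int_shift[OF assms(1) zero_less_Suc x, of s] unfolding e_def P_def by metis
    obtain w where w: "[u * w = 1] (mod int p)"
      using inverse_mod_prime[OF assms(1) u(1)] .
    have "[(\<Sum>r<p. \<beta> r * t ^ r) = 0] (mod int p)" for t
    proof -
      \<comment> \<open>The lift of the class of x at which e_(s+1) takes the value t modulo p. The
        basis functions of index below K do not notice the passage from x to y.\<close>
      define y where "y = x + P * (w * (t - e x))"
      have y: "\<not> int p dvd y"
        using x by (simp add: y_def P_def dvd_add_left_iff)
      have yx: "[y = x] (mod int p ^ Suc s)"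
        by (simp add: y_def P_def cong_def)
      have "[e y = e x + (u * w) * (t - e x)] (mod int p)"
        using u(2)[of "w * (t - e x)"] by (simp add: y_def ac_simps)
      also have "[e x + (u * w) * (t - e x) = e x + 1 * (t - e x)] (mod int p)"
        by (intro cong_add cong_mult w cong_refl)
      finally have ey: "[t = e y] (mod int p)"
        by (simp add: cong_sym)
      have "[(\<Sum>r<p. \<beta> r * t ^ r) = (\<Sum>r<p. (\<Sum>n<K. \<alpha> (n + r * K) * basis_fun p n y) * e y ^ r)] (mod int p)"
        unfolding \<beta>_def
      proof (intro cong_sum cong_mult cong_pow cong_refl ey)
        fix n assume "n \<in> {..<K}"
        then show "[basis_fun p n x = basis_fun p n y] (mod int p)"
          using basis_fun_cong[OF assms(1) _ x yx, of n] by (simp add: K_def cong_sym)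
      qed
      also have "(\<Sum>r<p. (\<Sum>n<K. \<alpha> (n + r * K) * basis_fun p n y) * e y ^ r) =
          (\<Sum>r<p. \<Sum>n<K. \<alpha> (n + r * K) * basis_fun p (n + r * K) y)"
      proof (rule sum.cong[OF refl])
        fix r assume r: "r \<in> {..<p}"
        have "\<alpha> (n + r * K) * basis_fun p n y * e y ^ r = \<alpha> (n + r * K) * basis_fun p (n + r * K) y" if "n \<in> {..<K}" for n
          using that r basis_fun_step[OF assms(1), of n s r y] unfolding K_def e_def by simp
        then show "(\<Sum>n<K. \<alpha> (n + r * K) * basis_fun p n y) * e y ^ r =
            (\<Sum>n<K. \<alpha> (n + r * K) * basis_fun p (n + r * K) y)"
          unfolding sum_distrib_right by (rule sum.cong[OF refl])
      qed
      also have "\<dots> = (\<Sum>N<(p - 1) * p ^ Suc s. \<alpha> N * basis_fun p N y)"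
        unfolding sum_basis_split K_def ..
      also have "[\<dots> = 0] (mod int p)"
        by (rule Suc.prems(1)[OF y])
      finally show ?thesis .
    qed
    from coeffs_vanish_mod_prime[OF assms(1) this r] show ?thesis
      unfolding \<beta>_def .
  qed
  have "n < p * K"
    using Suc.prems(2) unfolding K_def by (simp add: ac_simps)
  then have "n div K < p"
    by (simp add: less_mult_imp_div_less)
  have "[\<alpha> (n mod K + (n div K) * K) = 0] (mod int p)"
    using Suc.IH[of "\<lambda>i. \<alpha> (i + (n div K) * K)" "n mod K"] sub[OF \<open>n div K < p\<close>] K unfolding K_def by simp
  then show ?case
    by simp
qed

section \<open>Expansions modulo p^N and the twist by x^(2m)\<close>

lemma basis_fun_eq:
  assumes "prime p" "\<not> int p dvd x"
  shows "int p ^ basis_val p n * basis_fun p n x =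
    (\<Prod>j | phi_digits p n j \<noteq> 0. unit_prod p j x ^ phi_digits p n j)"
  unfolding basis_fun_def basis_val_def e_int_eq[OF assms] power_sum
  by (simp add: power_mult_distrib prod.distrib power_mult mult.commute flip: power_mult)

text \<open>The undivided product is an integer polynomial in x and respects congruences; cancelling
  p^\<open>basis_val\<close> costs that many levels.\<close>

lemma basis_fun_cong_power:
  assumes "prime p" "\<not> int p dvd x" "\<not> int p dvd y" "[x = y] (mod int p ^ (N + basis_val p n))"
  shows "[basis_fun p n x = basis_fun p n y] (mod int p ^ N)"
proof -
  have "[unit_prod p j x = unit_prod p j y] (mod int p ^ (N + basis_val p n))" for j
    unfolding unit_prod_def using assms(4) by (auto intro!: cong_prod cong_diff)
  then have "[int p ^ basis_val p n * basis_fun p n x = int p ^ basis_val p n * basis_fun p n y]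
      (mod int p ^ (N + basis_val p n))"
    unfolding basis_fun_eq[OF assms(1,2)] basis_fun_eq[OF assms(1,3)] by (intro cong_prod cong_pow)
  moreover have "p > 0"
    using assms(1) by (rule prime_gt_0_nat)
  ultimately show ?thesis
    by (simp add: cong_iff_dvd_diff power_add mult.commute[of "int p ^ N"] flip: right_diff_distrib)
qed

text \<open>Uniform continuity for the p-adic metric on the integers prime to p.\<close>

definition unit_continuous :: "nat \<Rightarrow> (int \<Rightarrow> int) \<Rightarrow> bool" where
  "unit_continuous p h \<longleftrightarrow> (\<forall>N. \<exists>s. \<forall>x y. \<not> int p dvd x \<longrightarrow> \<not> int p dvd y \<longrightarrow>
     [x = y] (mod int p ^ s) \<longrightarrow> [h x = h y] (mod int p ^ N))"

definition twisted_basis :: "nat \<Rightarrow> nat \<Rightarrow> nat \<Rightarrow> int \<Rightarrow> int" where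
  "twisted_basis p m n x = x ^ (2 * m) * basis_fun p n x"

text \<open>Linearity forces the value t on h modulo p^N once the values l n on the twisted basis
  are prescribed. As a relation it is compatible with sums and multiples before anything is known
  about existence or uniqueness of t.\<close>

definition represents ::
    "nat \<Rightarrow> nat \<Rightarrow> (nat \<Rightarrow> int) \<Rightarrow> nat \<Rightarrow> (int \<Rightarrow> int) \<Rightarrow> int \<Rightarrow> bool" where
  "represents p m l N h t \<longleftrightarrow> (\<exists>J \<alpha>.
     (\<forall>x. \<not> int p dvd x \<longrightarrow> [h x = (\<Sum>n<J. \<alpha> n * twisted_basis p m n x)] (mod int p ^ N)) \<and>
     [t = (\<Sum>n<J. \<alpha> n * l n)] (mod int p ^ N))"

lemma represents_zero: "represents p m l N (\<lambda>x. 0) 0"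
  unfolding represents_def by (intro exI[of _ 0]) simp

lemma represents_basis: "represents p m l N (twisted_basis p m n) (l n)"
  unfolding represents_def
proof (intro exI conjI allI impI)
  have "(\<Sum>i<Suc n. (if i = n then 1 else 0) * f i) = f n" for f :: "nat \<Rightarrow> int"
    by (simp add: if_distrib[of "\<lambda>c. c * _"] sum.delta cong: if_cong)
  then show "[twisted_basis p m n x = (\<Sum>i<Suc n. (if i = n then 1 else 0) * twisted_basis p m i x)] (mod int p ^ N)"
    and "[l n = (\<Sum>i<Suc n. (if i = n then 1 else 0) * l i)] (mod int p ^ N)" for x
    by simp_all
qed

lemma represents_scale:
  assumes "represents p m l N h t"
  shows "represents p m l N (\<lambda>x. c * h x) (c * t)"
proof -
  obtain J \<alpha> where "\<And>x. \<not> int p dvd x \<Longrightarrow> [h x = (\<Sum>n<J. \<alpha> n * twisted_basis p m n x)] (mod int p ^ N)"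
    "[t = (\<Sum>n<J. \<alpha> n * l n)] (mod int p ^ N)"
    using assms unfolding represents_def by blast
  moreover have "(\<Sum>n<J. c * \<alpha> n * f n) = c * (\<Sum>n<J. \<alpha> n * f n)" for f
    by (simp add: sum_distrib_left mult.assoc)
  ultimately show ?thesis
    unfolding represents_def
    by (intro exI[of _ J] exI[of _ "\<lambda>n. c * \<alpha> n"]) (simp add: cong_scalar_left)
qed

lemma represents_add:
  assumes "represents p m l N h t" "represents p m l N h' t'"
  shows "represents p m l N (\<lambda>x. h x + h' x) (t + t')"
proof -
  obtain J \<alpha> where 1: "\<And>x. \<not> int p dvd x \<Longrightarrow> [h x = (\<Sum>n<J. \<alpha> n * twisted_basis p m n x)] (mod int p ^ N)"
    "[t = (\<Sum>n<J. \<alpha> n * l n)] (mod int p ^ N)"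
    using assms(1) unfolding represents_def by blast
  obtain J' \<alpha>' where 2: "\<And>x. \<not> int p dvd x \<Longrightarrow> [h' x = (\<Sum>n<J'. \<alpha>' n * twisted_basis p m n x)] (mod int p ^ N)"
    "[t' = (\<Sum>n<J'. \<alpha>' n * l n)] (mod int p ^ N)"
    using assms(2) unfolding represents_def by blast
  define \<beta> where "\<beta> n = (if n < J then \<alpha> n else 0) + (if n < J' then \<alpha>' n else 0)" for n
  have "(\<Sum>n<max J J'. \<beta> n * f n) = (\<Sum>n<J. \<alpha> n * f n) + (\<Sum>n<J'. \<alpha>' n * f n)" for f
  proof -
    have "(\<Sum>n<max J J'. \<beta> n * f n) = (\<Sum>n<max J J'. (if n < J then \<alpha> n else 0) * f n) +
        (\<Sum>n<max J J'. (if n < J' then \<alpha>' n else 0) * f n)"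
      unfolding \<beta>_def by (simp add: distrib_right sum.distrib)
    also have "(\<Sum>n<max J J'. (if n < J then \<alpha> n else 0) * f n) = (\<Sum>n<J. \<alpha> n * f n)"
      by (intro sum.mono_neutral_cong_right) auto
    also have "(\<Sum>n<max J J'. (if n < J' then \<alpha>' n else 0) * f n) = (\<Sum>n<J'. \<alpha>' n * f n)"
      by (intro sum.mono_neutral_cong_right) auto
    finally show ?thesis .
  qed
  then show ?thesis
    unfolding represents_def using 1 2
    by (intro exI[of _ "max J J'"] exI[of _ \<beta>]) (simp add: cong_add)
qed

lemma represents_sum:
  assumes "finite A" "\<And>i. i \<in> A \<Longrightarrow> represents p m l N (h i) (t i)"
  shows "represents p m l N (\<lambda>x. \<Sum>i\<in>A. h i x) (\<Sum>i\<in>A. t i)"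
  using assms by (induction A) (simp_all add: represents_zero represents_add)

lemma represents_cong:
  assumes "represents p m l N h t" "\<And>x. \<not> int p dvd x \<Longrightarrow> [h' x = h x] (mod int p ^ N)"
    "[t' = t] (mod int p ^ N)"
  shows "represents p m l N h' t'"
  using assms unfolding represents_def by (meson cong_trans)

lemma represents_lift:
  assumes "represents p m l N h t"
  shows "represents p m l (Suc N) (\<lambda>x. int p * h x) (int p * t)"
proof -
  obtain J \<alpha> where 1: "\<And>x. \<not> int p dvd x \<Longrightarrow> [h x = (\<Sum>n<J. \<alpha> n * twisted_basis p m n x)] (mod int p ^ N)"
    "[t = (\<Sum>n<J. \<alpha> n * l n)] (mod int p ^ N)"
    using assms unfolding represents_def by blast
  have "(\<Sum>n<J. int p * \<alpha> n * f n) = int p * (\<Sum>n<J. \<alpha> n * f n)" for f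
    by (simp add: sum_distrib_left mult.assoc)
  moreover have "[int p * a = int p * b] (mod int p ^ Suc N)" if "[a = b] (mod int p ^ N)" for a b
    using that by (simp add: cong_iff_dvd_diff flip: right_diff_distrib)
  ultimately show ?thesis
    unfolding represents_def using 1
    by (intro exI[of _ J] exI[of _ "\<lambda>n. int p * \<alpha> n"]) simp
qed

lemma represents_Suc:
  assumes "represents p m l (Suc N) h t" "\<And>n. [l n = l' n] (mod int p ^ N)"
  shows "represents p m l' N h t"
proof -
  obtain J \<alpha> where 1: "\<And>x. \<not> int p dvd x \<Longrightarrow> [h x = (\<Sum>n<J. \<alpha> n * twisted_basis p m n x)] (mod int p ^ Suc N)"
    "[t = (\<Sum>n<J. \<alpha> n * l n)] (mod int p ^ Suc N)"
    using assms(1) unfolding represents_def by blast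
  have weak: "[a = b] (mod int p ^ N)" if "[a = b] (mod int p ^ Suc N)" for a b
    using that by (rule cong_dvd_modulus) simp
  have "[(\<Sum>n<J. \<alpha> n * l n) = (\<Sum>n<J. \<alpha> n * l' n)] (mod int p ^ N)"
    by (intro cong_sum cong_mult cong_refl assms(2))
  then show ?thesis
    unfolding represents_def using 1 weak by (intro exI[of _ J] exI[of _ \<alpha>]) (meson cong_trans)
qed

context
  fixes p m :: nat
  assumes prime: "prime p"
begin

lemma twisted_basis_cong:
  assumes "\<not> int p dvd x" "\<not> int p dvd y" "[x = y] (mod int p ^ (N + basis_val p n))"
  shows "[twisted_basis p m n x = twisted_basis p m n y] (mod int p ^ N)"
  unfolding twisted_basis_def
proof (intro cong_mult cong_pow)
  show "[x = y] (mod int p ^ N)"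
    by (rule cong_dvd_modulus[OF assms(3)]) (simp add: le_imp_power_dvd)
  show "[basis_fun p n x = basis_fun p n y] (mod int p ^ N)"
    by (rule basis_fun_cong_power[OF prime assms])
qed

text \<open>By Fermat, x^(2m(p-2)) inverts x^(2m) modulo p at units. So h is divided by the twist,
  expanded in the untwisted basis and multiplied back.\<close>

lemma twisted_basis_span_mod_prime:
  assumes "\<And>x y. \<not> int p dvd x \<Longrightarrow> \<not> int p dvd y \<Longrightarrow> [x = y] (mod int p ^ Suc s) \<Longrightarrow> [h x = h y] (mod int p)"
  shows "\<exists>\<alpha>. \<forall>x. \<not> int p dvd x \<longrightarrow>
    [h x = (\<Sum>n<(p - 1) * p ^ s. \<alpha> n * twisted_basis p m n x)] (mod int p)"
proof -
  have p: "p > 1"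
    using prime by (rule prime_gt_1_nat)
  define g where "g x = h x * x ^ (2 * m * (p - 2))" for x
  have "[g x = g y] (mod int p)"
    if "\<not> int p dvd x" "\<not> int p dvd y" "[x = y] (mod int p ^ Suc s)" for x y
  proof -
    have "[x = y] (mod int p)"
      by (rule cong_dvd_modulus[OF that(3)]) simp
    then show ?thesis
      unfolding g_def using assms[OF that] by (intro cong_mult cong_pow)
  qed
  then obtain \<alpha> where \<alpha>: "\<And>x. \<not> int p dvd x \<Longrightarrow>
      [g x = (\<Sum>n<(p - 1) * p ^ s. \<alpha> n * basis_fun p n x)] (mod int p)"
    using basis_span_mod_prime[OF prime, of s g] by blast
  have "[h x = (\<Sum>n<(p - 1) * p ^ s. \<alpha> n * twisted_basis p m n x)] (mod int p)" if x: "\<not> int p dvd x" for x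
  proof -
    have "[h x * (x ^ (p - 1)) ^ (2 * m) = h x * 1 ^ (2 * m)] (mod int p)"
      by (intro cong_mult cong_pow cong_refl fermat_int[OF prime x])
    then have "[h x = h x * (x ^ (p - 1)) ^ (2 * m)] (mod int p)"
      by (simp add: cong_sym)
    also have "h x * (x ^ (p - 1)) ^ (2 * m) = x ^ (2 * m) * g x"
    proof -
      have "p - 1 = Suc (p - 2)"
        using p by simp
      then have "(x ^ (p - 1)) ^ (2 * m) = x ^ (2 * m) * x ^ (2 * m * (p - 2))"
        by (simp add: power_mult_distrib mult.commute flip: power_mult)
      then show ?thesis
        unfolding g_def by simp
    qed
    also have "[\<dots> = x ^ (2 * m) * (\<Sum>n<(p - 1) * p ^ s. \<alpha> n * basis_fun p n x)] (mod int p)"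
      by (intro cong_mult cong_refl \<alpha> x)
    finally show ?thesis
      by (simp add: twisted_basis_def sum_distrib_left ac_simps)
  qed
  then show ?thesis
    by blast
qed

text \<open>Modulo p the invertible twist cancels and the coefficients vanish; divided by p they
  satisfy a relation of the same shape with the exponent lowered by one.\<close>

lemma twisted_basis_independent:
  assumes "\<And>x. \<not> int p dvd x \<Longrightarrow> [(\<Sum>n<J. \<alpha> n * twisted_basis p m n x) = 0] (mod int p ^ N)" "n < J"
  shows "[\<alpha> n = 0] (mod int p ^ N)"
  using assms
proof (induction N arbitrary: \<alpha> n)
  case (Suc N)
  have p: "p > 1"
    using prime by (rule prime_gt_1_nat)
  \<comment> \<open>The range of summation is padded with zero coefficients to a full level, taken
    as s = J, because independence modulo p is stated for full levels.\<close>
  have "J < 2 ^ J"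
    by (rule less_exp)
  also have "2 ^ J \<le> p ^ J"
    using p by (intro power_mono) auto
  also have "p ^ J \<le> (p - 1) * p ^ J"
    using p by simp
  finally have J: "J < (p - 1) * p ^ J" .
  define \<beta> where "\<beta> n = (if n < J then \<alpha> n else 0)" for n
  have "[(\<Sum>n<(p - 1) * p ^ J. \<beta> n * basis_fun p n x) = 0] (mod int p)" if x: "\<not> int p dvd x" for x
  proof -
    have "int p dvd (\<Sum>n<J. \<alpha> n * twisted_basis p m n x)"
      using Suc.prems(1)[OF x] unfolding cong_0_iff by (metis dvd_trans dvd_power zero_less_Suc)
    also have "(\<Sum>n<J. \<alpha> n * twisted_basis p m n x) = x ^ (2 * m) * (\<Sum>n<J. \<alpha> n * basis_fun p n x)"
      by (simp add: twisted_basis_def sum_distrib_left ac_simps)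
    also have "(\<Sum>n<J. \<alpha> n * basis_fun p n x) = (\<Sum>n<(p - 1) * p ^ J. \<beta> n * basis_fun p n x)"
      using J unfolding \<beta>_def by (intro sum.mono_neutral_cong_left) auto
    finally have "int p dvd x ^ (2 * m) * (\<Sum>n<(p - 1) * p ^ J. \<beta> n * basis_fun p n x)" .
    moreover have "\<not> int p dvd x ^ (2 * m)"
      using x prime prime_dvd_power[of "int p" x "2 * m"] by auto
    ultimately show ?thesis
      using prime by (simp add: cong_0_iff prime_dvd_mult_iff)
  qed
  then have "[\<beta> n = 0] (mod int p)" if "n < J" for n
    using basis_independent_mod_prime[OF prime, where s = J and \<alpha> = \<beta> and n = n] that J by simp
  then have div: "int p dvd \<alpha> n" if "n < J" for n
    using that by (auto simp: \<beta>_def cong_0_iff)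
  define a where "a n = \<alpha> n div int p" for n
  have a: "\<alpha> n = int p * a n" if "n < J" for n
    using div[OF that] unfolding a_def by simp
  have "[(\<Sum>n<J. a n * twisted_basis p m n x) = 0] (mod int p ^ N)" if x: "\<not> int p dvd x" for x
  proof -
    have "int p * (\<Sum>n<J. a n * twisted_basis p m n x) = (\<Sum>n<J. \<alpha> n * twisted_basis p m n x)"
      unfolding sum_distrib_left by (intro sum.cong) (auto simp: a)
    then have "int p * int p ^ N dvd int p * (\<Sum>n<J. a n * twisted_basis p m n x)"
      using Suc.prems(1)[OF x] by (simp add: cong_0_iff)
    then show ?thesis
      using p by (simp add: cong_0_iff)
  qed
  then have "[a n = 0] (mod int p ^ N)"
    using Suc.IH Suc.prems(2) by blast
  then show ?case
    using a[OF Suc.prems(2)] by (auto simp: cong_0_iff)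
qed (simp add: cong_def)

text \<open>The difference of the two expansions represents the zero function, so its coefficients
  vanish modulo p^N by independence.\<close>

lemma represents_unique:
  assumes "represents p m l N h t" "represents p m l N h t'"
  shows "[t = t'] (mod int p ^ N)"
proof -
  have "represents p m l N (\<lambda>x. h x + (- 1) * h x) (t + (- 1) * t')"
    by (intro represents_add represents_scale assms)
  then obtain J \<alpha> where 1: "\<And>x. \<not> int p dvd x \<Longrightarrow> [0 = (\<Sum>n<J. \<alpha> n * twisted_basis p m n x)] (mod int p ^ N)"
    and 2: "[t - t' = (\<Sum>n<J. \<alpha> n * l n)] (mod int p ^ N)"
    unfolding represents_def by auto
  have "[\<alpha> n = 0] (mod int p ^ N)" if "n < J" for n
    using twisted_basis_independent[where J = J and \<alpha> = \<alpha> and N = N and n = n] 1 that by (simp add: cong_sym)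
  then have "[(\<Sum>n<J. \<alpha> n * l n) = (\<Sum>n<J. 0 * l n)] (mod int p ^ N)"
    by (intro cong_sum cong_mult cong_refl) simp
  then have "[t - t' = 0] (mod int p ^ N)"
    using 2 by (simp add: cong_trans)
  then show ?thesis
    by (simp add: cong_iff_dvd_diff)
qed

text \<open>Successive approximation: subtract a combination S agreeing with h modulo p, divide the
  difference by p, and expand the quotient g modulo p^N. The point to check is that g is again
  continuous.\<close>

lemma represents_exists:
  assumes "unit_continuous p h"
  shows "\<exists>t. represents p m l N h t"
  using assms
proof (induction N arbitrary: h)
  case 0
  have "represents p m l 0 h 0"
    by (rule represents_cong[OF represents_zero]) simp_all
  then show ?case ..
next
  case (Suc N)
  have p: "p > 1"
    using prime by (rule prime_gt_1_nat)
  have level: "\<exists>s. \<forall>x y. \<not> int p dvd x \<longrightarrow> \<not> int p dvd y \<longrightarrow> [x = y] (mod int p ^ s) \<longrightarrow>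
      [h x = h y] (mod int p ^ K)" for K
    using Suc.prems unfolding unit_continuous_def by blast
  obtain s where s: "\<And>x y. \<not> int p dvd x \<Longrightarrow> \<not> int p dvd y \<Longrightarrow> [x = y] (mod int p ^ s) \<Longrightarrow> [h x = h y] (mod int p)"
    using level[of 1] by auto
  have "[h x = h y] (mod int p)"
    if "\<not> int p dvd x" "\<not> int p dvd y" "[x = y] (mod int p ^ Suc s)" for x y
    by (rule s[OF that(1,2)], rule cong_dvd_modulus[OF that(3)]) simp
  then obtain \<alpha> where \<alpha>: "\<And>x. \<not> int p dvd x \<Longrightarrow>
      [h x = (\<Sum>n<(p - 1) * p ^ s. \<alpha> n * twisted_basis p m n x)] (mod int p)"
    using twisted_basis_span_mod_prime[of s h] by blast
  define J where "J = (p - 1) * p ^ s"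
  define S where "S x = (\<Sum>n<J. \<alpha> n * twisted_basis p m n x)" for x
  define g where "g x = (h x - S x) div int p" for x
  have g: "h x = S x + int p * g x" if "\<not> int p dvd x" for x
    using \<alpha>[OF that] unfolding g_def S_def J_def by (simp add: cong_iff_dvd_diff)
  have "unit_continuous p g"
    unfolding unit_continuous_def
  proof
    fix K
    obtain s where s: "\<And>x y. \<not> int p dvd x \<Longrightarrow> \<not> int p dvd y \<Longrightarrow> [x = y] (mod int p ^ s) \<Longrightarrow>
        [h x = h y] (mod int p ^ Suc K)"
      using level[of "Suc K"] by blast
    \<comment> \<open>A level fine enough for h and for every basis function in S. The exponent Suc
      K allows for the division by p; the sum serves as an upper bound of its terms.\<close>
    define s' where "s' = s + (\<Sum>n<J. Suc K + basis_val p n)"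
    have "[g x = g y] (mod int p ^ K)"
      if x: "\<not> int p dvd x" and y: "\<not> int p dvd y" and xy: "[x = y] (mod int p ^ s')" for x y
    proof -
      have "[h x = h y] (mod int p ^ Suc K)"
        by (rule s[OF x y], rule cong_dvd_modulus[OF xy]) (simp add: s'_def le_imp_power_dvd)
      moreover have "[S x = S y] (mod int p ^ Suc K)"
        unfolding S_def
      proof (intro cong_sum cong_mult cong_refl twisted_basis_cong x y)
        fix n assume "n \<in> {..<J}"
        then have "Suc K + basis_val p n \<le> (\<Sum>n<J. Suc K + basis_val p n)"
          by (intro member_le_sum) auto
        then have "Suc K + basis_val p n \<le> s'"
          unfolding s'_def by linarith
        then show "[x = y] (mod int p ^ (Suc K + basis_val p n))"
          by (intro cong_dvd_modulus[OF xy] le_imp_power_dvd)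
      qed
      ultimately have "[h x - S x = h y - S y] (mod int p ^ Suc K)"
        by (rule cong_diff)
      then have "[int p * g x = int p * g y] (mod int p ^ Suc K)"
        using g[OF x] g[OF y] by simp
      then show ?thesis
        using p by (simp add: cong_iff_dvd_diff flip: right_diff_distrib)
    qed
    then show "\<exists>s. \<forall>x y. \<not> int p dvd x \<longrightarrow> \<not> int p dvd y \<longrightarrow> [x = y] (mod int p ^ s) \<longrightarrow>
        [g x = g y] (mod int p ^ K)"
      by blast
  qed
  then obtain t where "represents p m l N g t"
    using Suc.IH by blast
  then have "represents p m l (Suc N) (\<lambda>x. S x + int p * g x) ((\<Sum>n<J. \<alpha> n * l n) + int p * t)"
    unfolding S_def
    by (intro represents_add represents_lift represents_sum represents_scale represents_basis) auto
  then have "represents p m l (Suc N) h ((\<Sum>n<J. \<alpha> n * l n) + int p * t)"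
    by (rule represents_cong) (auto simp: g)
  then show ?case ..
qed

end

section \<open>Coordinates of p-adic integers\<close>

lemma in_carrier_Zp_iff:
  "x \<in> carrier (Zp p) \<longleftrightarrow> (\<forall>n. 0 \<le> x n \<and> x n < int p ^ n \<and> x (Suc n) mod int p ^ n = x n)"
  by (auto simp: Zp_def)

lemma Zp_simps:
  "(x \<oplus>\<^bsub>Zp p\<^esub> y) n = (x n + y n) mod int p ^ n"
  "(x \<otimes>\<^bsub>Zp p\<^esub> y) n = (x n * y n) mod int p ^ n"
  "\<one>\<^bsub>Zp p\<^esub> n = 1 mod int p ^ n"
  "\<zero>\<^bsub>Zp p\<^esub> n = 0"
  by (simp_all add: Zp_def)

lemma Zp_mod_level:
  assumes "x \<in> carrier (Zp p)" "i \<le> n"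
  shows "x n mod int p ^ i = x i"
  using assms(2)
proof (induction n rule: dec_induct)
  case base
  then show ?case
    using assms(1) by (simp add: in_carrier_Zp_iff)
next
  case (step n)
  have "x (Suc n) mod int p ^ i = x (Suc n) mod int p ^ n mod int p ^ i"
    using step.hyps by (simp add: mod_mod_cancel le_imp_power_dvd)
  then show ?case
    using step.IH assms(1) by (simp add: in_carrier_Zp_iff)
qed

lemma Zp_mod_self: "x \<in> carrier (Zp p) \<Longrightarrow> x n mod int p ^ n = x n"
  by (simp add: Zp_mod_level)

lemma Zp_cong_level:
  assumes "x \<in> carrier (Zp p)" "i \<le> n"
  shows "[x n = x i] (mod int p ^ i)"
  using Zp_mod_level[OF assms] by (simp add: cong_def) (metis mod_mod_trivial)

definition Zp_of_int :: "nat \<Rightarrow> int \<Rightarrow> nat \<Rightarrow> int" where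
  "Zp_of_int p z n = z mod int p ^ n"

context
  fixes p :: nat
  assumes prime: "prime p"
begin

interpretation Z: cring "Zp p"
  by (rule cring_Zp[OF prime_gt_0_nat[OF prime]])

lemma in_carrier_ZpI:
  assumes "\<And>n. [x (Suc n) = x n] (mod int p ^ n)"
  shows "(\<lambda>n. x n mod int p ^ n) \<in> carrier (Zp p)"
  using assms prime_gt_0_nat[OF prime] by (auto simp: in_carrier_Zp_iff mod_mod_cancel cong_def)

lemma Zp_of_int_carrier: "Zp_of_int p z \<in> carrier (Zp p)"
  unfolding Zp_of_int_def[abs_def] by (rule in_carrier_ZpI) simp

lemma Zp_uminus_apply:
  assumes "x \<in> carrier (Zp p)"
  shows "(\<ominus>\<^bsub>Zp p\<^esub> x) n = (- x n) mod int p ^ n"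
proof -
  have "(\<lambda>n. (- x n) mod int p ^ n) \<in> carrier (Zp p)"
    using assms by (intro in_carrier_ZpI) (simp add: cong_minus_minus_iff Zp_cong_level)
  moreover have "(\<lambda>n. (- x n) mod int p ^ n) \<oplus>\<^bsub>Zp p\<^esub> x = \<zero>\<^bsub>Zp p\<^esub>"
    by (rule ext) (simp add: Zp_simps mod_simps)
  ultimately have "\<ominus>\<^bsub>Zp p\<^esub> x = (\<lambda>n. (- x n) mod int p ^ n)"
    using Z.minus_equality assms by blast
  then show ?thesis
    by simp
qed

lemma Zp_minus_apply:
  assumes "x \<in> carrier (Zp p)" "y \<in> carrier (Zp p)"
  shows "(x \<ominus>\<^bsub>Zp p\<^esub> y) n = (x n - y n) mod int p ^ n"
  unfolding a_minus_def Zp_simps Zp_uminus_apply[OF assms(2)] by (simp add: mod_simps)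

lemma Zp_finsum_apply:
  assumes "finite A" "\<And>i. i \<in> A \<Longrightarrow> f i \<in> carrier (Zp p)"
  shows "(\<Oplus>\<^bsub>Zp p\<^esub>i\<in>A. f i) n = (\<Sum>i\<in>A. f i n) mod int p ^ n"
  using assms
proof (induction A)
  case empty
  then show ?case
    by (simp only: Z.finsum_empty Zp_simps) simp
next
  case (insert a A)
  have "(\<Oplus>\<^bsub>Zp p\<^esub>i\<in>insert a A. f i) = f a \<oplus>\<^bsub>Zp p\<^esub> (\<Oplus>\<^bsub>Zp p\<^esub>i\<in>A. f i)"
    using insert.prems insert.hyps by (intro Z.finsum_insert) auto
  then show ?case
    using insert by (simp add: Zp_simps mod_simps)
qed

lemma Zp_nat_add_pow_apply: "([(k :: nat)] \<cdot>\<^bsub>Zp p\<^esub> x) n = (int k * x n) mod int p ^ n"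
proof (induction k)
  case 0
  show ?case
    by (simp add: add_pow_def nat_pow_def Zp_simps)
next
  case (Suc k)
  have "[Suc k] \<cdot>\<^bsub>Zp p\<^esub> x = [k] \<cdot>\<^bsub>Zp p\<^esub> x \<oplus>\<^bsub>Zp p\<^esub> x"
    by (simp add: add_pow_def nat_pow_def)
  then show ?case
    using Suc.IH by (simp add: Zp_simps mod_simps algebra_simps)
qed

lemma Zp_int_add_pow_apply:
  assumes "x \<in> carrier (Zp p)"
  shows "([(k :: int)] \<cdot>\<^bsub>Zp p\<^esub> x) n = (k * x n) mod int p ^ n"
proof (cases "k < 0")
  case True
  then have "[k] \<cdot>\<^bsub>Zp p\<^esub> x = \<ominus>\<^bsub>Zp p\<^esub> ([nat (- k)] \<cdot>\<^bsub>Zp p\<^esub> x)"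
    by (simp add: add_pow_def int_pow_def a_inv_def nat_pow_def)
  moreover have "[nat (- k)] \<cdot>\<^bsub>Zp p\<^esub> x \<in> carrier (Zp p)"
    using Z.add.nat_pow_closed assms by blast
  ultimately show ?thesis
    using True by (simp add: Zp_uminus_apply Zp_nat_add_pow_apply mod_simps)
next
  case False
  then have "[k] \<cdot>\<^bsub>Zp p\<^esub> x = [nat k] \<cdot>\<^bsub>Zp p\<^esub> x"
    by (simp add: add_pow_def int_pow_def nat_pow_def)
  then show ?thesis
    using False by (simp add: Zp_nat_add_pow_apply)
qed

lemma Zp_unit_level:
  assumes "x \<in> carrier (Zp p)" "\<not> int p dvd x 1" "n > 0"
  shows "\<not> int p dvd x n"
proof -
  have "x n mod int p = x 1"
    using Zp_mod_level[OF assms(1), of 1 n] assms(3) by simp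
  then show ?thesis
    using assms(2) by (metis dvd_mod_iff dvd_refl)
qed

text \<open>Inverses modulo p^n are unique, so inverses chosen independently for each n are
  automatically coherent.\<close>

lemma Units_Zp_iff: "x \<in> Units (Zp p) \<longleftrightarrow> x \<in> carrier (Zp p) \<and> \<not> int p dvd x 1"
proof (intro iffI conjI)
  assume x: "x \<in> Units (Zp p)"
  then show "x \<in> carrier (Zp p)"
    by (rule Z.Units_closed)
  from x obtain y where "y \<otimes>\<^bsub>Zp p\<^esub> x = \<one>\<^bsub>Zp p\<^esub>"
    unfolding Units_def by blast
  from fun_cong[OF this, of 1] have "[y 1 * x 1 = 1] (mod int p)"
    by (simp add: Zp_simps cong_def)
  then show "\<not> int p dvd x 1"
    using prime by (metis cong_dvd_iff dvd_mult dvd_refl not_prime_unit prime_nat_int_transfer)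
next
  assume x: "x \<in> carrier (Zp p) \<and> \<not> int p dvd x 1"
  have cop: "coprime (x n) (int p ^ n)" for n
  proof (cases "n = 0")
    case False
    then have "coprime (int p) (x n)"
      using x Zp_unit_level[of x n] prime by (intro prime_imp_coprime) auto
    then show ?thesis
      by (simp add: coprime_commute)
  qed simp
  then have "\<forall>n. \<exists>y. [x n * y = 1] (mod int p ^ n)"
    using cong_solve_coprime_int by blast
  then obtain y where y: "\<And>n. [x n * y n = 1] (mod int p ^ n)"
    by (auto simp: choice_iff)
  define z where "z n = y n mod int p ^ n" for n
  have "[y (Suc n) = y n] (mod int p ^ n)" for n
  proof -
    have "[x n * y (Suc n) = x (Suc n) * y (Suc n)] (mod int p ^ n)"
      using x by (intro cong_mult cong_refl cong_sym[OF Zp_cong_level]) auto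
    also have "[x (Suc n) * y (Suc n) = 1] (mod int p ^ n)"
      by (rule cong_dvd_modulus[OF y[of "Suc n"]]) simp
    also have "[1 = x n * y n] (mod int p ^ n)"
      by (rule cong_sym[OF y])
    finally show ?thesis
      using cop[of n] by (simp add: cong_mult_lcancel)
  qed
  then have z: "z \<in> carrier (Zp p)"
    unfolding z_def by (rule in_carrier_ZpI)
  have xz: "x \<otimes>\<^bsub>Zp p\<^esub> z = \<one>\<^bsub>Zp p\<^esub>"
    using y by (intro ext) (simp add: Zp_simps z_def mod_simps cong_def)
  then have "z \<otimes>\<^bsub>Zp p\<^esub> x = \<one>\<^bsub>Zp p\<^esub>"
    using Z.m_comm z x by auto
  then show "x \<in> Units (Zp p)"
    unfolding Units_def using x z xz by blast
qed

lemma Zp_of_int_Units: "\<not> int p dvd z \<Longrightarrow> Zp_of_int p z \<in> Units (Zp p)"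
  using Zp_of_int_carrier by (simp add: Units_Zp_iff Zp_of_int_def dvd_mod_iff)

lemma Zp_divide:
  assumes "z \<in> carrier (Zp p)" "z v = 0"
  shows "\<exists>w\<in>carrier (Zp p). \<forall>n. z n = int p ^ v * w n mod int p ^ n"
proof -
  have dvd: "int p ^ v dvd z (n + v)" for n
    using Zp_mod_level[OF assms(1), of v "n + v"] assms(2) by (simp add: dvd_eq_mod_eq_0)
  \<comment> \<open>Dividing by p^v loses v levels, hence coordinate n of the quotient is read off
    from coordinate n + v.\<close>
  define w where "w n = z (n + v) div int p ^ v" for n
  have w: "z (n + v) = int p ^ v * w n" for n
    using dvd[of n] by (simp add: w_def)
  have "[w (Suc n) = w n] (mod int p ^ n)" for n
  proof -
    have "[int p ^ v * w (Suc n) = int p ^ v * w n] (mod int p ^ (n + v))"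
      using Zp_cong_level[OF assms(1), of "n + v" "Suc n + v"] unfolding w[symmetric] by simp
    then show ?thesis
      using prime_gt_0_nat[OF prime] by (simp add: cong_iff_dvd_diff power_add mult.commute[of "int p ^ n"] flip: right_diff_distrib)
  qed
  then have "(\<lambda>n. w n mod int p ^ n) \<in> carrier (Zp p)"
    by (rule in_carrier_ZpI)
  moreover have "z n = int p ^ v * (w n mod int p ^ n) mod int p ^ n" for n
    using Zp_mod_level[OF assms(1), of n "n + v"] w[of n] by (simp add: mod_simps)
  ultimately show ?thesis
    by (intro bexI[of _ "\<lambda>n. w n mod int p ^ n"] allI)
qed

text \<open>The prime-to-p part u of C is invertible in Z_p, so C and p^v generate the same ideal,
  and divisibility by p^v is visible in coordinate v.\<close>

lemma in_PIdl_iff: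
  assumes "z \<in> carrier (Zp p)" "C > 0" and v: "v = multiplicity (int p) (int C)"
  shows "z \<in> PIdl\<^bsub>Zp p\<^esub> ([C] \<cdot>\<^bsub>Zp p\<^esub> \<one>\<^bsub>Zp p\<^esub>) \<longleftrightarrow> z v = 0"
proof
  assume "z \<in> PIdl\<^bsub>Zp p\<^esub> ([C] \<cdot>\<^bsub>Zp p\<^esub> \<one>\<^bsub>Zp p\<^esub>)"
  then obtain x where "z = x \<otimes>\<^bsub>Zp p\<^esub> ([C] \<cdot>\<^bsub>Zp p\<^esub> \<one>\<^bsub>Zp p\<^esub>)"
    unfolding cgenideal_def by blast
  then have "z v = x v * int C mod int p ^ v"
    by (simp add: Zp_simps Zp_nat_add_pow_apply mod_simps)
  moreover have "int p ^ v dvd x v * int C"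
    unfolding v by (intro dvd_mult multiplicity_dvd)
  ultimately show "z v = 0"
    by (simp add: dvd_eq_mod_eq_0)
next
  assume "z v = 0"
  obtain u where u: "int C = int p ^ v * u" "\<not> int p dvd u"
    unfolding v by (rule multiplicity_decompose'[of "int C" "int p"]) (use assms(2) prime in auto)
  obtain w where w: "w \<in> carrier (Zp p)" "\<And>n. z n = int p ^ v * w n mod int p ^ n"
    using Zp_divide[OF assms(1) \<open>z v = 0\<close>] by blast
  have "Zp_of_int p u \<in> Units (Zp p)"
    using u(2) by (rule Zp_of_int_Units)
  then obtain y where y: "y \<in> carrier (Zp p)" "y \<otimes>\<^bsub>Zp p\<^esub> Zp_of_int p u = \<one>\<^bsub>Zp p\<^esub>"
    unfolding Units_def by blast
  have "[y n * u = 1] (mod int p ^ n)" for n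
    using fun_cong[OF y(2), of n] by (simp add: Zp_simps Zp_of_int_def cong_def mod_simps)
  then have yu: "[(w n * int p ^ v) * (y n * u) = (w n * int p ^ v) * 1] (mod int p ^ n)" for n
    by (intro cong_mult cong_refl)
  have "z = (w \<otimes>\<^bsub>Zp p\<^esub> y) \<otimes>\<^bsub>Zp p\<^esub> ([C] \<cdot>\<^bsub>Zp p\<^esub> \<one>\<^bsub>Zp p\<^esub>)"
  proof
    fix n
    have "((w \<otimes>\<^bsub>Zp p\<^esub> y) \<otimes>\<^bsub>Zp p\<^esub> ([C] \<cdot>\<^bsub>Zp p\<^esub> \<one>\<^bsub>Zp p\<^esub>)) n = (w n * y n * int C) mod int p ^ n"
      by (simp add: Zp_simps Zp_nat_add_pow_apply mod_simps)
    also have "w n * y n * int C = (w n * int p ^ v) * (y n * u)"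
      unfolding u(1) by (simp add: ac_simps)
    finally show "z n = ((w \<otimes>\<^bsub>Zp p\<^esub> y) \<otimes>\<^bsub>Zp p\<^esub> ([C] \<cdot>\<^bsub>Zp p\<^esub> \<one>\<^bsub>Zp p\<^esub>)) n"
      using yu[of n] w(2)[of n] by (simp add: cong_def ac_simps)
  qed
  moreover have "w \<otimes>\<^bsub>Zp p\<^esub> y \<in> carrier (Zp p)"
    using w(1) y(1) by (rule Z.m_closed)
  ultimately show "z \<in> PIdl\<^bsub>Zp p\<^esub> ([C] \<cdot>\<^bsub>Zp p\<^esub> \<one>\<^bsub>Zp p\<^esub>)"
    unfolding cgenideal_def by blast
qed

end

section \<open>Continuous functions on the quotient\<close>

definition pm_class :: "nat \<Rightarrow> (nat \<Rightarrow> int) \<Rightarrow> (nat \<Rightarrow> int) set" where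
  "pm_class p x = pm_one p #>\<^bsub>units_of (Zp p)\<^esub> x"

text \<open>Uniform continuity in coordinates: the value modulo p^N depends only on the argument
  modulo p^s.\<close>

definition level_uniform :: "nat \<Rightarrow> ((nat \<Rightarrow> int) \<Rightarrow> nat \<Rightarrow> int) \<Rightarrow> bool" where
  "level_uniform p f \<longleftrightarrow>
     (\<forall>N. \<exists>s. \<forall>x\<in>Units (Zp p). \<forall>y\<in>Units (Zp p). x s = y s \<longrightarrow> f x N = f y N)"

context
  fixes p :: nat
  assumes prime: "prime p"
begin

interpretation Z: cring "Zp p"
  by (rule cring_Zp[OF prime_gt_0_nat[OF prime]])

lemma topspace_Zp_topology: "topspace (Zp_topology p) = carrier (Zp p)"
  by (simp add: Zp_topology_def)

lemma Units_subset_carrier: "Units (Zp p) \<subseteq> carrier (Zp p)"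
  using Z.Units_closed by blast

lemma Units_eq_level:
  assumes "x \<in> Units (Zp p)" "y \<in> Units (Zp p)" "x s = y s" "i \<le> s"
  shows "x i = y i"
proof -
  have "x \<in> carrier (Zp p)" "y \<in> carrier (Zp p)"
    using assms(1,2) Units_subset_carrier by blast+
  then show ?thesis
    using assms(3,4) Zp_mod_level[of x p i s] Zp_mod_level[of y p i s] by simp
qed

lemma topspace_units: "topspace (subtopology (Zp_topology p) (Units (Zp p))) = Units (Zp p)"
  using Units_subset_carrier by (simp add: topspace_Zp_topology Int_absorb1)

lemma closedin_coordinates:
  fixes Q :: "int \<Rightarrow> int \<Rightarrow> bool"
  shows "closedin (product_topology (\<lambda>_. discrete_topology UNIV) UNIV) {x :: nat \<Rightarrow> int. Q (x i) (x j)}"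
proof -
  let ?P = "product_topology (\<lambda>_ :: nat. discrete_topology (UNIV :: int set)) UNIV"
  have cyl: "openin ?P {x. x i = a}" for i a
  proof -
    have "openin ?P {x \<in> topspace ?P. x i \<in> {a}}"
      by (rule openin_continuous_map_preimage[OF continuous_map_product_projection]) auto
    then show ?thesis
      by simp
  qed
  have "openin ?P (\<Union>(a, b)\<in>{(a, b). \<not> Q a b}. {x. x i = a} \<inter> {x. x j = b})"
    using cyl by (intro openin_Union) auto
  also have "(\<Union>(a, b)\<in>{(a, b). \<not> Q a b}. {x. x i = a} \<inter> {x. x j = b}) = - {x. Q (x i) (x j)}"
    by auto
  finally show ?thesis
    by (simp add: closedin_def Compl_eq_Diff_UNIV)
qed

text \<open>The units form a closed subset of a product of finite sets: coherence and being prime to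
  p are conditions on at most two coordinates each.\<close>

lemma compactin_Units:
  "compactin (product_topology (\<lambda>_. discrete_topology UNIV) UNIV) (Units (Zp p))"
proof (rule closed_compactin)
  let ?P = "product_topology (\<lambda>_ :: nat. discrete_topology (UNIV :: int set)) UNIV"
  show "compactin ?P (PiE UNIV (\<lambda>n. {0..<int p ^ n}))"
    by (simp add: compactin_PiE compactin_discrete_topology)
  show "Units (Zp p) \<subseteq> PiE UNIV (\<lambda>n. {0..<int p ^ n})"
    using Units_subset_carrier by (auto simp: in_carrier_Zp_iff)
  have "Units (Zp p) = (\<Inter>n. {x. 0 \<le> x n \<and> x n < int p ^ n \<and> x (Suc n) mod int p ^ n = x n}) \<inter>
      {x. \<not> int p dvd x 1}"
    by (auto simp: Units_Zp_iff[OF prime] in_carrier_Zp_iff)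
  moreover have "closedin ?P (\<Inter>n. {x. 0 \<le> x n \<and> x n < int p ^ n \<and> x (Suc n) mod int p ^ n = x n})"
    using closedin_coordinates[of "\<lambda>a b. 0 \<le> a \<and> a < int p ^ n \<and> b mod int p ^ n = a" n "Suc n" for n]
    by (intro closedin_Inter) auto
  moreover have "closedin ?P {x. \<not> int p dvd x 1}"
    using closedin_coordinates[of "\<lambda>a b. \<not> int p dvd a" 1 1] .
  ultimately show "closedin ?P (Units (Zp p))"
    by (simp add: closedin_Int)
qed

text \<open>Continuity at x yields a level s x valid near x. Finitely many of the corresponding
  cylinders cover the compact set of units, and the sum of their levels bounds each of them.\<close>

lemma level_uniform_if_continuous:
  assumes "continuous_map (subtopology (Zp_topology p) (Units (Zp p))) (Zp_topology p) f"
  shows "level_uniform p f"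
  unfolding level_uniform_def
proof
  fix N
  let ?P = "product_topology (\<lambda>_ :: nat. discrete_topology (UNIV :: int set)) UNIV"
  let ?U = "Units (Zp p)"
  have X: "subtopology (Zp_topology p) ?U = subtopology ?P ?U"
    using Units_subset_carrier by (simp add: Zp_topology_def subtopology_subtopology Int_absorb1)
  have cylP: "openin ?P {x. x i = a}" for i a
    using closedin_coordinates[of "\<lambda>b c. b \<noteq> a" i i] by (simp add: closedin_def Diff_eq flip: Collect_neg_eq)
  have cyl: "openin (Zp_topology p) {x \<in> carrier (Zp p). x i = a}" for i a
    using cylP[of i a] by (auto simp: Zp_topology_def openin_subtopology)
  have "\<exists>s. \<forall>y\<in>?U. y s = x s \<longrightarrow> f y N = f x N" if x: "x \<in> ?U" for x
  proof -
    have fx: "f x \<in> carrier (Zp p)"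
      using assms x by (auto simp: continuous_map_def topspace_Zp_topology topspace_units[unfolded X] X)
    have "openin (subtopology ?P ?U)
        {y \<in> topspace (subtopology ?P ?U). f y \<in> {z \<in> carrier (Zp p). z N = f x N}}"
      using assms cyl unfolding X by (rule openin_continuous_map_preimage)
    then obtain V where V: "openin ?P V"
      "{y \<in> ?U. f y \<in> carrier (Zp p) \<and> f y N = f x N} = V \<inter> ?U"
      unfolding openin_subtopology by auto
    have "x \<in> V"
      using V(2) x fx by blast
    then obtain W where W: "finite {i. W i \<noteq> UNIV}" "x \<in> PiE UNIV W" "PiE UNIV W \<subseteq> V"
      using V(1) unfolding openin_product_topology_alt by auto
    obtain s where s: "\<And>i. W i \<noteq> UNIV \<Longrightarrow> i \<le> s"
      using W(1) unfolding finite_nat_set_iff_bounded_le by auto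
    have "f y N = f x N" if y: "y \<in> ?U" "y s = x s" for y
    proof -
      have "y i \<in> W i" for i
      proof (cases "i \<le> s")
        case True
        then have "y i = x i"
          using Units_eq_level[of y x s i] x y by simp
        then show ?thesis
          using W(2) by auto
      next
        case False
        then show ?thesis
          using s by blast
      qed
      then have "y \<in> V"
        using W(3) by auto
      then show ?thesis
        using V(2) y(1) by auto
    qed
    then show ?thesis
      by blast
  qed
  then obtain s where s: "\<And>x y. x \<in> ?U \<Longrightarrow> y \<in> ?U \<Longrightarrow> y (s x) = x (s x) \<Longrightarrow> f y N = f x N"
    by metis
  define C where "C x = {y :: nat \<Rightarrow> int. y (s x) = x (s x)}" for x
  have "openin ?P V" if "V \<in> C ` ?U" for V
    using that cylP unfolding C_def by blast
  moreover have "?U \<subseteq> \<Union>(C ` ?U)"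
    unfolding C_def by blast
  ultimately obtain \<F> where \<F>: "finite \<F>" "\<F> \<subseteq> C ` ?U" "?U \<subseteq> \<Union>\<F>"
    using compactinD[OF compactin_Units, of "C ` ?U"] by blast
  obtain F where "F \<subseteq> ?U" "finite F" "\<F> = C ` F"
    using finite_subset_image[OF \<F>(1,2)] by blast
  then have F: "finite F" "F \<subseteq> ?U" "?U \<subseteq> (\<Union>x\<in>F. {y. y (s x) = x (s x)})"
    using \<F>(3) unfolding C_def by simp_all
  define S where "S = (\<Sum>x\<in>F. s x)"
  have "f x N = f y N" if x: "x \<in> ?U" and y: "y \<in> ?U" and xy: "x S = y S" for x y
  proof -
    obtain z where z: "z \<in> F" "x (s z) = z (s z)"
      using F(3) x by blast
    have "s z \<le> S"
      unfolding S_def using F(1) z(1) by (intro member_le_sum) auto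
    then have "y (s z) = x (s z)"
      using Units_eq_level[of x y S "s z"] x y xy by simp
    then show ?thesis
      using s[of z x] s[of z y] z x y F(2) by auto
  qed
  then show "\<exists>s. \<forall>x\<in>?U. \<forall>y\<in>?U. x s = y s \<longrightarrow> f x N = f y N"
    by blast
qed

lemma continuous_if_level_uniform:
  assumes "\<And>x. x \<in> Units (Zp p) \<Longrightarrow> f x \<in> carrier (Zp p)" "level_uniform p f"
  shows "continuous_map (subtopology (Zp_topology p) (Units (Zp p))) (Zp_topology p) f"
proof -
  let ?X = "subtopology (Zp_topology p) (Units (Zp p))"
  have "continuous_map ?X (discrete_topology UNIV) (\<lambda>x. f x N)" for N
  proof -
    obtain s where s: "\<And>x y. x \<in> Units (Zp p) \<Longrightarrow> y \<in> Units (Zp p) \<Longrightarrow> x s = y s \<Longrightarrow> f x N = f y N"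
      using assms(2) unfolding level_uniform_def by blast
    \<comment> \<open>Coordinate N of f factors through coordinate s of the argument; any map g
      between discrete spaces is continuous, so an arbitrary unit with the given coordinate may be
      picked.\<close>
    define g where "g a = f (SOME x. x \<in> Units (Zp p) \<and> x s = a) N" for a
    have "continuous_map ?X (discrete_topology UNIV) (\<lambda>x. x s)"
      unfolding Zp_topology_def
      by (intro continuous_map_from_subtopology continuous_map_product_projection) simp
    then have "continuous_map ?X (discrete_topology UNIV) (g \<circ> (\<lambda>x. x s))"
      by (rule continuous_map_compose) simp
    then show ?thesis
    proof (rule continuous_map_eq)
      fix x assume "x \<in> topspace ?X"
      then have x: "x \<in> Units (Zp p)"
        unfolding topspace_units .
      have "(SOME y. y \<in> Units (Zp p) \<and> y s = x s) \<in> Units (Zp p) \<and> (SOME y. y \<in> Units (Zp p) \<and> y s = x s) s = x s"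
        using x by (intro someI[of "\<lambda>y. y \<in> Units (Zp p) \<and> y s = x s" x]) simp
      then show "(g \<circ> (\<lambda>x. x s)) x = f x N"
        unfolding g_def o_apply using s x by blast
    qed
  qed
  then have "continuous_map ?X (product_topology (\<lambda>_. discrete_topology UNIV) UNIV) f"
    by (simp add: continuous_map_componentwise_UNIV)
  then show ?thesis
    using assms(1) topspace_units
    unfolding Zp_topology_def[of p] continuous_map_in_subtopology by (auto simp flip: Zp_topology_def)
qed

lemma topspace_eq_pm_class: "topspace (Zp_units_mod_pm_topology p) = pm_class p ` Units (Zp p)"
  unfolding topspace_Zp_units_mod_pm_topology Zp_units_mod_pm_def FactGroup_def RCOSETS_def
    partial_object.simps units_of_carrier pm_class_def
  by (simp only: UNION_singleton_eq_range)

text \<open>The quotient map reduces continuity on the quotient to that of the pull-back to the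
  units, where it is uniform by compactness.\<close>

lemma cont_funs_iff:
  "f \<in> cont_funs p (Zp_units_mod_pm_topology p) \<longleftrightarrow>
     f \<in> extensional (pm_class p ` Units (Zp p)) \<and>
     (\<forall>x\<in>Units (Zp p). f (pm_class p x) \<in> carrier (Zp p)) \<and> level_uniform p (f \<circ> pm_class p)"
proof -
  let ?X = "subtopology (Zp_topology p) (Units (Zp p))"
  have "continuous_map (Zp_units_mod_pm_topology p) (Zp_topology p) f \<longleftrightarrow>
      continuous_map ?X (Zp_topology p) (f \<circ> pm_class p)"
    unfolding Zp_units_mod_pm_topology_def pm_class_def[abs_def]
    by (rule continuous_compose_quotient_map_eq[OF quotient_map_quotient_topology, symmetric])
  also have "\<dots> \<longleftrightarrow> (\<forall>x\<in>Units (Zp p). f (pm_class p x) \<in> carrier (Zp p)) \<and> level_uniform p (f \<circ> pm_class p)"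
  proof
    assume c: "continuous_map ?X (Zp_topology p) (f \<circ> pm_class p)"
    then show "(\<forall>x\<in>Units (Zp p). f (pm_class p x) \<in> carrier (Zp p)) \<and> level_uniform p (f \<circ> pm_class p)"
      using level_uniform_if_continuous[OF c] topspace_units topspace_Zp_topology
      unfolding continuous_map_def by auto
  next
    assume "(\<forall>x\<in>Units (Zp p). f (pm_class p x) \<in> carrier (Zp p)) \<and> level_uniform p (f \<circ> pm_class p)"
    then show "continuous_map ?X (Zp_topology p) (f \<circ> pm_class p)"
      by (intro continuous_if_level_uniform) auto
  qed
  finally show ?thesis
    unfolding cont_funs_def topspace_eq_pm_class by auto
qed

lemma descend_pm_class:
  assumes "x \<in> Units (Zp p)" "\<And>x. x \<in> Units (Zp p) \<Longrightarrow> f (\<ominus>\<^bsub>Zp p\<^esub> x) = f x"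
  shows "descend p f (pm_class p x) = f x"
  unfolding pm_class_def by (rule descend_even[where f = f, OF prime_gt_0_nat[OF prime] assms])

lemma descend_in_cont_funs:
  assumes "\<And>x. x \<in> Units (Zp p) \<Longrightarrow> f (\<ominus>\<^bsub>Zp p\<^esub> x) = f x"
    "\<And>x. x \<in> Units (Zp p) \<Longrightarrow> f x \<in> carrier (Zp p)" "level_uniform p f"
  shows "descend p f \<in> cont_funs p (Zp_units_mod_pm_topology p)"
  unfolding cont_funs_iff
proof (intro conjI ballI)
  show "descend p f \<in> extensional (pm_class p ` Units (Zp p))"
    unfolding topspace_eq_pm_class[symmetric] topspace_Zp_units_mod_pm_topology descend_def
    by (rule restrict_extensional)
  have d: "descend p f (pm_class p x) = f x" if "x \<in> Units (Zp p)" for x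
    using that assms(1) by (rule descend_pm_class)
  show "descend p f (pm_class p x) \<in> carrier (Zp p)" if "x \<in> Units (Zp p)" for x
    using assms(2) that by (simp add: d)
  show "level_uniform p (descend p f \<circ> pm_class p)"
    using assms(3) unfolding level_uniform_def by (simp add: d)
qed

lemma descend_power_pm_class:
  assumes "x \<in> Units (Zp p)"
  shows "descend p (\<lambda>x. x [^]\<^bsub>Zp p\<^esub> (2 * k)) (pm_class p x) N = x N ^ (2 * k) mod int p ^ N"
proof -
  have "(\<ominus>\<^bsub>Zp p\<^esub> x) [^]\<^bsub>Zp p\<^esub> (2 * k) = x [^]\<^bsub>Zp p\<^esub> (2 * k)" if "x \<in> Units (Zp p)" for x
  proof
    fix n
    have x: "x \<in> carrier (Zp p)" "\<ominus>\<^bsub>Zp p\<^esub> x \<in> carrier (Zp p)"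
      using Z.Units_closed[OF that] Z.a_inv_closed by blast+
    show "((\<ominus>\<^bsub>Zp p\<^esub> x) [^]\<^bsub>Zp p\<^esub> (2 * k)) n = (x [^]\<^bsub>Zp p\<^esub> (2 * k)) n"
      unfolding Zp_nat_pow_apply[OF prime_gt_0_nat[OF prime] x(1)] Zp_nat_pow_apply[OF prime_gt_0_nat[OF prime] x(2)]
        Zp_uminus_apply[OF prime x(1)] power_mod by simp
  qed
  then have "descend p (\<lambda>x. x [^]\<^bsub>Zp p\<^esub> (2 * k)) (pm_class p x) = x [^]\<^bsub>Zp p\<^esub> (2 * k)"
    by (rule descend_pm_class[OF assms])
  then show ?thesis
    using Zp_nat_pow_apply[OF prime_gt_0_nat[OF prime] Z.Units_closed[OF assms]] by (simp only:)
qed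

end

section \<open>Moments of measures\<close>

abbreviation "quotient_funs p \<equiv> cont_funs p (Zp_units_mod_pm_topology p)"
abbreviation "quotient_space p \<equiv> topspace (Zp_units_mod_pm_topology p)"

lemma poly_num_poly: "poly (num_poly p j) (of_int x) = of_int (unit_prod p j x)"
  by (cases "j = 0") (simp_all add: num_poly_0 num_poly_pos unit_prod_def poly_prod)

text \<open>Multiplying \<open>basis_fun\<close> by p^\<open>basis_val\<close> and E_(2n) by C_p
  gives the same monic integral polynomial, so the identity defining the coefficients c can be
  evaluated at x with the power of p in place of C_p.\<close>

lemma twisted_basis_expansion:
  assumes "prime p" "\<not> int p dvd x"
  shows "int p ^ basis_val p (2 * n) * twisted_basis p m (2 * n) x =
    x ^ (2 * (n + m)) - (\<Sum>i=m..<n + m. c_coeffs p n (2 * (i - m)) * x ^ (2 * i))"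
proof -
  have "poly (Polynomial.smult (of_nat (C_const p n)) (E_poly p (2 * n)) * [:0, 1:] ^ (2 * m)) (of_int x) =
      poly ([:0, 1:] ^ (2 * (n + m)) -
        (\<Sum>i=m..<n + m. Polynomial.smult (of_int (c_coeffs p n (2 * (i - m)))) ([:0, 1:] ^ (2 * i)))) (rat_of_int x)"
    using is_c_coeffs_c_coeffs[OF assms(1), of n] unfolding is_c_coeffs_def by simp
  then have "rat_of_int ((\<Prod>j | phi_digits p (2 * n) j \<noteq> 0. unit_prod p j x ^ phi_digits p (2 * n) j) * x ^ (2 * m)) =
      rat_of_int (x ^ (2 * (n + m)) - (\<Sum>i=m..<n + m. c_coeffs p n (2 * (i - m)) * x ^ (2 * i)))"
    unfolding smult_C_const_E_poly by (simp add: poly_prod poly_power poly_sum poly_num_poly)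
  then show ?thesis
    unfolding of_int_eq_iff basis_fun_eq[OF assms, symmetric] twisted_basis_def by (simp add: ac_simps)
qed

lemma basis_val_eq_multiplicity:
  assumes "prime p"
  shows "basis_val p (2 * n) = multiplicity (int p) (int (C_const p n))"
proof -
  have pe: "prime_elem (int p)"
    using assms by simp
  have "multiplicity (int p) (int (C_const p n)) =
      multiplicity (int p) (\<Prod>i | phi_digits p (2 * n) i \<noteq> 0. fact (p ^ i) ^ phi_digits p (2 * n) i)"
    by (simp add: C_const_def)
  also have "\<dots> = (\<Sum>i | phi_digits p (2 * n) i \<noteq> 0. multiplicity (int p) (fact (p ^ i) ^ phi_digits p (2 * n) i))"
    using finite_phi_digits[OF assms] by (intro prime_elem_multiplicity_prod_distrib[OF pe]) auto
  also have "\<dots> = basis_val p (2 * n)"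
    unfolding basis_val_def fact_val_def by (simp add: prime_elem_multiplicity_power_distrib[OF pe])
  finally show ?thesis ..
qed

lemma Meas_cases:
  assumes "\<mu> \<in> Meas p X"
  shows "f \<in> cont_funs p X \<Longrightarrow> \<mu> f \<in> carrier (Zp p)"
    and "f \<in> cont_funs p X \<Longrightarrow> g \<in> cont_funs p X \<Longrightarrow>
      \<mu> (\<lambda>x\<in>topspace X. f x \<oplus>\<^bsub>Zp p\<^esub> g x) = \<mu> f \<oplus>\<^bsub>Zp p\<^esub> \<mu> g"
    and "c \<in> carrier (Zp p) \<Longrightarrow> f \<in> cont_funs p X \<Longrightarrow>
      \<mu> (\<lambda>x\<in>topspace X. c \<otimes>\<^bsub>Zp p\<^esub> f x) = c \<otimes>\<^bsub>Zp p\<^esub> \<mu> f"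
  using assms unfolding Meas_def by auto

text \<open>The level is shifted by one more than the valuation so that the argument of the integer-valued
  function is prime to p also for N = 0.\<close>

definition basis_lift :: "nat \<Rightarrow> nat \<Rightarrow> nat \<Rightarrow> (nat \<Rightarrow> int) \<Rightarrow> nat \<Rightarrow> int" where
  "basis_lift p m n x N = twisted_basis p m (2 * n) (x (Suc (N + basis_val p (2 * n)))) mod int p ^ N"

context
  fixes p :: nat
  assumes prime: "prime p"
begin

interpretation Z: cring "Zp p"
  by (rule cring_Zp[OF prime_gt_0_nat[OF prime]])

lemma pm_class_in_topspace: "x \<in> Units (Zp p) \<Longrightarrow> pm_class p x \<in> quotient_space p"
  by (simp add: topspace_eq_pm_class[OF prime])

lemma cont_funs_eqI:
  assumes "f \<in> quotient_funs p" "g \<in> quotient_funs p" "\<And>x N. x \<in> Units (Zp p) \<Longrightarrow> f (pm_class p x) N = g (pm_class p x) N"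
  shows "f = g"
proof (rule extensionalityI)
  show "f \<in> extensional (pm_class p ` Units (Zp p))" "g \<in> extensional (pm_class p ` Units (Zp p))"
    using assms(1,2) unfolding cont_funs_iff[OF prime] by auto
  show "f A = g A" if "A \<in> pm_class p ` Units (Zp p)" for A
    using that assms(3) by auto
qed

lemma cont_funs_carrier: "f \<in> quotient_funs p \<Longrightarrow> x \<in> Units (Zp p) \<Longrightarrow> f (pm_class p x) \<in> carrier (Zp p)"
  unfolding cont_funs_iff[OF prime] by auto

lemma cont_funs_level:
  assumes "f \<in> quotient_funs p"
  shows "\<exists>s. \<forall>x\<in>Units (Zp p). \<forall>y\<in>Units (Zp p). x s = y s \<longrightarrow> f (pm_class p x) N = f (pm_class p y) N"
proof -
  have "level_uniform p (f \<circ> pm_class p)"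
    using assms unfolding cont_funs_iff[OF prime] by (elim conjE)
  then show ?thesis
    unfolding level_uniform_def o_apply by (rule spec)
qed

lemma cont_funs_add:
  assumes "f \<in> quotient_funs p" "g \<in> quotient_funs p"
  shows "(\<lambda>A\<in>quotient_space p. f A \<oplus>\<^bsub>Zp p\<^esub> g A) \<in> quotient_funs p"
  unfolding cont_funs_iff[OF prime]
proof (intro conjI ballI)
  show "(\<lambda>A\<in>quotient_space p. f A \<oplus>\<^bsub>Zp p\<^esub> g A) \<in> extensional (pm_class p ` Units (Zp p))"
    by (simp add: topspace_eq_pm_class[OF prime])
  show "(\<lambda>A\<in>quotient_space p. f A \<oplus>\<^bsub>Zp p\<^esub> g A) (pm_class p x) \<in> carrier (Zp p)" if "x \<in> Units (Zp p)" for x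
    using Z.add.m_closed cont_funs_carrier assms that by (simp add: pm_class_in_topspace)
  show "level_uniform p ((\<lambda>A\<in>quotient_space p. f A \<oplus>\<^bsub>Zp p\<^esub> g A) \<circ> pm_class p)"
    unfolding level_uniform_def
  proof
    fix N
    obtain s where s: "\<And>x y. x \<in> Units (Zp p) \<Longrightarrow> y \<in> Units (Zp p) \<Longrightarrow> x s = y s \<Longrightarrow>
        f (pm_class p x) N = f (pm_class p y) N"
      using cont_funs_level[OF assms(1), of N] by blast
    obtain r where r: "\<And>x y. x \<in> Units (Zp p) \<Longrightarrow> y \<in> Units (Zp p) \<Longrightarrow> x r = y r \<Longrightarrow>
        g (pm_class p x) N = g (pm_class p y) N"
      using cont_funs_level[OF assms(2), of N] by blast
    have level: "x i = y i" if "x \<in> Units (Zp p)" "y \<in> Units (Zp p)" "x (s + r) = y (s + r)" "i \<le> s + r" for x y i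
      using Units_eq_level[OF prime that] .
    show "\<exists>s. \<forall>x\<in>Units (Zp p). \<forall>y\<in>Units (Zp p). x s = y s \<longrightarrow>
        ((\<lambda>A\<in>quotient_space p. f A \<oplus>\<^bsub>Zp p\<^esub> g A) \<circ> pm_class p) x N = ((\<lambda>A\<in>quotient_space p. f A \<oplus>\<^bsub>Zp p\<^esub> g A) \<circ> pm_class p) y N"
    proof (intro exI ballI impI)
      fix x y assume xy: "x \<in> Units (Zp p)" "y \<in> Units (Zp p)" "x (s + r) = y (s + r)"
      show "((\<lambda>A\<in>quotient_space p. f A \<oplus>\<^bsub>Zp p\<^esub> g A) \<circ> pm_class p) x N = ((\<lambda>A\<in>quotient_space p. f A \<oplus>\<^bsub>Zp p\<^esub> g A) \<circ> pm_class p) y N"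
        using s[OF xy(1,2) level[OF xy]] r[OF xy(1,2) level[OF xy]] xy
        by (simp add: pm_class_in_topspace Zp_simps)
    qed
  qed
qed

lemma cont_funs_scale:
  assumes "f \<in> quotient_funs p" "c \<in> carrier (Zp p)"
  shows "(\<lambda>A\<in>quotient_space p. c \<otimes>\<^bsub>Zp p\<^esub> f A) \<in> quotient_funs p"
  unfolding cont_funs_iff[OF prime]
proof (intro conjI ballI)
  show "(\<lambda>A\<in>quotient_space p. c \<otimes>\<^bsub>Zp p\<^esub> f A) \<in> extensional (pm_class p ` Units (Zp p))"
    by (simp add: topspace_eq_pm_class[OF prime])
  show "(\<lambda>A\<in>quotient_space p. c \<otimes>\<^bsub>Zp p\<^esub> f A) (pm_class p x) \<in> carrier (Zp p)" if "x \<in> Units (Zp p)" for x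
    using Z.m_closed cont_funs_carrier assms that by (simp add: pm_class_in_topspace)
  show "level_uniform p ((\<lambda>A\<in>quotient_space p. c \<otimes>\<^bsub>Zp p\<^esub> f A) \<circ> pm_class p)"
    unfolding level_uniform_def
  proof
    fix N
    obtain s where s: "\<And>x y. x \<in> Units (Zp p) \<Longrightarrow> y \<in> Units (Zp p) \<Longrightarrow> x s = y s \<Longrightarrow>
        f (pm_class p x) N = f (pm_class p y) N"
      using cont_funs_level[OF assms(1), of N] by blast
    show "\<exists>s. \<forall>x\<in>Units (Zp p). \<forall>y\<in>Units (Zp p). x s = y s \<longrightarrow>
        ((\<lambda>A\<in>quotient_space p. c \<otimes>\<^bsub>Zp p\<^esub> f A) \<circ> pm_class p) x N = ((\<lambda>A\<in>quotient_space p. c \<otimes>\<^bsub>Zp p\<^esub> f A) \<circ> pm_class p) y N"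
    proof (intro exI ballI impI)
      fix x y assume xy: "x \<in> Units (Zp p)" "y \<in> Units (Zp p)" "x s = y s"
      show "((\<lambda>A\<in>quotient_space p. c \<otimes>\<^bsub>Zp p\<^esub> f A) \<circ> pm_class p) x N = ((\<lambda>A\<in>quotient_space p. c \<otimes>\<^bsub>Zp p\<^esub> f A) \<circ> pm_class p) y N"
        using s[OF xy] xy(1,2) by (simp add: pm_class_in_topspace Zp_simps)
    qed
  qed
qed

text \<open>The congruences for all N say that g is the combination of the f i, with integer
  coefficients acting as p-adic ones. The induction removes one summand at a time, since
  \<open>Meas\<close> offers binary sums and multiples; in the empty case g is 0 times
  itself.\<close>

lemma Meas_linear_combination:
  assumes \<mu>: "\<mu> \<in> Meas p (Zp_units_mod_pm_topology p)"
    and "finite I" "\<And>i. i \<in> I \<Longrightarrow> f i \<in> quotient_funs p" "g \<in> quotient_funs p"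
    and "\<And>x N. x \<in> Units (Zp p) \<Longrightarrow>
      [g (pm_class p x) N = (\<Sum>i\<in>I. c i * f i (pm_class p x) N)] (mod int p ^ N)"
  shows "[\<mu> g N = (\<Sum>i\<in>I. c i * \<mu> (f i) N)] (mod int p ^ N)"
  using assms(2-)
proof (induction I arbitrary: g N)
  case empty
  have zero: "\<zero>\<^bsub>Zp p\<^esub> \<in> carrier (Zp p)"
    by (rule Z.zero_closed)
  have "g = (\<lambda>A\<in>quotient_space p. \<zero>\<^bsub>Zp p\<^esub> \<otimes>\<^bsub>Zp p\<^esub> g A)"
  proof (rule cont_funs_eqI[OF empty(2) cont_funs_scale[OF empty(2) zero]])
    fix x N assume x: "x \<in> Units (Zp p)"
    have "g (pm_class p x) N mod int p ^ N = 0"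
      using empty(3)[OF x, of N] by (simp add: cong_def)
    then show "g (pm_class p x) N = (\<lambda>A\<in>quotient_space p. \<zero>\<^bsub>Zp p\<^esub> \<otimes>\<^bsub>Zp p\<^esub> g A) (pm_class p x) N"
      using Zp_mod_self[OF cont_funs_carrier[OF empty(2) x], of N] x by (simp add: pm_class_in_topspace Zp_simps)
  qed
  then have "\<mu> g = \<zero>\<^bsub>Zp p\<^esub> \<otimes>\<^bsub>Zp p\<^esub> \<mu> g"
    using Meas_cases(3)[OF \<mu> zero empty(2)] by (rule trans[OF arg_cong[of _ _ \<mu>]])
  then have "\<mu> g N = (\<zero>\<^bsub>Zp p\<^esub> \<otimes>\<^bsub>Zp p\<^esub> \<mu> g) N"
    by (rule fun_cong)
  then show ?case
    by (simp add: Zp_simps)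
next
  case (insert a I)
  have ca: "Zp_of_int p z \<in> carrier (Zp p)" for z
    by (rule Zp_of_int_carrier[OF prime])
  define h where "h = (\<lambda>A\<in>quotient_space p. Zp_of_int p (c a) \<otimes>\<^bsub>Zp p\<^esub> f a A)"
  \<comment> \<open>Subtraction is expressed as multiplication by -1 followed by addition.\<close>
  define h' where "h' = (\<lambda>A\<in>quotient_space p. Zp_of_int p (- 1) \<otimes>\<^bsub>Zp p\<^esub> h A)"
  define g' where "g' = (\<lambda>A\<in>quotient_space p. g A \<oplus>\<^bsub>Zp p\<^esub> h' A)"
  have fa: "f a \<in> quotient_funs p"
    using insert.prems(1) by simp
  have h: "h \<in> quotient_funs p"
    unfolding h_def by (rule cont_funs_scale[OF fa ca])
  have h': "h' \<in> quotient_funs p"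
    unfolding h'_def by (rule cont_funs_scale[OF h ca])
  have g': "g' \<in> quotient_funs p"
    unfolding g'_def by (rule cont_funs_add[OF insert.prems(2) h'])
  have "\<mu> h = Zp_of_int p (c a) \<otimes>\<^bsub>Zp p\<^esub> \<mu> (f a)"
    unfolding h_def by (rule Meas_cases(3)[OF \<mu> ca fa])
  moreover have "\<mu> h' = Zp_of_int p (- 1) \<otimes>\<^bsub>Zp p\<^esub> \<mu> h"
    unfolding h'_def by (rule Meas_cases(3)[OF \<mu> ca h])
  moreover have "\<mu> g' = \<mu> g \<oplus>\<^bsub>Zp p\<^esub> \<mu> h'"
    unfolding g'_def by (rule Meas_cases(2)[OF \<mu> insert.prems(2) h'])
  ultimately have \<mu>g': "[\<mu> g' N = \<mu> g N - c a * \<mu> (f a) N] (mod int p ^ N)"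
    by (simp add: Zp_simps Zp_of_int_def cong_def mod_simps)
  have "[\<mu> g' N = (\<Sum>i\<in>I. c i * \<mu> (f i) N)] (mod int p ^ N)"
  proof (rule insert.IH[OF _ g'])
    show "f i \<in> quotient_funs p" if "i \<in> I" for i
      using insert.prems(1) that by simp
    fix x N assume x: "x \<in> Units (Zp p)"
    have "[g' (pm_class p x) N = g (pm_class p x) N - c a * f a (pm_class p x) N] (mod int p ^ N)"
      using x by (simp add: g'_def h'_def h_def pm_class_in_topspace Zp_simps Zp_of_int_def cong_def mod_simps)
    also have "[g (pm_class p x) N - c a * f a (pm_class p x) N =
        (\<Sum>i\<in>insert a I. c i * f i (pm_class p x) N) - c a * f a (pm_class p x) N] (mod int p ^ N)"
      by (intro cong_diff insert.prems(3) x cong_refl)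
    finally show "[g' (pm_class p x) N = (\<Sum>i\<in>I. c i * f i (pm_class p x) N)] (mod int p ^ N)"
      using insert.hyps by simp
  qed
  then have "[\<mu> g N - c a * \<mu> (f a) N = (\<Sum>i\<in>I. c i * \<mu> (f i) N)] (mod int p ^ N)"
    using \<mu>g' cong_sym cong_trans by blast
  then have "[\<mu> g N - c a * \<mu> (f a) N + c a * \<mu> (f a) N = (\<Sum>i\<in>I. c i * \<mu> (f i) N) + c a * \<mu> (f a) N] (mod int p ^ N)"
    by (intro cong_add cong_refl)
  then show ?case
    using insert.hyps by (simp add: add.commute)
qed

text \<open>Only even powers of x occur in \<open>twisted_basis_expansion\<close>, and
  p^\<open>basis_val\<close> can be cancelled. This lets the even-indexed basis functions descend to
  the quotient.\<close>

lemma twisted_basis_uminus: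
  assumes "\<not> int p dvd x"
  shows "twisted_basis p m (2 * n) (- x) = twisted_basis p m (2 * n) x"
proof -
  have assms': "\<not> int p dvd - x"
    using assms by simp
  have "int p ^ basis_val p (2 * n) * twisted_basis p m (2 * n) (- x) =
      int p ^ basis_val p (2 * n) * twisted_basis p m (2 * n) x"
    unfolding twisted_basis_expansion[OF prime assms] twisted_basis_expansion[OF prime assms']
    by (simp add: uminus_power_if)
  then show ?thesis
    using prime_gt_0_nat[OF prime] by simp
qed

lemma basis_lift_cong:
  assumes "x \<in> Units (Zp p)" "\<not> int p dvd y" "[y = x (Suc (N + basis_val p (2 * n)))] (mod int p ^ (N + basis_val p (2 * n)))"
  shows "basis_lift p m n x N = twisted_basis p m (2 * n) y mod int p ^ N"
proof -
  have "\<not> int p dvd x (Suc (N + basis_val p (2 * n)))"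
    using assms(1) Zp_unit_level[OF prime, of x] by (simp add: Units_Zp_iff[OF prime])
  then have "[twisted_basis p m (2 * n) y = twisted_basis p m (2 * n) (x (Suc (N + basis_val p (2 * n))))] (mod int p ^ N)"
    by (rule twisted_basis_cong[OF prime assms(2) _ assms(3)])
  then show ?thesis
    unfolding basis_lift_def by (simp add: cong_def)
qed

lemma basis_lift_carrier:
  assumes "x \<in> Units (Zp p)"
  shows "basis_lift p m n x \<in> carrier (Zp p)"
  unfolding basis_lift_def[abs_def]
proof (rule in_carrier_ZpI[OF prime])
  fix N
  have x: "x \<in> carrier (Zp p)" "\<not> int p dvd x 1"
    using assms by (simp_all add: Units_Zp_iff[OF prime])
  show "[twisted_basis p m (2 * n) (x (Suc (Suc N + basis_val p (2 * n)))) =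
      twisted_basis p m (2 * n) (x (Suc (N + basis_val p (2 * n))))] (mod int p ^ N)"
  proof (rule twisted_basis_cong[OF prime])
    show "[x (Suc (Suc N + basis_val p (2 * n))) = x (Suc (N + basis_val p (2 * n)))] (mod int p ^ (N + basis_val p (2 * n)))"
      by (rule cong_dvd_modulus[OF Zp_cong_level[OF x(1)]]) (simp_all add: le_imp_power_dvd)
  qed (use x Zp_unit_level[OF prime] in auto)
qed

lemma basis_lift_uminus:
  assumes "x \<in> Units (Zp p)"
  shows "basis_lift p m n (\<ominus>\<^bsub>Zp p\<^esub> x) = basis_lift p m n x"
proof
  fix N
  define M where "M = Suc (N + basis_val p (2 * n))"
  have x: "x \<in> carrier (Zp p)" "\<not> int p dvd x 1"
    using assms by (simp_all add: Units_Zp_iff[OF prime])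
  have xM: "\<not> int p dvd x M"
    using Zp_unit_level[OF prime x, of M] by (simp add: M_def)
  have "(\<ominus>\<^bsub>Zp p\<^esub> x) M = (- x M) mod int p ^ M"
    by (rule Zp_uminus_apply[OF prime x(1)])
  then have "[- x M = (\<ominus>\<^bsub>Zp p\<^esub> x) M] (mod int p ^ M)"
    by (simp add: cong_def)
  then have "[- x M = (\<ominus>\<^bsub>Zp p\<^esub> x) M] (mod int p ^ (N + basis_val p (2 * n)))"
    by (rule cong_dvd_modulus) (simp add: M_def le_imp_power_dvd)
  moreover have "\<ominus>\<^bsub>Zp p\<^esub> x \<in> Units (Zp p)"
    using x xM Z.a_inv_closed[OF x(1)] unfolding Units_Zp_iff[OF prime] Zp_uminus_apply[OF prime x(1)]
    by (simp add: dvd_mod_iff)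
  ultimately have "basis_lift p m n (\<ominus>\<^bsub>Zp p\<^esub> x) N = twisted_basis p m (2 * n) (- x M) mod int p ^ N"
    using xM by (intro basis_lift_cong) (auto simp: M_def)
  also have "\<dots> = basis_lift p m n x N"
    unfolding twisted_basis_uminus[OF xM] by (simp only: basis_lift_def M_def)
  finally show "basis_lift p m n (\<ominus>\<^bsub>Zp p\<^esub> x) N = basis_lift p m n x N" .
qed

lemma basis_lift_expansion:
  assumes "x \<in> Units (Zp p)"
  shows "[x N ^ (2 * (n + m)) = int p ^ basis_val p (2 * n) * basis_lift p m n x N +
    (\<Sum>i=m..<n + m. c_coeffs p n (2 * (i - m)) * x N ^ (2 * i))] (mod int p ^ N)"
proof -
  define M where "M = Suc (N + basis_val p (2 * n))"
  have x: "x \<in> carrier (Zp p)" "\<not> int p dvd x 1"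
    using assms by (simp_all add: Units_Zp_iff[OF prime])
  have xM: "\<not> int p dvd x M"
    using Zp_unit_level[OF prime x, of M] by (simp add: M_def)
  have c: "[x N = x M] (mod int p ^ N)"
    by (rule cong_sym[OF Zp_cong_level[OF x(1)]]) (simp add: M_def)
  have "[x N ^ (2 * (n + m)) = x M ^ (2 * (n + m))] (mod int p ^ N)"
    by (intro cong_pow c)
  also have "x M ^ (2 * (n + m)) = int p ^ basis_val p (2 * n) * twisted_basis p m (2 * n) (x M) +
      (\<Sum>i=m..<n + m. c_coeffs p n (2 * (i - m)) * x M ^ (2 * i))"
    using twisted_basis_expansion[OF prime xM, of n m] by simp
  also have "[\<dots> = int p ^ basis_val p (2 * n) * basis_lift p m n x N +
      (\<Sum>i=m..<n + m. c_coeffs p n (2 * (i - m)) * x N ^ (2 * i))] (mod int p ^ N)"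
    by (intro cong_add cong_mult cong_sum cong_pow cong_refl cong_sym[OF c])
      (simp add: basis_lift_def M_def cong_def)
  finally show ?thesis .
qed

text \<open>The integrated form of \<open>basis_lift_expansion\<close>. A moment differs from the
  c-combination of the lower ones by p^\<open>basis_val\<close> times the integral of a Z_p-valued
  function, which is the reason for (b).\<close>

lemma moment_congruence:
  assumes \<mu>: "\<mu> \<in> Meas p (Zp_units_mod_pm_topology p)"
  shows "[\<mu> (descend p (\<lambda>x. x [^]\<^bsub>Zp p\<^esub> (2 * (n + m)))) N =
    int p ^ basis_val p (2 * n) * \<mu> (descend p (basis_lift p m n)) N +
    (\<Sum>i=m..<n + m. c_coeffs p n (2 * (i - m)) * \<mu> (descend p (\<lambda>x. x [^]\<^bsub>Zp p\<^esub> (2 * i))) N)] (mod int p ^ N)"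
proof -
  define pw where "pw i = descend p (\<lambda>x. x [^]\<^bsub>Zp p\<^esub> (2 * i))" for i :: nat
  \<comment> \<open>The lower powers use the indices m, ..., n + m - 1; the free index n + m carries
    the basis function, so that one sum covers the whole expansion.\<close>
  define f where "f i = (if i = n + m then descend p (basis_lift p m n) else pw i)" for i
  define c where "c i = (if i = n + m then int p ^ basis_val p (2 * n) else c_coeffs p n (2 * (i - m)))" for i
  have pw: "pw i \<in> quotient_funs p" for i
    unfolding pw_def by (rule descend_even_power_in_cont_funs[OF prime_gt_0_nat[OF prime]])
  \<comment> \<open>Coordinate N of \<open>basis_lift\<close> reads a single coordinate of
    x.\<close>
  have "level_uniform p (basis_lift p m n)"
    unfolding level_uniform_def basis_lift_def by (metis (mono_tags, lifting))
  then have bl: "descend p (basis_lift p m n) \<in> quotient_funs p"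
    by (intro descend_in_cont_funs[OF prime] basis_lift_uminus basis_lift_carrier)
  have split: "(\<Sum>i\<in>insert (n + m) {m..<n + m}. c i * F i) = int p ^ basis_val p (2 * n) * F (n + m) +
      (\<Sum>i=m..<n + m. c_coeffs p n (2 * (i - m)) * F i)" for F
    by (simp add: c_def)
  have sum: "(\<Sum>i=m..<n + m. c_coeffs p n (2 * (i - m)) * G (f i)) = (\<Sum>i=m..<n + m. c_coeffs p n (2 * (i - m)) * G (pw i))" for G
    by (intro sum.cong) (auto simp: f_def)
  have "[\<mu> (pw (n + m)) N = (\<Sum>i\<in>insert (n + m) {m..<n + m}. c i * \<mu> (f i) N)] (mod int p ^ N)"
  proof (rule Meas_linear_combination[OF \<mu>])
    show "f i \<in> quotient_funs p" for i
      using pw bl by (simp add: f_def)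
    fix x N assume x: "x \<in> Units (Zp p)"
    have P: "[pw i (pm_class p x) N = x N ^ (2 * i)] (mod int p ^ N)" for i
      unfolding pw_def descend_power_pm_class[OF prime x] by (simp add: cong_def)
    have B: "descend p (basis_lift p m n) (pm_class p x) N = basis_lift p m n x N"
      using descend_pm_class[OF prime x, of "basis_lift p m n"] basis_lift_uminus by simp
    have "[pw (n + m) (pm_class p x) N = x N ^ (2 * (n + m))] (mod int p ^ N)"
      by (rule P)
    also note basis_lift_expansion[OF x]
    also have "[int p ^ basis_val p (2 * n) * basis_lift p m n x N + (\<Sum>i=m..<n + m. c_coeffs p n (2 * (i - m)) * x N ^ (2 * i)) =
        int p ^ basis_val p (2 * n) * basis_lift p m n x N +
        (\<Sum>i=m..<n + m. c_coeffs p n (2 * (i - m)) * pw i (pm_class p x) N)] (mod int p ^ N)"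
      by (intro cong_add cong_mult cong_sum cong_refl cong_sym[OF P])
    also have "int p ^ basis_val p (2 * n) * basis_lift p m n x N +
        (\<Sum>i=m..<n + m. c_coeffs p n (2 * (i - m)) * pw i (pm_class p x) N) =
        (\<Sum>i\<in>insert (n + m) {m..<n + m}. c i * f i (pm_class p x) N)"
      unfolding split sum[of "\<lambda>g. g (pm_class p x) N"] by (simp add: f_def B)
    finally show "[pw (n + m) (pm_class p x) N =
        (\<Sum>i\<in>insert (n + m) {m..<n + m}. c i * f i (pm_class p x) N)] (mod int p ^ N)" .
  qed (simp_all add: pw)
  then show ?thesis
    unfolding split sum[of "\<lambda>g. \<mu> g N"] by (simp add: f_def pw_def)
qed

end

section \<open>Construction of a measure with prescribed values on the basis\<close>

definition restrict_int :: "nat \<Rightarrow> ((nat \<Rightarrow> int) set \<Rightarrow> nat \<Rightarrow> int) \<Rightarrow> nat \<Rightarrow> int \<Rightarrow> int" where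
  "restrict_int p f N x = f (pm_class p (Zp_of_int p x)) N"

context
  fixes p :: nat
  assumes prime: "prime p"
begin

interpretation Z: cring "Zp p"
  by (rule cring_Zp[OF prime_gt_0_nat[OF prime]])

lemma unit_continuous_restrict_int:
  assumes "f \<in> quotient_funs p"
  shows "unit_continuous p (restrict_int p f N)"
proof -
  obtain s where s: "\<And>x y. x \<in> Units (Zp p) \<Longrightarrow> y \<in> Units (Zp p) \<Longrightarrow> x s = y s \<Longrightarrow>
      f (pm_class p x) N = f (pm_class p y) N"
    using cont_funs_level[OF prime assms, of N] by blast
  have "restrict_int p f N x = restrict_int p f N y"
    if "\<not> int p dvd x" "\<not> int p dvd y" "[x = y] (mod int p ^ s)" for x y
    unfolding restrict_int_def using that
    by (intro s Zp_of_int_Units[OF prime]) (simp_all add: Zp_of_int_def cong_def)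
  then show ?thesis
    unfolding unit_continuous_def by (metis cong_refl)
qed

text \<open>Coordinate N of \<mu> f is the value forced modulo p^N. Uniqueness of forced values
  yields both the coherence of these coordinates and the linearity of \<mu>.\<close>

lemma Meas_interpolation:
  assumes l: "\<And>n. l n \<in> carrier (Zp p)"
  obtains \<mu> where "\<mu> \<in> Meas p (Zp_units_mod_pm_topology p)"
    "\<And>f N. f \<in> quotient_funs p \<Longrightarrow> represents p m (\<lambda>n. l n N) N (restrict_int p f N) (\<mu> f N)"
proof -
  have "\<exists>t. represents p m (\<lambda>n. l n N) N (restrict_int p f N) t" if "f \<in> quotient_funs p" for f N
    by (rule represents_exists[OF prime unit_continuous_restrict_int[OF that]])
  then obtain v where v: "\<And>f N. f \<in> quotient_funs p \<Longrightarrow> represents p m (\<lambda>n. l n N) N (restrict_int p f N) (v f N)"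
    by metis
  define \<mu> where "\<mu> = (\<lambda>f\<in>quotient_funs p. \<lambda>N. v f N mod int p ^ N)"
  have \<mu>v: "[\<mu> f N = v f N] (mod int p ^ N)" if "f \<in> quotient_funs p" for f N
    using that by (simp add: \<mu>_def cong_def)
  have rep: "represents p m (\<lambda>n. l n N) N (restrict_int p f N) (\<mu> f N)" if "f \<in> quotient_funs p" for f N
    by (rule represents_cong[OF v[OF that] _ \<mu>v[OF that]]) simp
  have carrier: "\<mu> f \<in> carrier (Zp p)" if f: "f \<in> quotient_funs p" for f
  proof -
    have "[v f (Suc N) = v f N] (mod int p ^ N)" for N
    proof (rule represents_unique[OF prime])
      have "represents p m (\<lambda>n. l n N) N (restrict_int p f (Suc N)) (v f (Suc N))"
        by (rule represents_Suc[OF v[OF f]]) (simp add: Zp_cong_level[OF l])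
      then show "represents p m (\<lambda>n. l n N) N (restrict_int p f N) (v f (Suc N))"
      proof (rule represents_cong)
        fix x assume "\<not> int p dvd x"
        then have "f (pm_class p (Zp_of_int p x)) \<in> carrier (Zp p)"
          by (intro cont_funs_carrier[OF prime f] Zp_of_int_Units[OF prime])
        then show "[restrict_int p f N x = restrict_int p f (Suc N) x] (mod int p ^ N)"
          unfolding restrict_int_def by (intro cong_sym[OF Zp_cong_level]) simp_all
      qed simp
      show "represents p m (\<lambda>n. l n N) N (restrict_int p f N) (v f N)"
        by (rule v[OF f])
    qed
    then show ?thesis
      using f unfolding \<mu>_def by (simp add: in_carrier_ZpI[OF prime])
  qed
  \<comment> \<open>Each linearity law reduces to showing that its right-hand side is also a forced
    value at every level.\<close>
  have eqI: "\<mu> f = y" if f: "f \<in> quotient_funs p" and y: "y \<in> carrier (Zp p)"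
    and r: "\<And>N. represents p m (\<lambda>n. l n N) N (restrict_int p f N) (y N)" for f y
  proof
    fix N
    have "[\<mu> f N = y N] (mod int p ^ N)"
      by (rule represents_unique[OF prime rep[OF f] r])
    then show "\<mu> f N = y N"
      using Zp_mod_self[OF carrier[OF f], of N] Zp_mod_self[OF y, of N] by (simp add: cong_def)
  qed
  have "\<mu> \<in> Meas p (Zp_units_mod_pm_topology p)"
    unfolding Meas_def
  proof (intro CollectI conjI ballI)
    show "\<mu> \<in> quotient_funs p \<rightarrow>\<^sub>E carrier (Zp p)"
      using carrier by (auto simp: \<mu>_def)
    show "\<mu> (\<lambda>x\<in>quotient_space p. f x \<oplus>\<^bsub>Zp p\<^esub> g x) = \<mu> f \<oplus>\<^bsub>Zp p\<^esub> \<mu> g" if f: "f \<in> quotient_funs p" and g: "g \<in> quotient_funs p" for f g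
    proof (rule eqI)
      show "(\<lambda>x\<in>quotient_space p. f x \<oplus>\<^bsub>Zp p\<^esub> g x) \<in> quotient_funs p"
        by (rule cont_funs_add[OF prime f g])
      show "\<mu> f \<oplus>\<^bsub>Zp p\<^esub> \<mu> g \<in> carrier (Zp p)"
        by (rule Z.add.m_closed[OF carrier[OF f] carrier[OF g]])
      show "represents p m (\<lambda>n. l n N) N (restrict_int p (\<lambda>x\<in>quotient_space p. f x \<oplus>\<^bsub>Zp p\<^esub> g x) N)
          ((\<mu> f \<oplus>\<^bsub>Zp p\<^esub> \<mu> g) N)" for N
        by (rule represents_cong[OF represents_add[OF rep[OF f] rep[OF g]]])
          (simp_all add: restrict_int_def pm_class_in_topspace[OF prime] Zp_of_int_Units[OF prime] Zp_simps cong_def)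
    qed
    show "\<mu> (\<lambda>x\<in>quotient_space p. c \<otimes>\<^bsub>Zp p\<^esub> f x) = c \<otimes>\<^bsub>Zp p\<^esub> \<mu> f" if c: "c \<in> carrier (Zp p)" and f: "f \<in> quotient_funs p" for c f
    proof (rule eqI)
      show "(\<lambda>x\<in>quotient_space p. c \<otimes>\<^bsub>Zp p\<^esub> f x) \<in> quotient_funs p"
        by (rule cont_funs_scale[OF prime f c])
      show "c \<otimes>\<^bsub>Zp p\<^esub> \<mu> f \<in> carrier (Zp p)"
        by (rule Z.m_closed[OF c carrier[OF f]])
      show "represents p m (\<lambda>n. l n N) N (restrict_int p (\<lambda>x\<in>quotient_space p. c \<otimes>\<^bsub>Zp p\<^esub> f x) N) ((c \<otimes>\<^bsub>Zp p\<^esub> \<mu> f) N)" for N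
        by (rule represents_cong[OF represents_scale[OF rep[OF f], where c = "c N"]])
          (simp_all add: restrict_int_def pm_class_in_topspace[OF prime] Zp_of_int_Units[OF prime] Zp_simps cong_def)
    qed
  qed
  then show ?thesis
    using rep that by blast
qed

text \<open>The expansion is triangular: x^(2(n+m)) is a multiple of the basis function of index 2n
  plus lower even powers. By hypothesis b obeys the same recursion, so strong induction
  applies.\<close>

lemma represents_power:
  assumes l: "\<And>n. [b (n + m) = int p ^ basis_val p (2 * n) * l (2 * n) +
      (\<Sum>i=m..<n + m. c_coeffs p n (2 * (i - m)) * b i)] (mod int p ^ N)"
    and "k \<ge> m"
  shows "represents p m l N (\<lambda>x. x ^ (2 * k)) (b k)"
  using assms(2)
proof (induction k rule: less_induct)
  case (less k)
  obtain n where k: "k = n + m"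
    using less.prems by (metis le_add_diff_inverse2)
  have "represents p m l N (\<lambda>x. int p ^ basis_val p (2 * n) * twisted_basis p m (2 * n) x +
      (\<Sum>i=m..<n + m. c_coeffs p n (2 * (i - m)) * x ^ (2 * i)))
    (int p ^ basis_val p (2 * n) * l (2 * n) + (\<Sum>i=m..<n + m. c_coeffs p n (2 * (i - m)) * b i))"
    using less.IH k
    by (intro represents_add represents_scale represents_basis represents_sum) auto
  then show ?case
  proof (rule represents_cong)
    show "[x ^ (2 * k) = int p ^ basis_val p (2 * n) * twisted_basis p m (2 * n) x +
        (\<Sum>i=m..<n + m. c_coeffs p n (2 * (i - m)) * x ^ (2 * i))] (mod int p ^ N)" if "\<not> int p dvd x" for x
      unfolding twisted_basis_expansion[OF prime that] k by simp
    show "[b k = int p ^ basis_val p (2 * n) * l (2 * n) +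
        (\<Sum>i=m..<n + m. c_coeffs p n (2 * (i - m)) * b i)] (mod int p ^ N)"
      unfolding k by (rule l)
  qed
qed

end

theorem corollary2p3p7:
  fixes p m :: nat and b :: "nat \<Rightarrow> nat \<Rightarrow> int"
  assumes "prime p"
    and "\<And>k. k \<ge> 2 * m \<Longrightarrow> b k \<in> carrier (Zp p)"
    and "\<And>k. k \<ge> 2 * m \<Longrightarrow> odd k \<Longrightarrow> b k = \<zero>\<^bsub>Zp p\<^esub>"
  shows "(\<exists>\<mu>\<in>Meas p (Zp_units_mod_pm_topology p).
            \<forall>k\<ge>m. b (2 * k) = \<mu> (descend p (\<lambda>x. x [^]\<^bsub>Zp p\<^esub> (2 * k)))) \<longleftrightarrow>
         (\<forall>k\<ge>m. b (2 * k) \<ominus>\<^bsub>Zp p\<^esub>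
              (\<Oplus>\<^bsub>Zp p\<^esub>i\<in>{m..<k}. [c_coeffs p (k - m) (2 * (i - m))] \<cdot>\<^bsub>Zp p\<^esub> b (2 * i))
            \<in> PIdl\<^bsub>Zp p\<^esub> ([C_const p (k - m)] \<cdot>\<^bsub>Zp p\<^esub> \<one>\<^bsub>Zp p\<^esub>))"
proof -
  interpret Z: cring "Zp p"
    by (rule cring_Zp[OF prime_gt_0_nat[OF assms(1)]])
  define z where "z k = b (2 * k) \<ominus>\<^bsub>Zp p\<^esub>
    (\<Oplus>\<^bsub>Zp p\<^esub>i\<in>{m..<k}. [c_coeffs p (k - m) (2 * (i - m))] \<cdot>\<^bsub>Zp p\<^esub> b (2 * i))" for k
  have b: "b (2 * k) \<in> carrier (Zp p)" if "k \<ge> m" for k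
    using assms(2) that by simp
  have cb: "[(c :: int)] \<cdot>\<^bsub>Zp p\<^esub> b (2 * i) \<in> carrier (Zp p)" if "i \<ge> m" for c i
    using Z.add.int_pow_closed b[OF that] by blast
  have sum: "(\<Oplus>\<^bsub>Zp p\<^esub>i\<in>{m..<k}. [c_coeffs p (k - m) (2 * (i - m))] \<cdot>\<^bsub>Zp p\<^esub> b (2 * i)) \<in> carrier (Zp p)" for k
    using cb by (intro Z.finsum_closed) auto
  have z: "z k \<in> carrier (Zp p)" if "k \<ge> m" for k
    unfolding z_def by (rule Z.minus_closed[OF b[OF that] sum])
  have zN: "z k N = (b (2 * k) N - (\<Sum>i=m..<k. c_coeffs p (k - m) (2 * (i - m)) * b (2 * i) N)) mod int p ^ N"
    if "k \<ge> m" for k N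
  proof -
    have "(\<Oplus>\<^bsub>Zp p\<^esub>i\<in>{m..<k}. [c_coeffs p (k - m) (2 * (i - m))] \<cdot>\<^bsub>Zp p\<^esub> b (2 * i)) N =
        (\<Sum>i=m..<k. ([c_coeffs p (k - m) (2 * (i - m))] \<cdot>\<^bsub>Zp p\<^esub> b (2 * i)) N) mod int p ^ N"
      using cb by (intro Zp_finsum_apply[OF assms(1)]) auto
    also have "\<dots> = (\<Sum>i=m..<k. c_coeffs p (k - m) (2 * (i - m)) * b (2 * i) N mod int p ^ N) mod int p ^ N"
      using b by (intro arg_cong[of _ _ "\<lambda>s. s mod int p ^ N"] sum.cong refl Zp_int_add_pow_apply[OF assms(1)]) simp
    also have "\<dots> = (\<Sum>i=m..<k. c_coeffs p (k - m) (2 * (i - m)) * b (2 * i) N) mod int p ^ N"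
      by (rule mod_sum_eq)
    finally show ?thesis
      unfolding z_def Zp_minus_apply[OF assms(1) b[OF that] sum] by (simp add: mod_simps)
  qed
  \<comment> \<open>Since C_p(k - m) Z_p is generated by a power of p, the congruence in (b) is the
    vanishing of one coordinate of the difference z k of its two sides.\<close>
  have ideal: "z k \<in> PIdl\<^bsub>Zp p\<^esub> ([C_const p (k - m)] \<cdot>\<^bsub>Zp p\<^esub> \<one>\<^bsub>Zp p\<^esub>) \<longleftrightarrow>
      z k (basis_val p (2 * (k - m))) = 0" if "k \<ge> m" for k
    using z[OF that] by (intro in_PIdl_iff[OF assms(1)] basis_val_eq_multiplicity[OF assms(1)])
      (auto simp: C_const_def intro!: prod_pos)
  show ?thesis
    unfolding z_def[symmetric]
  proof (intro iffI allI impI)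
    fix k assume k: "k \<ge> m"
    assume "\<exists>\<mu>\<in>Meas p (Zp_units_mod_pm_topology p). \<forall>k\<ge>m. b (2 * k) = \<mu> (descend p (\<lambda>x. x [^]\<^bsub>Zp p\<^esub> (2 * k)))"
    then obtain \<mu> where \<mu>: "\<mu> \<in> Meas p (Zp_units_mod_pm_topology p)"
      and mom: "\<And>k. k \<ge> m \<Longrightarrow> \<mu> (descend p (\<lambda>x. x [^]\<^bsub>Zp p\<^esub> (2 * k))) = b (2 * k)"
      by auto
    define n where "n = k - m"
    define v where "v = basis_val p (2 * n)"
    have kn: "k = n + m"
      using k by (simp add: n_def)
    have "[\<mu> (descend p (\<lambda>x. x [^]\<^bsub>Zp p\<^esub> (2 * (n + m)))) v =
        int p ^ v * \<mu> (descend p (basis_lift p m n)) v +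
        (\<Sum>i=m..<n + m. c_coeffs p n (2 * (i - m)) * \<mu> (descend p (\<lambda>x. x [^]\<^bsub>Zp p\<^esub> (2 * i))) v)] (mod int p ^ v)"
      unfolding v_def by (rule moment_congruence[OF assms(1) \<mu>])
    moreover have "(\<Sum>i=m..<n + m. c_coeffs p n (2 * (i - m)) * \<mu> (descend p (\<lambda>x. x [^]\<^bsub>Zp p\<^esub> (2 * i))) v) =
        (\<Sum>i=m..<n + m. c_coeffs p n (2 * (i - m)) * b (2 * i) v)"
      by (intro sum.cong refl) (simp add: mom)
    moreover have "\<mu> (descend p (\<lambda>x. x [^]\<^bsub>Zp p\<^esub> (2 * (n + m)))) = b (2 * (n + m))"
      by (rule mom) simp
    ultimately have "[b (2 * (n + m)) v = int p ^ v * \<mu> (descend p (basis_lift p m n)) v +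
        (\<Sum>i=m..<n + m. c_coeffs p n (2 * (i - m)) * b (2 * i) v)] (mod int p ^ v)"
      by (simp only:)
    then have "[b (2 * k) v - (\<Sum>i=m..<k. c_coeffs p n (2 * (i - m)) * b (2 * i) v) =
        int p ^ v * \<mu> (descend p (basis_lift p m n)) v] (mod int p ^ v)"
      unfolding kn cong_iff_dvd_diff by (simp only: diff_diff_eq add.commute)
    \<comment> \<open>At level v the remaining term, a multiple of p^v, is zero.\<close>
    then have "z k v = 0"
      unfolding zN[OF k] by (simp add: cong_def n_def)
    then show "z k \<in> PIdl\<^bsub>Zp p\<^esub> ([C_const p (k - m)] \<cdot>\<^bsub>Zp p\<^esub> \<one>\<^bsub>Zp p\<^esub>)"
      using ideal[OF k] by (simp add: v_def n_def)
  next
    assume *: "\<forall>k\<ge>m. z k \<in> PIdl\<^bsub>Zp p\<^esub> ([C_const p (k - m)] \<cdot>\<^bsub>Zp p\<^esub> \<one>\<^bsub>Zp p\<^esub>)"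
    \<comment> \<open>w is the integral that the moments force on the basis function of index 2n;
      (b) is what makes the division by p^\<open>basis_val\<close> possible.\<close>
    have "\<exists>w\<in>carrier (Zp p). \<forall>N. z (n + m) N = int p ^ basis_val p (2 * n) * w N mod int p ^ N" for n
    proof -
      have "z (n + m) (basis_val p (2 * n)) = 0"
        using *[rule_format, of "n + m"] ideal[of "n + m"] by simp
      then show ?thesis
        using Zp_divide[OF assms(1) z[of "n + m"]] by simp
    qed
    then have "\<forall>n. \<exists>w. w \<in> carrier (Zp p) \<and> (\<forall>N. z (n + m) N = int p ^ basis_val p (2 * n) * w N mod int p ^ N)"
      by blast
    then obtain w where w: "\<And>n. w n \<in> carrier (Zp p)"
      "\<And>n N. z (n + m) N = int p ^ basis_val p (2 * n) * w n N mod int p ^ N"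
      unfolding choice_iff by blast
    \<comment> \<open>The values at the odd basis functions are arbitrary: what is prescribed is a measure on the
      units, which is then pushed forward to the quotient.\<close>
    define l where "l n = (if even n then w (n div 2) else \<zero>\<^bsub>Zp p\<^esub>)" for n
    have "l n \<in> carrier (Zp p)" for n
      using w(1) Z.zero_closed by (simp add: l_def)
    then obtain \<mu> where \<mu>: "\<mu> \<in> Meas p (Zp_units_mod_pm_topology p)"
      and rep: "\<And>f N. f \<in> cont_funs p (Zp_units_mod_pm_topology p) \<Longrightarrow>
        represents p m (\<lambda>n. l n N) N (restrict_int p f N) (\<mu> f N)"
      using Meas_interpolation[OF assms(1), of l m] by blast
    have "b (2 * k) = \<mu> (descend p (\<lambda>x. x [^]\<^bsub>Zp p\<^esub> (2 * k)))" if k: "k \<ge> m" for k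
    proof
      fix N
      let ?f = "descend p (\<lambda>x. x [^]\<^bsub>Zp p\<^esub> (2 * k))"
      have f: "?f \<in> cont_funs p (Zp_units_mod_pm_topology p)"
        by (rule descend_even_power_in_cont_funs[OF prime_gt_0_nat[OF assms(1)]])
      have "[b (2 * (n + m)) N = int p ^ basis_val p (2 * n) * l (2 * n) N +
          (\<Sum>i=m..<n + m. c_coeffs p n (2 * (i - m)) * b (2 * i) N)] (mod int p ^ N)" for n
      proof -
        have "[b (2 * (n + m)) N - (\<Sum>i=m..<n + m. c_coeffs p n (2 * (i - m)) * b (2 * i) N) =
            int p ^ basis_val p (2 * n) * l (2 * n) N] (mod int p ^ N)"
          using w(2)[of n N] zN[of "n + m" N] by (simp add: cong_def l_def)
        then show ?thesis
          by (simp add: cong_iff_dvd_diff algebra_simps)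
      qed
      then have "represents p m (\<lambda>n. l n N) N (\<lambda>x. x ^ (2 * k)) (b (2 * k) N)"
        by (rule represents_power[OF assms(1), where b = "\<lambda>k. b (2 * k) N"]) (rule k)
      moreover have "represents p m (\<lambda>n. l n N) N (\<lambda>x. x ^ (2 * k)) (\<mu> ?f N)"
      proof (rule represents_cong[OF rep[OF f]])
        fix x assume "\<not> int p dvd x"
        then have "Zp_of_int p x \<in> Units (Zp p)"
          by (rule Zp_of_int_Units[OF assms(1)])
        then have "restrict_int p ?f N x = (x mod int p ^ N) ^ (2 * k) mod int p ^ N"
          unfolding restrict_int_def by (simp only: descend_power_pm_class[OF assms(1)] Zp_of_int_def)
        then show "[x ^ (2 * k) = restrict_int p ?f N x] (mod int p ^ N)"
          by (simp add: cong_def power_mod)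
      qed simp
      ultimately have "[b (2 * k) N = \<mu> ?f N] (mod int p ^ N)"
        by (rule represents_unique[OF assms(1)])
      then show "b (2 * k) N = \<mu> ?f N"
        using Zp_mod_self[OF b[OF k], of N] Zp_mod_self[OF Meas_cases(1)[OF \<mu> f], of N] by (simp add: cong_def)
    qed
    then show "\<exists>\<mu>\<in>Meas p (Zp_units_mod_pm_topology p).
        \<forall>k\<ge>m. b (2 * k) = \<mu> (descend p (\<lambda>x. x [^]\<^bsub>Zp p\<^esub> (2 * k)))"
      using \<mu> by blast
  qed
qed

end
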